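(* If $\mathbb{D}$ is a Cartesian and fibrant double category with Eilenberg-Moore objects for co-pointed endomorphisms, then $\mathbb{D}$ has tabulators. If moreover the Eilenberg-Moore objects are strong, then the tabulators are strong as well.
   Context: A (pseudo) double category $\mathbb D$ consists of: a category $D_0$ (objects and vertical arrows of $\mathbb D$); a category $D_1$ (its objects are called horizontal arrows, its arrows cells); functors $S,T:D_1\to D_0$, $U:D_0\to D_1$ and $\odot:D_1\times_{D_0}D_1\to D_1$ (defined on pairs $(M,N)$ with $SM=TN$) such that $SU=TU=\mathrm{id}$, $S(M\odot N)=SN$, $T(M\odot N)=TM$; and natural isomorphisms $(M\odot N)\odot P\cong M\odot(N\odot P)$, $U_{TM}\odot M\cong M$, $M\odot U_{SM}\cong M$ in $D_1$ whose components have identity source and target under $S,T$ and satisfy the pentagon and triangle axioms. Write $M:A\nrightarrow B$ if $SM=A$, $TM=B$. A cell $\alpha:M\to N$ with $S\alpha=f$, $T\alpha=g$ has sides $(f,g)$; it is globular if both sides are identities. $\mathcal H(\mathbb D)$ is the bicategory of objects, horizontal arrows and globular cells, with composition $\odot$. A lax double functor $F:\mathbb B\to\mathbb D$ consists of functors $F_0,F_1$ (on the categories $B_0$, $B_1$) commuting with $S,T$ and natural globular cells $F_1M\odot F_1N\to F_1(M\odot N)$, $U_{F_0A}\to F_1U_A$ satisfying the usual coherence axioms; it is a (pseudo) double functor if these are invertible. A vertical natural transformation $F\to G$ is a pair of natural transformations $\phi_0:F_0\to G_0$, $\phi_1:F_1\to G_1$ with $S\phi_M=\phi_{SM}$, $T\phi_M=\phi_{TM}$,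 compatible with the structure cells. $\mathbf{DblCat}$ is the 2-category of double categories, double functors and vertical natural transformations. $\mathbb D$ is Cartesian if the diagonal $\Delta:\mathbb D\to\mathbb D\times\mathbb D$ and the unique $!:\mathbb D\to\mathbb 1$ have right adjoints in $\mathbf{DblCat}$. A cell $\alpha:M\to N$ with sides $(f,g)$ is Cartesian if every cell $M'\to N$ with sides $(fh,gk)$ factors as $\alpha\circ\gamma$ for a unique cell $\gamma:M'\to M$ with sides $(h,k)$; op-Cartesian is the dual notion. $\mathbb D$ is fibrant if for all vertical $f:A\to B$, $g:C\to D$ and $M:B\nrightarrow D$ there is a Cartesian cell into $M$ with sides $(f,g)$. For $f:A\to B$, $f_*:A\nrightarrow B$ (resp. $f^*:B\nrightarrow A$) is the domain of a Cartesian cell into $U_B$ with sides $(f,1_B)$ (resp. $(1_B,f)$). In a fibrant double category $g_*\odot M\odot f^*$ is the codomain of an op-Cartesian cell out of $M$ with sides $(f,g)$. A co-pointed endomorphism is a horizontal arrow $P:A\nrightarrow A$ with a globular cell $\epsilon_P:P\to U_A$. The category $\mathbf{Copt}(\mathbb D)_0$ has these as objects; a morphism $(A,P)\to(B,R)$ is a vertical arrow $f:A\to B$ with a cell $\phi:P\to R$ with sides $(f,f)$ such that $\epsilon_R\circ\phi=U_f\circ\epsilon_P$. $\mathbb D$ has Eilenberg-Moore objects for co-pointed endomorphisms if the inclusion $D_0\to\mathbf{Copt}(\mathbb D)_0$, $A\mapsto(U_A,\mathrm{id})$, $f\mapsto(f,U_f)$, has a right adjoint $EM$; the counit at $P:A\nrightarrow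 A$ is a cell $\theta_P:U_{EM(P)}\to P$ with sides $(u,u)$, $u:EM(P)\to A$. They are strong (for $\mathbb D$ fibrant) if $P\cong u_*\odot u^*$ in $\mathcal H(\mathbb D)$ for every co-pointed endomorphism $P$. $\mathbb D$ has tabulators if $U:D_0\to D_1$ has a right adjoint; i.e. for each $F:A\nrightarrow X$ there are an object $T$ and a cell $\iota:U_T\to F$ with sides $(q_1,q_2)$ such that every cell $\beta:U_H\to F$ equals $\iota\circ U_b$ for a unique vertical $b:H\to T$. For $\mathbb D$ fibrant, the tabulators are strong if for every $F$ the globular cell ${q_2}_*\odot q_1^*\to F$ induced by $\iota$ via the universal property of the op-Cartesian cell $U_T\to{q_2}_*\odot q_1^*$ is invertible.
   Formalization: "Strong" Eilenberg-Moore objects are taken to mean that the canonical globular cell u_*⊙u^* → P induced by the counit θ_P is invertible; with a mere unrelated isomorphism P ≅ u_*⊙u^* the second claim is false. *)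

theory Defs
  imports Main
begin

section \<open>Categories, functors, adjunctions\<close>

record ('o, 'a) cat =
  Ob :: "'o set"
  Ar :: "'a set"
  Dom :: "'a \<Rightarrow> 'o"
  Cod :: "'a \<Rightarrow> 'o"
  Ide :: "'o \<Rightarrow> 'a"
  Cmp :: "'a \<Rightarrow> 'a \<Rightarrow> 'a"  (infixl "\<cdot>\<index>" 65)

text \<open>Composition is written in applicative order: \<open>g \<cdot> f\<close> is first \<open>f\<close>, then \<open>g\<close>.
  All operations are meaningful on the carriers only.\<close>

definition hom :: "('o, 'a) cat \<Rightarrow> 'o \<Rightarrow> 'o \<Rightarrow> 'a set" where
  "hom C x y = {f \<in> Ar C. Dom C f = x \<and> Cod C f = y}"

locale category =
  fixes C :: "('o, 'a) cat"
  assumes dom_Ob: "f \<in> Ar C \<Longrightarrow> Dom C f \<in> Ob C"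
    and cod_Ob: "f \<in> Ar C \<Longrightarrow> Cod C f \<in> Ob C"
    and ide_hom: "x \<in> Ob C \<Longrightarrow> Ide C x \<in> hom C x x"
    and cmp_hom: "\<lbrakk>f \<in> hom C x y; g \<in> hom C y z\<rbrakk> \<Longrightarrow> g \<cdot>\<^bsub>C\<^esub> f \<in> hom C x z"
    and cmp_ide: "f \<in> hom C x y \<Longrightarrow> f \<cdot>\<^bsub>C\<^esub> Ide C x = f"
    and ide_cmp: "f \<in> hom C x y \<Longrightarrow> Ide C y \<cdot>\<^bsub>C\<^esub> f = f"
    and cmp_assoc: "\<lbrakk>f \<in> hom C w x; g \<in> hom C x y; h \<in> hom C y z\<rbrakk>
      \<Longrightarrow> (h \<cdot>\<^bsub>C\<^esub> g) \<cdot>\<^bsub>C\<^esub> f = h \<cdot>\<^bsub>C\<^esub> (g \<cdot>\<^bsub>C\<^esub> f)"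

definition invertible :: "('o, 'a) cat \<Rightarrow> 'a \<Rightarrow> bool" where
  "invertible C f \<longleftrightarrow> f \<in> Ar C \<and> (\<exists>g \<in> hom C (Cod C f) (Dom C f).
     g \<cdot>\<^bsub>C\<^esub> f = Ide C (Dom C f) \<and> f \<cdot>\<^bsub>C\<^esub> g = Ide C (Cod C f))"

record ('o, 'a, 'p, 'b) fctr =
  FO :: "'o \<Rightarrow> 'p"
  FA :: "'a \<Rightarrow> 'b"

locale cat_functor = A: category C + B: category D
  for C :: "('o, 'a) cat" and D :: "('p, 'b) cat" +
  fixes F :: "('o, 'a, 'p, 'b) fctr"
  assumes map_Ob: "x \<in> Ob C \<Longrightarrow> FO F x \<in> Ob D"
    and map_hom: "f \<in> hom C x y \<Longrightarrow> FA F f \<in> hom D (FO F x) (FO F y)"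
    and map_ide: "x \<in> Ob C \<Longrightarrow> FA F (Ide C x) = Ide D (FO F x)"
    and map_cmp: "\<lbrakk>f \<in> hom C x y; g \<in> hom C y z\<rbrakk>
      \<Longrightarrow> FA F (g \<cdot>\<^bsub>C\<^esub> f) = FA F g \<cdot>\<^bsub>D\<^esub> FA F f"

definition id_fctr :: "('o, 'a, 'o, 'a) fctr" where
  "id_fctr = \<lparr>FO = (\<lambda>x. x), FA = (\<lambda>f. f)\<rparr>"

definition comp_fctr ::
  "('p, 'b, 'q, 'c) fctr \<Rightarrow> ('o, 'a, 'p, 'b) fctr \<Rightarrow> ('o, 'a, 'q, 'c) fctr" where
  "comp_fctr G F = \<lparr>FO = FO G \<circ> FO F, FA = FA G \<circ> FA F\<rparr>"

locale nat_trans = F: cat_functor C D F + G: cat_functor C D G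
  for C :: "('o, 'a) cat" and D :: "('p, 'b) cat" and F G +
  fixes \<tau> :: "'o \<Rightarrow> 'b"
  assumes component: "x \<in> Ob C \<Longrightarrow> \<tau> x \<in> hom D (FO F x) (FO G x)"
    and naturality: "f \<in> hom C x y \<Longrightarrow> \<tau> y \<cdot>\<^bsub>D\<^esub> FA F f = FA G f \<cdot>\<^bsub>D\<^esub> \<tau> x"

text \<open>\<open>F : C \<rightarrow> D\<close> is left adjoint to \<open>G : D \<rightarrow> C\<close>, with unit \<open>\<eta>\<close> and counit \<open>\<epsilon>\<close>.\<close>

locale adjunction = L: cat_functor C D F + R: cat_functor D C G
  + unit: nat_trans C C id_fctr "comp_fctr G F" \<eta>
  + counit: nat_trans D D "comp_fctr F G" id_fctr \<epsilon>
  for C :: "('o, 'a) cat" and D :: "('p, 'b) cat" and F G \<eta> \<epsilon> +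
  assumes triangle_left: "x \<in> Ob C \<Longrightarrow> \<epsilon> (FO F x) \<cdot>\<^bsub>D\<^esub> FA F (\<eta> x) = Ide D (FO F x)"
    and triangle_right: "y \<in> Ob D \<Longrightarrow> FA G (\<epsilon> y) \<cdot>\<^bsub>C\<^esub> \<eta> (FO G y) = Ide C (FO G y)"

definition prod_cat :: "('o, 'a) cat \<Rightarrow> ('p, 'b) cat \<Rightarrow> ('o \<times> 'p, 'a \<times> 'b) cat" where
  "prod_cat C D = \<lparr>Ob = Ob C \<times> Ob D, Ar = Ar C \<times> Ar D,
     Dom = map_prod (Dom C) (Dom D), Cod = map_prod (Cod C) (Cod D),
     Ide = map_prod (Ide C) (Ide D),
     Cmp = (\<lambda>(g, g') (f, f'). (g \<cdot>\<^bsub>C\<^esub> f, g' \<cdot>\<^bsub>D\<^esub> f'))\<rparr>"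

definition prod_fctr :: "('o, 'a, 'p, 'b) fctr \<Rightarrow> ('o2, 'a2, 'p2, 'b2) fctr
    \<Rightarrow> ('o \<times> 'o2, 'a \<times> 'a2, 'p \<times> 'p2, 'b \<times> 'b2) fctr" where
  "prod_fctr F G = \<lparr>FO = map_prod (FO F) (FO G), FA = map_prod (FA F) (FA G)\<rparr>"

definition terminal_cat :: "(unit, unit) cat" where
  "terminal_cat = \<lparr>Ob = UNIV, Ar = UNIV, Dom = (\<lambda>_. ()), Cod = (\<lambda>_. ()),
     Ide = (\<lambda>_. ()), Cmp = (\<lambda>_ _. ())\<rparr>"

definition const_unit :: "('o, 'a, unit, unit) fctr" where
  "const_unit = \<lparr>FO = (\<lambda>_. ()), FA = (\<lambda>_. ())\<rparr>"


section \<open>Pseudo double categories\<close>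

text \<open>\<open>VCat\<close> is the category of objects and vertical arrows, \<open>HCat\<close> the category of
  horizontal arrows and cells. \<open>Asc M N P : (M \<odot> N) \<odot> P \<rightarrow> M \<odot> (N \<odot> P)\<close>,
  \<open>Lun M : U (T M) \<odot> M \<rightarrow> M\<close>, \<open>Run M : M \<odot> U (S M) \<rightarrow> M\<close>.\<close>

record ('o, 'v, 'h, 'c) dblcat =
  VCat :: "('o, 'v) cat"
  HCat :: "('h, 'c) cat"
  Src :: "('h, 'c, 'o, 'v) fctr"
  Tgt :: "('h, 'c, 'o, 'v) fctr"
  Unt :: "('o, 'v, 'h, 'c) fctr"
  Hcmp :: "('h \<times> 'h, 'c \<times> 'c, 'h, 'c) fctr"
  Asc :: "'h \<Rightarrow> 'h \<Rightarrow> 'h \<Rightarrow> 'c"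
  Lun :: "'h \<Rightarrow> 'c"
  Run :: "'h \<Rightarrow> 'c"

abbreviation hsrc :: "('o, 'v, 'h, 'c) dblcat \<Rightarrow> 'h \<Rightarrow> 'o" where "hsrc D \<equiv> FO (Src D)"
abbreviation htgt :: "('o, 'v, 'h, 'c) dblcat \<Rightarrow> 'h \<Rightarrow> 'o" where "htgt D \<equiv> FO (Tgt D)"
abbreviation csrc :: "('o, 'v, 'h, 'c) dblcat \<Rightarrow> 'c \<Rightarrow> 'v" where "csrc D \<equiv> FA (Src D)"
abbreviation ctgt :: "('o, 'v, 'h, 'c) dblcat \<Rightarrow> 'c \<Rightarrow> 'v" where "ctgt D \<equiv> FA (Tgt D)"
abbreviation hunit :: "('o, 'v, 'h, 'c) dblcat \<Rightarrow> 'o \<Rightarrow> 'h" where "hunit D \<equiv> FO (Unt D)"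
abbreviation cunit :: "('o, 'v, 'h, 'c) dblcat \<Rightarrow> 'v \<Rightarrow> 'c" where "cunit D \<equiv> FA (Unt D)"

abbreviation hcomp :: "('o, 'v, 'h, 'c) dblcat \<Rightarrow> 'h \<Rightarrow> 'h \<Rightarrow> 'h"  (infixl "\<odot>\<index>" 70)
  where "M \<odot>\<^bsub>D\<^esub> N \<equiv> FO (Hcmp D) (M, N)"
abbreviation ccomp :: "('o, 'v, 'h, 'c) dblcat \<Rightarrow> 'c \<Rightarrow> 'c \<Rightarrow> 'c"  (infixl "\<star>\<index>" 70)
  where "\<alpha> \<star>\<^bsub>D\<^esub> \<beta> \<equiv> FA (Hcmp D) (\<alpha>, \<beta>)"
abbreviation vcomp :: "('o, 'v, 'h, 'c) dblcat \<Rightarrow> 'v \<Rightarrow> 'v \<Rightarrow> 'v"  (infixl "\<cdot>\<^sub>0\<index>" 65)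
  where "g \<cdot>\<^sub>0\<^bsub>D\<^esub> f \<equiv> g \<cdot>\<^bsub>VCat D\<^esub> f"
abbreviation cvcomp :: "('o, 'v, 'h, 'c) dblcat \<Rightarrow> 'c \<Rightarrow> 'c \<Rightarrow> 'c"  (infixl "\<cdot>\<^sub>1\<index>" 65)
  where "\<beta> \<cdot>\<^sub>1\<^bsub>D\<^esub> \<alpha> \<equiv> \<beta> \<cdot>\<^bsub>HCat D\<^esub> \<alpha>"

definition cells :: "('o, 'v, 'h, 'c) dblcat \<Rightarrow> 'v \<Rightarrow> 'v \<Rightarrow> 'h \<Rightarrow> 'h \<Rightarrow> 'c set" where
  "cells D f g M N = {\<alpha> \<in> hom (HCat D) M N. csrc D \<alpha> = f \<and> ctgt D \<alpha> = g}"

definition globular :: "('o, 'v, 'h, 'c) dblcat \<Rightarrow> 'h \<Rightarrow> 'h \<Rightarrow> 'c set" where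
  "globular D M N = cells D (Ide (VCat D) (hsrc D M)) (Ide (VCat D) (htgt D M)) M N"

text \<open>The pullback of \<open>HCat\<close> with itself over \<open>VCat\<close>, on which \<open>Hcmp\<close> is defined.\<close>

definition hpairs :: "('o, 'v, 'h, 'c) dblcat \<Rightarrow> ('h \<times> 'h, 'c \<times> 'c) cat" where
  "hpairs D = (prod_cat (HCat D) (HCat D))
     \<lparr>Ob := {(M, N). M \<in> Ob (HCat D) \<and> N \<in> Ob (HCat D) \<and> hsrc D M = htgt D N},
      Ar := {(\<alpha>, \<beta>). \<alpha> \<in> Ar (HCat D) \<and> \<beta> \<in> Ar (HCat D) \<and> csrc D \<alpha> = ctgt D \<beta>}\<rparr>"

locale double_category =
  S: cat_functor "HCat D" "VCat D" "Src D" +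
  T: cat_functor "HCat D" "VCat D" "Tgt D" +
  U: cat_functor "VCat D" "HCat D" "Unt D" +
  H: cat_functor "hpairs D" "HCat D" "Hcmp D"
  for D :: "('o, 'v, 'h, 'c) dblcat" +
  assumes unit_Ob: "A \<in> Ob (VCat D) \<Longrightarrow> hsrc D (hunit D A) = A \<and> htgt D (hunit D A) = A"
    and unit_Ar: "f \<in> Ar (VCat D) \<Longrightarrow> csrc D (cunit D f) = f \<and> ctgt D (cunit D f) = f"
    and hcomp_Ob: "(M, N) \<in> Ob (hpairs D)
      \<Longrightarrow> hsrc D (M \<odot>\<^bsub>D\<^esub> N) = hsrc D N \<and> htgt D (M \<odot>\<^bsub>D\<^esub> N) = htgt D M"
    and hcomp_Ar: "(\<alpha>, \<beta>) \<in> Ar (hpairs D)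
      \<Longrightarrow> csrc D (\<alpha> \<star>\<^bsub>D\<^esub> \<beta>) = csrc D \<beta> \<and> ctgt D (\<alpha> \<star>\<^bsub>D\<^esub> \<beta>) = ctgt D \<alpha>"
    and assoc_cell: "\<lbrakk>(M, N) \<in> Ob (hpairs D); (N, P) \<in> Ob (hpairs D)\<rbrakk>
      \<Longrightarrow> Asc D M N P \<in> globular D ((M \<odot>\<^bsub>D\<^esub> N) \<odot>\<^bsub>D\<^esub> P) (M \<odot>\<^bsub>D\<^esub> (N \<odot>\<^bsub>D\<^esub> P))
        \<and> invertible (HCat D) (Asc D M N P)"
    and assoc_natural: "\<lbrakk>\<alpha> \<in> hom (HCat D) M M'; \<beta> \<in> hom (HCat D) N N'; \<gamma> \<in> hom (HCat D) P P';
        csrc D \<alpha> = ctgt D \<beta>; csrc D \<beta> = ctgt D \<gamma>\<rbrakk>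
      \<Longrightarrow> Asc D M' N' P' \<cdot>\<^sub>1\<^bsub>D\<^esub> ((\<alpha> \<star>\<^bsub>D\<^esub> \<beta>) \<star>\<^bsub>D\<^esub> \<gamma>) = (\<alpha> \<star>\<^bsub>D\<^esub> (\<beta> \<star>\<^bsub>D\<^esub> \<gamma>)) \<cdot>\<^sub>1\<^bsub>D\<^esub> Asc D M N P"
    and lunit_cell: "M \<in> Ob (HCat D)
      \<Longrightarrow> Lun D M \<in> globular D (hunit D (htgt D M) \<odot>\<^bsub>D\<^esub> M) M \<and> invertible (HCat D) (Lun D M)"
    and lunit_natural: "\<alpha> \<in> hom (HCat D) M M'
      \<Longrightarrow> Lun D M' \<cdot>\<^sub>1\<^bsub>D\<^esub> (cunit D (ctgt D \<alpha>) \<star>\<^bsub>D\<^esub> \<alpha>) = \<alpha> \<cdot>\<^sub>1\<^bsub>D\<^esub> Lun D M"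
    and runit_cell: "M \<in> Ob (HCat D)
      \<Longrightarrow> Run D M \<in> globular D (M \<odot>\<^bsub>D\<^esub> hunit D (hsrc D M)) M \<and> invertible (HCat D) (Run D M)"
    and runit_natural: "\<alpha> \<in> hom (HCat D) M M'
      \<Longrightarrow> Run D M' \<cdot>\<^sub>1\<^bsub>D\<^esub> (\<alpha> \<star>\<^bsub>D\<^esub> cunit D (csrc D \<alpha>)) = \<alpha> \<cdot>\<^sub>1\<^bsub>D\<^esub> Run D M"
    and pentagon:
      "\<lbrakk>(M, N) \<in> Ob (hpairs D); (N, P) \<in> Ob (hpairs D); (P, Q) \<in> Ob (hpairs D)\<rbrakk>
      \<Longrightarrow> Asc D M N (P \<odot>\<^bsub>D\<^esub> Q) \<cdot>\<^sub>1\<^bsub>D\<^esub> Asc D (M \<odot>\<^bsub>D\<^esub> N) P Q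
        = (Ide (HCat D) M \<star>\<^bsub>D\<^esub> Asc D N P Q) \<cdot>\<^sub>1\<^bsub>D\<^esub> Asc D M (N \<odot>\<^bsub>D\<^esub> P) Q
            \<cdot>\<^sub>1\<^bsub>D\<^esub> (Asc D M N P \<star>\<^bsub>D\<^esub> Ide (HCat D) Q)"
    and triangle: "(M, N) \<in> Ob (hpairs D)
      \<Longrightarrow> (Ide (HCat D) M \<star>\<^bsub>D\<^esub> Lun D N) \<cdot>\<^sub>1\<^bsub>D\<^esub> Asc D M (hunit D (hsrc D M)) N
        = Run D M \<star>\<^bsub>D\<^esub> Ide (HCat D) N"


section \<open>The 2-category of double categories\<close>

text \<open>\<open>DMul M N : F M \<odot> F N \<rightarrow> F (M \<odot> N)\<close> and \<open>DUni A : U (F A) \<rightarrow> F (U A)\<close> are the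
  structure cells.\<close>

record ('o, 'v, 'h, 'c, 'o2, 'v2, 'h2, 'c2) dfctr =
  DF0 :: "('o, 'v, 'o2, 'v2) fctr"
  DF1 :: "('h, 'c, 'h2, 'c2) fctr"
  DMul :: "'h \<Rightarrow> 'h \<Rightarrow> 'c2"
  DUni :: "'o \<Rightarrow> 'c2"

locale lax_double_functor =
  dom: double_category B + cod: double_category D +
  F0: cat_functor "VCat B" "VCat D" "DF0 F" +
  F1: cat_functor "HCat B" "HCat D" "DF1 F"
  for B :: "('o, 'v, 'h, 'c) dblcat" and D :: "('o2, 'v2, 'h2, 'c2) dblcat" and F +
  assumes src_Ob: "M \<in> Ob (HCat B) \<Longrightarrow> hsrc D (FO (DF1 F) M) = FO (DF0 F) (hsrc B M)"
    and tgt_Ob: "M \<in> Ob (HCat B) \<Longrightarrow> htgt D (FO (DF1 F) M) = FO (DF0 F) (htgt B M)"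
    and src_Ar: "\<alpha> \<in> Ar (HCat B) \<Longrightarrow> csrc D (FA (DF1 F) \<alpha>) = FA (DF0 F) (csrc B \<alpha>)"
    and tgt_Ar: "\<alpha> \<in> Ar (HCat B) \<Longrightarrow> ctgt D (FA (DF1 F) \<alpha>) = FA (DF0 F) (ctgt B \<alpha>)"
    and mul_cell: "(M, N) \<in> Ob (hpairs B)
      \<Longrightarrow> DMul F M N \<in> globular D (FO (DF1 F) M \<odot>\<^bsub>D\<^esub> FO (DF1 F) N) (FO (DF1 F) (M \<odot>\<^bsub>B\<^esub> N))"
    and mul_natural: "\<lbrakk>\<alpha> \<in> hom (HCat B) M M'; \<beta> \<in> hom (HCat B) N N'; csrc B \<alpha> = ctgt B \<beta>\<rbrakk>
      \<Longrightarrow> DMul F M' N' \<cdot>\<^sub>1\<^bsub>D\<^esub> (FA (DF1 F) \<alpha> \<star>\<^bsub>D\<^esub> FA (DF1 F) \<beta>)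
        = FA (DF1 F) (\<alpha> \<star>\<^bsub>B\<^esub> \<beta>) \<cdot>\<^sub>1\<^bsub>D\<^esub> DMul F M N"
    and uni_cell: "A \<in> Ob (VCat B)
      \<Longrightarrow> DUni F A \<in> globular D (hunit D (FO (DF0 F) A)) (FO (DF1 F) (hunit B A))"
    and uni_natural: "f \<in> hom (VCat B) A A'
      \<Longrightarrow> DUni F A' \<cdot>\<^sub>1\<^bsub>D\<^esub> cunit D (FA (DF0 F) f) = FA (DF1 F) (cunit B f) \<cdot>\<^sub>1\<^bsub>D\<^esub> DUni F A"
    and mul_assoc: "\<lbrakk>(M, N) \<in> Ob (hpairs B); (N, P) \<in> Ob (hpairs B)\<rbrakk>
      \<Longrightarrow> FA (DF1 F) (Asc B M N P) \<cdot>\<^sub>1\<^bsub>D\<^esub> DMul F (M \<odot>\<^bsub>B\<^esub> N) P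
            \<cdot>\<^sub>1\<^bsub>D\<^esub> (DMul F M N \<star>\<^bsub>D\<^esub> Ide (HCat D) (FO (DF1 F) P))
        = DMul F M (N \<odot>\<^bsub>B\<^esub> P) \<cdot>\<^sub>1\<^bsub>D\<^esub> (Ide (HCat D) (FO (DF1 F) M) \<star>\<^bsub>D\<^esub> DMul F N P)
            \<cdot>\<^sub>1\<^bsub>D\<^esub> Asc D (FO (DF1 F) M) (FO (DF1 F) N) (FO (DF1 F) P)"
    and mul_lunit: "M \<in> Ob (HCat B)
      \<Longrightarrow> FA (DF1 F) (Lun B M) \<cdot>\<^sub>1\<^bsub>D\<^esub> DMul F (hunit B (htgt B M)) M
            \<cdot>\<^sub>1\<^bsub>D\<^esub> (DUni F (htgt B M) \<star>\<^bsub>D\<^esub> Ide (HCat D) (FO (DF1 F) M))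
        = Lun D (FO (DF1 F) M)"
    and mul_runit: "M \<in> Ob (HCat B)
      \<Longrightarrow> FA (DF1 F) (Run B M) \<cdot>\<^sub>1\<^bsub>D\<^esub> DMul F M (hunit B (hsrc B M))
            \<cdot>\<^sub>1\<^bsub>D\<^esub> (Ide (HCat D) (FO (DF1 F) M) \<star>\<^bsub>D\<^esub> DUni F (hsrc B M))
        = Run D (FO (DF1 F) M)"

locale double_functor = lax_double_functor +
  assumes mul_invertible: "(M, N) \<in> Ob (hpairs B) \<Longrightarrow> invertible (HCat D) (DMul F M N)"
    and uni_invertible: "A \<in> Ob (VCat B) \<Longrightarrow> invertible (HCat D) (DUni F A)"

definition id_dfctr ::
  "('o, 'v, 'h, 'c) dblcat \<Rightarrow> ('o, 'v, 'h, 'c, 'o, 'v, 'h, 'c) dfctr" where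
  "id_dfctr D = \<lparr>DF0 = id_fctr, DF1 = id_fctr,
     DMul = (\<lambda>M N. Ide (HCat D) (M \<odot>\<^bsub>D\<^esub> N)), DUni = (\<lambda>A. Ide (HCat D) (hunit D A))\<rparr>"

text \<open>The first argument of \<open>comp_dfctr\<close> is the codomain of \<open>G\<close>, where the structure cells of
  the composite \<open>G F\<close> are formed.\<close>

definition comp_dfctr :: "('o3, 'v3, 'h3, 'c3) dblcat
    \<Rightarrow> ('o2, 'v2, 'h2, 'c2, 'o3, 'v3, 'h3, 'c3) dfctr
    \<Rightarrow> ('o, 'v, 'h, 'c, 'o2, 'v2, 'h2, 'c2) dfctr
    \<Rightarrow> ('o, 'v, 'h, 'c, 'o3, 'v3, 'h3, 'c3) dfctr" where
  "comp_dfctr E G F = \<lparr>DF0 = comp_fctr (DF0 G) (DF0 F), DF1 = comp_fctr (DF1 G) (DF1 F),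
     DMul = (\<lambda>M N. FA (DF1 G) (DMul F M N) \<cdot>\<^sub>1\<^bsub>E\<^esub> DMul G (FO (DF1 F) M) (FO (DF1 F) N)),
     DUni = (\<lambda>A. FA (DF1 G) (DUni F A) \<cdot>\<^sub>1\<^bsub>E\<^esub> DUni G (FO (DF0 F) A))\<rparr>"

locale vertical_trans =
  F: double_functor B D F + G: double_functor B D G +
  t0: nat_trans "VCat B" "VCat D" "DF0 F" "DF0 G" \<phi>\<^sub>0 +
  t1: nat_trans "HCat B" "HCat D" "DF1 F" "DF1 G" \<phi>\<^sub>1
  for B :: "('o, 'v, 'h, 'c) dblcat" and D :: "('o2, 'v2, 'h2, 'c2) dblcat"
    and F G \<phi>\<^sub>0 \<phi>\<^sub>1 +
  assumes trans_src: "M \<in> Ob (HCat B) \<Longrightarrow> csrc D (\<phi>\<^sub>1 M) = \<phi>\<^sub>0 (hsrc B M)"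
    and trans_tgt: "M \<in> Ob (HCat B) \<Longrightarrow> ctgt D (\<phi>\<^sub>1 M) = \<phi>\<^sub>0 (htgt B M)"
    and trans_mul: "(M, N) \<in> Ob (hpairs B)
      \<Longrightarrow> \<phi>\<^sub>1 (M \<odot>\<^bsub>B\<^esub> N) \<cdot>\<^sub>1\<^bsub>D\<^esub> DMul F M N = DMul G M N \<cdot>\<^sub>1\<^bsub>D\<^esub> (\<phi>\<^sub>1 M \<star>\<^bsub>D\<^esub> \<phi>\<^sub>1 N)"
    and trans_uni: "A \<in> Ob (VCat B)
      \<Longrightarrow> \<phi>\<^sub>1 (hunit B A) \<cdot>\<^sub>1\<^bsub>D\<^esub> DUni F A = DUni G A \<cdot>\<^sub>1\<^bsub>D\<^esub> cunit D (\<phi>\<^sub>0 A)"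

text \<open>Adjunctions in the 2-category of double categories, (pseudo) double functors and vertical
  transformations; \<open>L : B \<rightarrow> D\<close> is the left adjoint. The triangle identities are the
  ordinary ones for the two underlying adjunctions of categories.\<close>

locale double_adjunction =
  L: double_functor B D L + R: double_functor D B R +
  unit: vertical_trans B B "id_dfctr B" "comp_dfctr B R L" \<eta>\<^sub>0 \<eta>\<^sub>1 +
  counit: vertical_trans D D "comp_dfctr D L R" "id_dfctr D" \<epsilon>\<^sub>0 \<epsilon>\<^sub>1 +
  adj0: adjunction "VCat B" "VCat D" "DF0 L" "DF0 R" \<eta>\<^sub>0 \<epsilon>\<^sub>0 +
  adj1: adjunction "HCat B" "HCat D" "DF1 L" "DF1 R" \<eta>\<^sub>1 \<epsilon>\<^sub>1
  for B :: "('o, 'v, 'h, 'c) dblcat" and D :: "('o2, 'v2, 'h2, 'c2) dblcat"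
    and L R \<eta>\<^sub>0 \<eta>\<^sub>1 \<epsilon>\<^sub>0 \<epsilon>\<^sub>1

definition prod_dbl :: "('o, 'v, 'h, 'c) dblcat \<Rightarrow> ('o2, 'v2, 'h2, 'c2) dblcat
    \<Rightarrow> ('o \<times> 'o2, 'v \<times> 'v2, 'h \<times> 'h2, 'c \<times> 'c2) dblcat" where
  "prod_dbl D E = \<lparr>VCat = prod_cat (VCat D) (VCat E), HCat = prod_cat (HCat D) (HCat E),
     Src = prod_fctr (Src D) (Src E), Tgt = prod_fctr (Tgt D) (Tgt E),
     Unt = prod_fctr (Unt D) (Unt E),
     Hcmp = \<lparr>FO = (\<lambda>((M, M'), (N, N')). (M \<odot>\<^bsub>D\<^esub> N, M' \<odot>\<^bsub>E\<^esub> N')),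
             FA = (\<lambda>((\<alpha>, \<alpha>'), (\<beta>, \<beta>')). (\<alpha> \<star>\<^bsub>D\<^esub> \<beta>, \<alpha>' \<star>\<^bsub>E\<^esub> \<beta>'))\<rparr>,
     Asc = (\<lambda>(M, M') (N, N') (P, P'). (Asc D M N P, Asc E M' N' P')),
     Lun = map_prod (Lun D) (Lun E), Run = map_prod (Run D) (Run E)\<rparr>"

definition terminal_dbl :: "(unit, unit, unit, unit) dblcat" where
  "terminal_dbl = \<lparr>VCat = terminal_cat, HCat = terminal_cat, Src = const_unit, Tgt = const_unit,
     Unt = const_unit, Hcmp = const_unit, Asc = (\<lambda>_ _ _. ()), Lun = (\<lambda>_. ()), Run = (\<lambda>_. ())\<rparr>"

definition diagonal :: "('o, 'v, 'h, 'c) dblcat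
    \<Rightarrow> ('o, 'v, 'h, 'c, 'o \<times> 'o, 'v \<times> 'v, 'h \<times> 'h, 'c \<times> 'c) dfctr" where
  "diagonal D = \<lparr>DF0 = \<lparr>FO = (\<lambda>A. (A, A)), FA = (\<lambda>f. (f, f))\<rparr>,
     DF1 = \<lparr>FO = (\<lambda>M. (M, M)), FA = (\<lambda>\<alpha>. (\<alpha>, \<alpha>))\<rparr>,
     DMul = (\<lambda>M N. let i = Ide (HCat D) (M \<odot>\<^bsub>D\<^esub> N) in (i, i)),
     DUni = (\<lambda>A. let i = Ide (HCat D) (hunit D A) in (i, i))\<rparr>"

definition to_terminal :: "('o, 'v, 'h, 'c, unit, unit, unit, unit) dfctr" where
  "to_terminal = \<lparr>DF0 = const_unit, DF1 = const_unit, DMul = (\<lambda>_ _. ()), DUni = (\<lambda>_. ())\<rparr>"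

definition cartesian_double_category :: "('o, 'v, 'h, 'c) dblcat \<Rightarrow> bool" where
  "cartesian_double_category D \<longleftrightarrow>
     (\<exists>R \<eta>\<^sub>0 \<eta>\<^sub>1 \<epsilon>\<^sub>0 \<epsilon>\<^sub>1. double_adjunction D (prod_dbl D D) (diagonal D) R \<eta>\<^sub>0 \<eta>\<^sub>1 \<epsilon>\<^sub>0 \<epsilon>\<^sub>1) \<and>
     (\<exists>R \<eta>\<^sub>0 \<eta>\<^sub>1 \<epsilon>\<^sub>0 \<epsilon>\<^sub>1. double_adjunction D terminal_dbl to_terminal R \<eta>\<^sub>0 \<eta>\<^sub>1 \<epsilon>\<^sub>0 \<epsilon>\<^sub>1)"


section \<open>Cartesian cells and fibrancy\<close>

definition cartesian_cell :: "('o, 'v, 'h, 'c) dblcat \<Rightarrow> 'c \<Rightarrow> bool" where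
  "cartesian_cell D \<alpha> \<longleftrightarrow> \<alpha> \<in> Ar (HCat D) \<and>
     (\<forall>M' \<in> Ob (HCat D).
        \<forall>h \<in> hom (VCat D) (hsrc D M') (hsrc D (Dom (HCat D) \<alpha>)).
        \<forall>k \<in> hom (VCat D) (htgt D M') (htgt D (Dom (HCat D) \<alpha>)).
        \<forall>\<beta> \<in> cells D (csrc D \<alpha> \<cdot>\<^sub>0\<^bsub>D\<^esub> h) (ctgt D \<alpha> \<cdot>\<^sub>0\<^bsub>D\<^esub> k) M' (Cod (HCat D) \<alpha>).
          \<exists>!\<gamma>. \<gamma> \<in> cells D h k M' (Dom (HCat D) \<alpha>) \<and> \<beta> = \<alpha> \<cdot>\<^sub>1\<^bsub>D\<^esub> \<gamma>)"

definition opcartesian_cell :: "('o, 'v, 'h, 'c) dblcat \<Rightarrow> 'c \<Rightarrow> bool" where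
  "opcartesian_cell D \<alpha> \<longleftrightarrow> \<alpha> \<in> Ar (HCat D) \<and>
     (\<forall>N' \<in> Ob (HCat D).
        \<forall>h \<in> hom (VCat D) (hsrc D (Cod (HCat D) \<alpha>)) (hsrc D N').
        \<forall>k \<in> hom (VCat D) (htgt D (Cod (HCat D) \<alpha>)) (htgt D N').
        \<forall>\<beta> \<in> cells D (h \<cdot>\<^sub>0\<^bsub>D\<^esub> csrc D \<alpha>) (k \<cdot>\<^sub>0\<^bsub>D\<^esub> ctgt D \<alpha>) (Dom (HCat D) \<alpha>) N'.
          \<exists>!\<gamma>. \<gamma> \<in> cells D h k (Cod (HCat D) \<alpha>) N' \<and> \<beta> = \<gamma> \<cdot>\<^sub>1\<^bsub>D\<^esub> \<alpha>)"

definition fibrant :: "('o, 'v, 'h, 'c) dblcat \<Rightarrow> bool" where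
  "fibrant D \<longleftrightarrow> (\<forall>f \<in> Ar (VCat D). \<forall>g \<in> Ar (VCat D). \<forall>M \<in> Ob (HCat D).
     hsrc D M = Cod (VCat D) f \<and> htgt D M = Cod (VCat D) g \<longrightarrow>
     (\<exists>K. \<exists>\<alpha> \<in> cells D f g K M. cartesian_cell D \<alpha>))"

text \<open>\<open>companion D f K\<close>: \<open>K\<close> is a choice of \<open>f\<^sub>*\<close>; \<open>conjoint D f K\<close>: \<open>K\<close> is a choice of
  \<open>f\<^sup>*\<close>.\<close>

definition companion :: "('o, 'v, 'h, 'c) dblcat \<Rightarrow> 'v \<Rightarrow> 'h \<Rightarrow> bool" where
  "companion D f K \<longleftrightarrow> (let B = Cod (VCat D) f in
     \<exists>\<alpha> \<in> cells D f (Ide (VCat D) B) K (hunit D B). cartesian_cell D \<alpha>)"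

definition conjoint :: "('o, 'v, 'h, 'c) dblcat \<Rightarrow> 'v \<Rightarrow> 'h \<Rightarrow> bool" where
  "conjoint D f K \<longleftrightarrow> (let B = Cod (VCat D) f in
     \<exists>\<alpha> \<in> cells D (Ide (VCat D) B) f K (hunit D B). cartesian_cell D \<alpha>)"

text \<open>For a cell \<open>\<iota> : U\<^sub>T \<rightarrow> F\<close> with sides \<open>(f, g)\<close>: the globular cell
  \<open>g\<^sub>* \<odot> f\<^sup>* \<rightarrow> F\<close> induced by \<open>\<iota>\<close> via the op-Cartesian cell
  \<open>U\<^sub>T \<rightarrow> g\<^sub>* \<odot> f\<^sup>*\<close> is invertible. Since \<open>g\<^sub>*\<close>, \<open>f\<^sup>*\<close> and the op-Cartesian cell are
  determined only up to isomorphism, all choices are quantified over.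
  In a fibrant double category choices exist.\<close>

definition induced_cell_invertible :: "('o, 'v, 'h, 'c) dblcat \<Rightarrow> 'o \<Rightarrow> 'h \<Rightarrow> 'c \<Rightarrow> bool" where
  "induced_cell_invertible D T F \<iota> \<longleftrightarrow>
     (\<forall>K L. companion D (ctgt D \<iota>) K \<and> conjoint D (csrc D \<iota>) L \<longrightarrow>
        (\<exists>\<sigma> \<in> cells D (csrc D \<iota>) (ctgt D \<iota>) (hunit D T) (K \<odot>\<^bsub>D\<^esub> L). opcartesian_cell D \<sigma>) \<and>
        (\<forall>\<sigma> \<in> cells D (csrc D \<iota>) (ctgt D \<iota>) (hunit D T) (K \<odot>\<^bsub>D\<^esub> L). opcartesian_cell D \<sigma> \<longrightarrow>
           (\<exists>m \<in> globular D (K \<odot>\<^bsub>D\<^esub> L) F. m \<cdot>\<^sub>1\<^bsub>D\<^esub> \<sigma> = \<iota> \<and> invertible (HCat D) m)))"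


section \<open>Eilenberg--Moore objects for co-pointed endomorphisms\<close>

text \<open>Objects of \<open>Copt D\<close> are pairs \<open>(P, \<epsilon>)\<close>; the underlying object is the source of \<open>P\<close>.
  An arrow carries its domain and codomain, as these are not determined by the pair
  \<open>(f, \<phi>)\<close>.\<close>

type_synonym ('v, 'h, 'c) copt_arrow = "('h \<times> 'c) \<times> ('v \<times> 'c) \<times> ('h \<times> 'c)"

definition copointed :: "('o, 'v, 'h, 'c) dblcat \<Rightarrow> 'h \<Rightarrow> 'c \<Rightarrow> bool" where
  "copointed D P \<epsilon> \<longleftrightarrow> P \<in> Ob (HCat D) \<and> hsrc D P = htgt D P \<and>
     \<epsilon> \<in> globular D P (hunit D (hsrc D P))"

definition copt_map ::
  "('o, 'v, 'h, 'c) dblcat \<Rightarrow> 'h \<times> 'c \<Rightarrow> 'h \<times> 'c \<Rightarrow> 'v \<Rightarrow> 'c \<Rightarrow> bool" where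
  "copt_map D = (\<lambda>(P, \<epsilon>) (R, \<epsilon>') f \<phi>. f \<in> hom (VCat D) (hsrc D P) (hsrc D R) \<and>
     \<phi> \<in> cells D f f P R \<and> \<epsilon>' \<cdot>\<^sub>1\<^bsub>D\<^esub> \<phi> = cunit D f \<cdot>\<^sub>1\<^bsub>D\<^esub> \<epsilon>)"

definition Copt :: "('o, 'v, 'h, 'c) dblcat \<Rightarrow> ('h \<times> 'c, ('v, 'h, 'c) copt_arrow) cat" where
  "Copt D = \<lparr>Ob = {(P, \<epsilon>). copointed D P \<epsilon>},
     Ar = {(p, (f, \<phi>), r). case_prod (copointed D) p \<and> case_prod (copointed D) r \<and>
             copt_map D p r f \<phi>},
     Dom = (\<lambda>(p, _, r). p), Cod = (\<lambda>(p, _, r). r),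
     Ide = (\<lambda>(P, \<epsilon>). ((P, \<epsilon>), (Ide (VCat D) (hsrc D P), Ide (HCat D) P), (P, \<epsilon>))),
     Cmp = (\<lambda>(_, (g, \<psi>), r) (p, (f, \<phi>), _). (p, (g \<cdot>\<^sub>0\<^bsub>D\<^esub> f, \<psi> \<cdot>\<^sub>1\<^bsub>D\<^esub> \<phi>), r))\<rparr>"

definition copt_incl ::
  "('o, 'v, 'h, 'c) dblcat \<Rightarrow> ('o, 'v, 'h \<times> 'c, ('v, 'h, 'c) copt_arrow) fctr" where
  "copt_incl D = (let I = (\<lambda>A. (hunit D A, Ide (HCat D) (hunit D A))) in
     \<lparr>FO = I, FA = (\<lambda>f. (I (Dom (VCat D) f), (f, cunit D f), I (Cod (VCat D) f)))\<rparr>)"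

abbreviation copt_cell :: "('v, 'h, 'c) copt_arrow \<Rightarrow> 'c" where
  "copt_cell a \<equiv> snd (fst (snd a))"

definition has_EM_objects :: "('o, 'v, 'h, 'c) dblcat \<Rightarrow> bool" where
  "has_EM_objects D \<longleftrightarrow> (\<exists>EM \<eta> \<theta>. adjunction (VCat D) (Copt D) (copt_incl D) EM \<eta> \<theta>)"

text \<open>Strength asks that the counit cell \<open>\<theta>\<^sub>P : U\<^bsub>EM P\<^esub> \<rightarrow> P\<close>, with sides \<open>(u, u)\<close>, exhibits
  \<open>P \<cong> u\<^sub>* \<odot> u\<^sup>*\<close>, i.e. that the globular comparison cell it induces is invertible
  (the existence of an unrelated isomorphism would be strictly weaker).
  As right adjoints are unique up to isomorphism, the choice of adjunction does not matter.\<close>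

definition strong_EM_objects :: "('o, 'v, 'h, 'c) dblcat \<Rightarrow> bool" where
  "strong_EM_objects D \<longleftrightarrow>
     (\<forall>EM \<eta> \<theta>. adjunction (VCat D) (Copt D) (copt_incl D) EM \<eta> \<theta> \<longrightarrow>
        (\<forall>P \<epsilon>. copointed D P \<epsilon> \<longrightarrow>
           induced_cell_invertible D (FO EM (P, \<epsilon>)) P (copt_cell (\<theta> (P, \<epsilon>)))))"


section \<open>Tabulators\<close>

definition has_tabulators :: "('o, 'v, 'h, 'c) dblcat \<Rightarrow> bool" where
  "has_tabulators D \<longleftrightarrow> (\<exists>Tab \<eta> \<iota>. adjunction (VCat D) (HCat D) (Unt D) Tab \<eta> \<iota>)"

definition strong_tabulators :: "('o, 'v, 'h, 'c) dblcat \<Rightarrow> bool" where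
  "strong_tabulators D \<longleftrightarrow>
     (\<forall>Tab \<eta> \<iota>. adjunction (VCat D) (HCat D) (Unt D) Tab \<eta> \<iota> \<longrightarrow>
        (\<forall>F \<in> Ob (HCat D). induced_cell_invertible D (FO Tab F) F (\<iota> F)))"

end

theory Submission
  imports Defs
begin

text \<open>For \<open>F : A \<rightarrow> X\<close> let \<open>P\<close> be the local product of \<open>U\<close> and the restriction of \<open>F\<close> along the
  projections, a co-pointed endomorphism of \<open>A \<times> X\<close>. A map from \<open>U\<^sub>H\<close> to \<open>P\<close> over \<open>U\<close> is a
  vertical arrow \<open>H \<rightarrow> A \<times> X\<close> with a cell \<open>U\<^sub>H \<rightarrow> F\<close> over its two components, so the
  Eilenberg--Moore object of \<open>P\<close> is a tabulator of \<open>F\<close>, and the tabulator cell factors as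
  \<open>U\<^sub>T \<rightarrow> P \<rightarrow> F\<close>. Strength says exactly that the cell out of \<open>U\<^sub>T\<close> is op-Cartesian. The second
  cell \<open>P \<rightarrow> F\<close> is always op-Cartesian, because the product functor preserves \<open>\<odot>\<close> up to
  isomorphism. So strength passes from \<open>P\<close> to \<open>F\<close>.\<close>

section \<open>Categories and adjunctions\<close>

text \<open>Fibrancy supplies Cartesian cells only, whereas strength and the factorization through
  \<open>P\<close> concern op-Cartesian ones. Companions connect the two: a cell out of
  \<open>M\<close> with sides \<open>(1, g)\<close> is op-Cartesian as soon as its codomain is
  identified with \<open>K \<odot> M\<close>, where \<open>K\<close> is a companion of
  \<open>g\<close>, and this is a matter of two equations. For that reason the cell from
  \<open>P\<close> to \<open>F\<close> is split into two cells that each have one identity side.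
  Both are instances of the same lemma, one of them after reversing the horizontal arrows and
  exchanging the two factors of the product. The obstacle in that lemma is to produce a cell INTO a
  composite \<open>K \<odot> P\<close>, since nothing describes such cells in general. Two devices
  make it possible. Whiskering with \<open>K\<close> keeps a source-side restriction Cartesian, so
  \<open>P\<close> may be replaced by the product that it restricts. And \<open>K\<close>, a
  companion of a projection, receives a comparison cell from a product of a unit arrow with a
  locally terminal horizontal arrow \<open>E\<close>; a composite of two products is a product of
  composites, and cells into a product are pairs.\<close>

lemma homI: "\<lbrakk>f \<in> Ar C; Dom C f = x; Cod C f = y\<rbrakk> \<Longrightarrow> f \<in> hom C x y"
  by (simp add: hom_def)

lemma homD:
  assumes "f \<in> hom C x y"
  shows "f \<in> Ar C" "Dom C f = x" "Cod C f = y"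
  using assms by (auto simp: hom_def)

definition cinv :: "('o, 'a) cat \<Rightarrow> 'a \<Rightarrow> 'a" where
  "cinv C f = (SOME g. g \<in> hom C (Cod C f) (Dom C f) \<and>
     g \<cdot>\<^bsub>C\<^esub> f = Ide C (Dom C f) \<and> f \<cdot>\<^bsub>C\<^esub> g = Ide C (Cod C f))"

context category
begin

lemma dom_Ob' [simp]: "f \<in> Ar C \<Longrightarrow> Dom C f \<in> Ob C"
  by (rule dom_Ob)

lemma cod_Ob' [simp]: "f \<in> Ar C \<Longrightarrow> Cod C f \<in> Ob C"
  by (rule cod_Ob)

lemma ide_simps [simp]:
  assumes "x \<in> Ob C"
  shows "Ide C x \<in> Ar C" "Dom C (Ide C x) = x" "Cod C (Ide C x) = x"
  using ide_hom[OF assms] by (auto simp: hom_def)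

lemma cmp_simps [simp]:
  assumes "f \<in> Ar C" "g \<in> Ar C" "Dom C g = Cod C f"
  shows "g \<cdot>\<^bsub>C\<^esub> f \<in> Ar C" "Dom C (g \<cdot>\<^bsub>C\<^esub> f) = Dom C f" "Cod C (g \<cdot>\<^bsub>C\<^esub> f) = Cod C g"
  using cmp_hom[of f "Dom C f" "Cod C f" g "Cod C g"] assms by (auto simp: hom_def)

lemma cmp_ide' [simp]: "\<lbrakk>f \<in> Ar C; Dom C f = x\<rbrakk> \<Longrightarrow> f \<cdot>\<^bsub>C\<^esub> Ide C x = f"
  using cmp_ide[of f x] by (auto simp: hom_def)

lemma ide_cmp' [simp]: "\<lbrakk>f \<in> Ar C; Cod C f = x\<rbrakk> \<Longrightarrow> Ide C x \<cdot>\<^bsub>C\<^esub> f = f"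
  using ide_cmp[of f _ x] by (auto simp: hom_def)

lemma assoc:
  assumes "f \<in> Ar C" "g \<in> Ar C" "h \<in> Ar C" "Dom C g = Cod C f" "Dom C h = Cod C g"
  shows "h \<cdot>\<^bsub>C\<^esub> g \<cdot>\<^bsub>C\<^esub> f = h \<cdot>\<^bsub>C\<^esub> (g \<cdot>\<^bsub>C\<^esub> f)"
  using cmp_assoc assms by (simp add: hom_def)

lemma invertible_Ar: "invertible C f \<Longrightarrow> f \<in> Ar C"
  by (simp add: invertible_def)

lemma cinv_simps:
  assumes "invertible C f"
  shows "cinv C f \<in> Ar C" "Dom C (cinv C f) = Cod C f" "Cod C (cinv C f) = Dom C f"
    "cinv C f \<cdot>\<^bsub>C\<^esub> f = Ide C (Dom C f)" "f \<cdot>\<^bsub>C\<^esub> cinv C f = Ide C (Cod C f)"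
proof -
  have "\<exists>g. g \<in> hom C (Cod C f) (Dom C f) \<and>
     g \<cdot>\<^bsub>C\<^esub> f = Ide C (Dom C f) \<and> f \<cdot>\<^bsub>C\<^esub> g = Ide C (Cod C f)"
    using assms by (auto simp: invertible_def)
  from someI_ex[OF this, folded cinv_def]
  show "cinv C f \<in> Ar C" "Dom C (cinv C f) = Cod C f" "Cod C (cinv C f) = Dom C f"
    "cinv C f \<cdot>\<^bsub>C\<^esub> f = Ide C (Dom C f)" "f \<cdot>\<^bsub>C\<^esub> cinv C f = Ide C (Cod C f)"
    by (auto simp: hom_def)
qed

lemma invertibleI:
  assumes "f \<in> Ar C" "g \<in> Ar C" "Dom C g = Cod C f" "Cod C g = Dom C f"
    "g \<cdot>\<^bsub>C\<^esub> f = Ide C (Dom C f)" "f \<cdot>\<^bsub>C\<^esub> g = Ide C (Cod C f)"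
  shows "invertible C f"
  using assms by (auto simp: invertible_def hom_def)

lemma cinv_cmp [simp]:
  assumes "invertible C f" "Dom C f = x"
  shows "cinv C f \<cdot>\<^bsub>C\<^esub> f = Ide C x"
  using assms cinv_simps by simp

lemma cmp_cinv [simp]:
  assumes "invertible C f" "Cod C f = y"
  shows "f \<cdot>\<^bsub>C\<^esub> cinv C f = Ide C y"
  using assms cinv_simps by simp

lemma cinv_cmp_cmp [simp]:
  assumes "invertible C f" "g \<in> Ar C" "Cod C g = Dom C f"
  shows "cinv C f \<cdot>\<^bsub>C\<^esub> (f \<cdot>\<^bsub>C\<^esub> g) = g"
  using assms cinv_simps[OF assms(1)] invertible_Ar[OF assms(1)] by (simp flip: assoc)

lemma cmp_cinv_cmp [simp]:
  assumes "invertible C f" "g \<in> Ar C" "Cod C g = Cod C f"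
  shows "f \<cdot>\<^bsub>C\<^esub> (cinv C f \<cdot>\<^bsub>C\<^esub> g) = g"
  using assms cinv_simps[OF assms(1)] invertible_Ar[OF assms(1)] by (simp flip: assoc)

lemma invertible_monic:
  assumes "invertible C f" "g \<in> Ar C" "h \<in> Ar C" "Cod C g = Dom C f" "Cod C h = Dom C f"
    "f \<cdot>\<^bsub>C\<^esub> g = f \<cdot>\<^bsub>C\<^esub> h"
  shows "g = h"
  using assms by (metis cinv_cmp_cmp)

lemma invertible_epic:
  assumes f: "invertible C f" and "g \<in> Ar C" "h \<in> Ar C" "Dom C g = Cod C f" "Dom C h = Cod C f"
    and eq: "g \<cdot>\<^bsub>C\<^esub> f = h \<cdot>\<^bsub>C\<^esub> f"
  shows "g = h"
proof -
  have "g = g \<cdot>\<^bsub>C\<^esub> f \<cdot>\<^bsub>C\<^esub> cinv C f"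
    using assms(2,4) f cinv_simps[OF f] invertible_Ar[OF f] by (simp add: assoc)
  also have "\<dots> = h \<cdot>\<^bsub>C\<^esub> f \<cdot>\<^bsub>C\<^esub> cinv C f"
    by (simp only: eq)
  also have "\<dots> = h"
    using assms(3,5) f cinv_simps[OF f] invertible_Ar[OF f] by (simp add: assoc)
  finally show ?thesis .
qed

lemma invertible_cinv:
  assumes "invertible C f"
  shows "invertible C (cinv C f)"
  using cinv_simps[OF assms] invertible_Ar[OF assms] by (intro invertibleI[of _ f]) auto

end

context cat_functor
begin

lemma FO_Ob [simp]: "x \<in> Ob C \<Longrightarrow> FO F x \<in> Ob D"
  by (rule map_Ob)

lemma FA_simps [simp]:
  assumes "f \<in> Ar C"
  shows "FA F f \<in> Ar D" "Dom D (FA F f) = FO F (Dom C f)" "Cod D (FA F f) = FO F (Cod C f)"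
  using map_hom[of f "Dom C f" "Cod C f"] assms by (auto simp: hom_def)

lemma FA_ide [simp]: "x \<in> Ob C \<Longrightarrow> FA F (Ide C x) = Ide D (FO F x)"
  by (rule map_ide)

lemma FA_cmp:
  "\<lbrakk>f \<in> Ar C; g \<in> Ar C; Dom C g = Cod C f\<rbrakk> \<Longrightarrow> FA F (g \<cdot>\<^bsub>C\<^esub> f) = FA F g \<cdot>\<^bsub>D\<^esub> FA F f"
  by (rule map_cmp) (auto simp: hom_def)

lemma FA_invertible: "invertible C f \<Longrightarrow> invertible D (FA F f)"
  using A.cinv_simps[of f] A.invertible_Ar[of f] FA_cmp[of f "cinv C f"] FA_cmp[of "cinv C f" f]
  by (intro B.invertibleI[of _ "FA F (cinv C f)"]) auto

end

text \<open>A terminal object of the comma category of \<open>F\<close> over \<open>y\<close>;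
  \<open>\<epsilon>\<close> is one component of a counit. Tabulators and Eilenberg-Moore objects are
  compared in this form, one \<open>y\<close> at a time, which avoids units and naturality.\<close>

definition universal_arrow ::
  "('o, 'a) cat \<Rightarrow> ('p, 'b) cat \<Rightarrow> ('o, 'a, 'p, 'b) fctr \<Rightarrow> 'o \<Rightarrow> 'b \<Rightarrow> 'p \<Rightarrow> bool" where
  "universal_arrow C D F t \<epsilon> y \<longleftrightarrow> t \<in> Ob C \<and> \<epsilon> \<in> hom D (FO F t) y \<and>
     (\<forall>x \<in> Ob C. \<forall>\<beta> \<in> hom D (FO F x) y. \<exists>!b. b \<in> hom C x t \<and> \<epsilon> \<cdot>\<^bsub>D\<^esub> FA F b = \<beta>)"

lemma universal_arrowI:
  assumes "t \<in> Ob C" "\<epsilon> \<in> hom D (FO F t) y"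
    and "\<And>x \<beta>. \<lbrakk>x \<in> Ob C; \<beta> \<in> hom D (FO F x) y\<rbrakk> \<Longrightarrow> \<exists>b. b \<in> hom C x t \<and> \<epsilon> \<cdot>\<^bsub>D\<^esub> FA F b = \<beta>"
    and "\<And>x b b'. \<lbrakk>x \<in> Ob C; b \<in> hom C x t; b' \<in> hom C x t;
      \<epsilon> \<cdot>\<^bsub>D\<^esub> FA F b = \<epsilon> \<cdot>\<^bsub>D\<^esub> FA F b'\<rbrakk> \<Longrightarrow> b = b'"
  shows "universal_arrow C D F t \<epsilon> y"
  unfolding universal_arrow_def using assms by (metis (lifting))

text \<open>The transpose of \<open>\<beta>\<close> is \<open>FA G \<beta>\<close> after
  \<open>\<eta> x\<close>. One triangle identity makes it a factorization, the other makes it the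
  only one.\<close>

lemma (in adjunction) counit_universal:
  assumes y: "y \<in> Ob D"
  shows "universal_arrow C D F (FO G y) (\<epsilon> y) y"
proof (rule universal_arrowI)
  have e: "\<And>y. y \<in> Ob D \<Longrightarrow> \<epsilon> y \<in> Ar D \<and> Dom D (\<epsilon> y) = FO F (FO G y) \<and> Cod D (\<epsilon> y) = y"
    using counit.component by (auto simp: hom_def id_fctr_def comp_fctr_def)
  have n: "\<And>x. x \<in> Ob C \<Longrightarrow> \<eta> x \<in> Ar C \<and> Dom C (\<eta> x) = x \<and> Cod C (\<eta> x) = FO G (FO F x)"
    using unit.component by (auto simp: hom_def id_fctr_def comp_fctr_def)
  show "FO G y \<in> Ob C" "\<epsilon> y \<in> hom D (FO F (FO G y)) y"
    using y e by (auto simp: hom_def)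
  show "\<exists>b. b \<in> hom C x (FO G y) \<and> \<epsilon> y \<cdot>\<^bsub>D\<^esub> FA F b = \<beta>"
    if x: "x \<in> Ob C" and b: "\<beta> \<in> hom D (FO F x) y" for x \<beta>
  proof (intro exI conjI)
    note b' = homD[OF b]
    have "\<epsilon> y \<cdot>\<^bsub>D\<^esub> FA F (FA G \<beta>) = \<beta> \<cdot>\<^bsub>D\<^esub> \<epsilon> (FO F x)"
      using counit.naturality[OF b] by (simp add: id_fctr_def comp_fctr_def)
    then show "\<epsilon> y \<cdot>\<^bsub>D\<^esub> FA F (FA G \<beta> \<cdot>\<^bsub>C\<^esub> \<eta> x) = \<beta>"
      using x b' y e n triangle_left[OF x]
      by (simp add: L.FA_cmp flip: L.B.assoc) (simp add: L.B.assoc)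
    show "FA G \<beta> \<cdot>\<^bsub>C\<^esub> \<eta> x \<in> hom C x (FO G y)"
      using x b' y n by (auto simp: hom_def)
  qed
  show "b = b'"
    if x: "x \<in> Ob C" and b: "b \<in> hom C x (FO G y)" and b': "b' \<in> hom C x (FO G y)"
      and eq: "\<epsilon> y \<cdot>\<^bsub>D\<^esub> FA F b = \<epsilon> y \<cdot>\<^bsub>D\<^esub> FA F b'" for x b b'
  proof -
    \<comment> \<open>An arrow into \<open>FO G y\<close> is recovered from its composite with the
      counit, so that composite determines it.\<close>
    have *: "a = FA G (\<epsilon> y \<cdot>\<^bsub>D\<^esub> FA F a) \<cdot>\<^bsub>C\<^esub> \<eta> x" if a: "a \<in> hom C x (FO G y)" for a
    proof -
      note a' = homD[OF a]
      have "\<eta> (FO G y) \<cdot>\<^bsub>C\<^esub> a = FA G (FA F a) \<cdot>\<^bsub>C\<^esub> \<eta> x"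
        using unit.naturality[OF a] by (simp add: id_fctr_def comp_fctr_def)
      then have "FA G (\<epsilon> y \<cdot>\<^bsub>D\<^esub> FA F a) \<cdot>\<^bsub>C\<^esub> \<eta> x = FA G (\<epsilon> y) \<cdot>\<^bsub>C\<^esub> (\<eta> (FO G y) \<cdot>\<^bsub>C\<^esub> a)"
        using x y e n a' by (simp add: R.FA_cmp L.A.assoc)
      also have "\<dots> = a"
        using y e n a' triangle_right[OF y] by (simp flip: L.A.assoc)
      finally show ?thesis ..
    qed
    show ?thesis
      using *[OF b] *[OF b'] eq by simp
  qed
qed

text \<open>The right adjoint is assembled from independently chosen universal arrows. Transposition
  \<open>tr\<close> gives its action on arrows and the unit. The functor laws, naturality of the
  unit and the right triangle identity are equations in \<open>C\<close>, which \<open>uniq\<close>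
  lets one test after \<open>F\<close> and \<open>\<epsilon>\<close>.\<close>

lemma (in cat_functor) adjunction_of_universal_arrows:
  assumes ex: "\<And>y. y \<in> Ob D \<Longrightarrow> \<exists>t \<epsilon>. universal_arrow C D F t \<epsilon> y"
  shows "\<exists>G \<eta> \<epsilon>. adjunction C D F G \<eta> \<epsilon>"
proof -
  obtain t \<epsilon> where u: "\<And>y. y \<in> Ob D \<Longrightarrow> universal_arrow C D F (t y) (\<epsilon> y) y"
    using ex by metis
  have t [simp]: "\<And>y. y \<in> Ob D \<Longrightarrow> t y \<in> Ob C"
    and e': "\<And>y. y \<in> Ob D \<Longrightarrow> \<epsilon> y \<in> hom D (FO F (t y)) y"
    using u by (auto simp: universal_arrow_def)
  have e [simp]: "\<epsilon> y \<in> Ar D" "Dom D (\<epsilon> y) = FO F (t y)" "Cod D (\<epsilon> y) = y" if "y \<in> Ob D" for y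
    using e'[OF that] by (auto simp: hom_def)
  define tr where "tr x y \<beta> = (THE b. b \<in> hom C x (t y) \<and> \<epsilon> y \<cdot>\<^bsub>D\<^esub> FA F b = \<beta>)" for x y \<beta>
  have tr: "tr x y \<beta> \<in> Ar C" "Dom C (tr x y \<beta>) = x" "Cod C (tr x y \<beta>) = t y"
      "\<epsilon> y \<cdot>\<^bsub>D\<^esub> FA F (tr x y \<beta>) = \<beta>"
    if "x \<in> Ob C" "y \<in> Ob D" "\<beta> \<in> Ar D" "Dom D \<beta> = FO F x" "Cod D \<beta> = y" for x y \<beta>
  proof -
    have "\<exists>!b. b \<in> hom C x (t y) \<and> \<epsilon> y \<cdot>\<^bsub>D\<^esub> FA F b = \<beta>"
      using u[OF that(2)] that by (auto simp: universal_arrow_def hom_def)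
    from theI'[OF this, folded tr_def]
    show "tr x y \<beta> \<in> Ar C" "Dom C (tr x y \<beta>) = x" "Cod C (tr x y \<beta>) = t y"
      "\<epsilon> y \<cdot>\<^bsub>D\<^esub> FA F (tr x y \<beta>) = \<beta>"
      by (auto simp: hom_def)
  qed
  have uniq: "b = b'" if "y \<in> Ob D" "b \<in> Ar C" "b' \<in> Ar C" "Dom C b = Dom C b'"
      "Cod C b = t y" "Cod C b' = t y" "\<epsilon> y \<cdot>\<^bsub>D\<^esub> FA F b = \<epsilon> y \<cdot>\<^bsub>D\<^esub> FA F b'" for y b b'
  proof -
    have "\<exists>!a. a \<in> hom C (Dom C b) (t y) \<and> \<epsilon> y \<cdot>\<^bsub>D\<^esub> FA F a = \<epsilon> y \<cdot>\<^bsub>D\<^esub> FA F b"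
      using u[OF that(1)] that by (auto simp: universal_arrow_def hom_def)
    then show ?thesis
      using that by (metis homI)
  qed
  \<comment> \<open>An arrow goes to the transpose of its composite with the counit at its domain,
    the only choice that makes \<open>\<epsilon>\<close> natural.\<close>
  define G where "G = \<lparr>FO = t, FA = (\<lambda>\<beta>. tr (t (Dom D \<beta>)) (Cod D \<beta>) (\<beta> \<cdot>\<^bsub>D\<^esub> \<epsilon> (Dom D \<beta>)))\<rparr>"
  define \<eta> where "\<eta> x = tr x (FO F x) (Ide D (FO F x))" for x
  have GO: "FO G = t"
    by (simp add: G_def)
  have GA: "FA G \<beta> \<in> Ar C" "Dom C (FA G \<beta>) = t (Dom D \<beta>)" "Cod C (FA G \<beta>) = t (Cod D \<beta>)"
    "\<epsilon> (Cod D \<beta>) \<cdot>\<^bsub>D\<^esub> FA F (FA G \<beta>) = \<beta> \<cdot>\<^bsub>D\<^esub> \<epsilon> (Dom D \<beta>)" if "\<beta> \<in> Ar D" for \<beta>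
    using tr[of "t (Dom D \<beta>)" "Cod D \<beta>" "\<beta> \<cdot>\<^bsub>D\<^esub> \<epsilon> (Dom D \<beta>)"] that by (simp_all add: G_def)
  have n: "\<eta> x \<in> Ar C" "Dom C (\<eta> x) = x" "Cod C (\<eta> x) = t (FO F x)"
    "\<epsilon> (FO F x) \<cdot>\<^bsub>D\<^esub> FA F (\<eta> x) = Ide D (FO F x)" if "x \<in> Ob C" for x
    using tr[of x "FO F x" "Ide D (FO F x)"] that by (simp_all add: \<eta>_def)
  interpret G: cat_functor D C G
  proof
    show "FO G y \<in> Ob C" if "y \<in> Ob D" for y
      using that by (simp add: GO)
    show "FA G f \<in> hom C (FO G x) (FO G y)" if "f \<in> hom D x y" for f x y
      using GA[of f] homD[OF that] by (auto simp: hom_def GO)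
    show "FA G (Ide D y) = Ide C (FO G y)" if "y \<in> Ob D" for y
      using GA[of "Ide D y"] that by (intro uniq[of y]) (auto simp: GO)
    show "FA G (g \<cdot>\<^bsub>D\<^esub> f) = FA G g \<cdot>\<^bsub>C\<^esub> FA G f" if "f \<in> hom D x y" "g \<in> hom D y z" for f g x y z
    proof (rule uniq[of z])
      note f = homD[OF that(1)] and g = homD[OF that(2)]
      have "x \<in> Ob D" "y \<in> Ob D" and z: "z \<in> Ob D"
        using f g B.dom_Ob B.cod_Ob by blast+
      note o = this
      show "z \<in> Ob D" by (fact z)
      have "\<epsilon> z \<cdot>\<^bsub>D\<^esub> FA F (FA G g \<cdot>\<^bsub>C\<^esub> FA G f) = \<epsilon> z \<cdot>\<^bsub>D\<^esub> FA F (FA G g) \<cdot>\<^bsub>D\<^esub> FA F (FA G f)"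
        using f g GA(1-3)[of f] GA(1-3)[of g] o by (simp add: FA_cmp B.assoc)
      also have "\<dots> = g \<cdot>\<^bsub>D\<^esub> \<epsilon> y \<cdot>\<^bsub>D\<^esub> FA F (FA G f)"
        using f g GA[of g] by simp
      also have "\<dots> = g \<cdot>\<^bsub>D\<^esub> (\<epsilon> y \<cdot>\<^bsub>D\<^esub> FA F (FA G f))"
        using f g GA(1-3)[of f] o by (simp add: B.assoc)
      also have "\<dots> = g \<cdot>\<^bsub>D\<^esub> f \<cdot>\<^bsub>D\<^esub> \<epsilon> x"
        using f g GA(4)[of f] o by (simp add: B.assoc)
      finally show "\<epsilon> z \<cdot>\<^bsub>D\<^esub> FA F (FA G (g \<cdot>\<^bsub>D\<^esub> f)) = \<epsilon> z \<cdot>\<^bsub>D\<^esub> FA F (FA G g \<cdot>\<^bsub>C\<^esub> FA G f)"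
        using f g GA[of "g \<cdot>\<^bsub>D\<^esub> f"] by simp
    qed (use that GA[of f] GA[of g] GA[of "g \<cdot>\<^bsub>D\<^esub> f"] in \<open>auto simp: hom_def\<close>)
  qed
  have "adjunction C D F G \<eta> \<epsilon>"
  proof (intro adjunction.intro nat_trans.intro nat_trans_axioms.intro adjunction_axioms.intro)
    show "cat_functor C D F" "cat_functor D C G"
      by (fact cat_functor_axioms, fact G.cat_functor_axioms)
    show "cat_functor C C id_fctr" "cat_functor D D id_fctr"
      by (unfold_locales, auto simp: id_fctr_def hom_def)+
    show "cat_functor C C (comp_fctr G F)" "cat_functor D D (comp_fctr F G)"
      by (unfold_locales, auto simp: comp_fctr_def hom_def FA_cmp G.FA_cmp)+
    show "\<eta> x \<in> hom C (FO id_fctr x) (FO (comp_fctr G F) x)" if "x \<in> Ob C" for x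
      using n[OF that] that by (auto simp: hom_def id_fctr_def comp_fctr_def GO)
    show "\<epsilon> x \<in> hom D (FO (comp_fctr F G) x) (FO id_fctr x)" if "x \<in> Ob D" for x
      using that by (auto simp: hom_def id_fctr_def comp_fctr_def GO)
    show "\<epsilon> y \<cdot>\<^bsub>D\<^esub> FA (comp_fctr F G) f = FA id_fctr f \<cdot>\<^bsub>D\<^esub> \<epsilon> x" if "f \<in> hom D x y" for f x y
      using homD[OF that] GA[of f] by (simp add: id_fctr_def comp_fctr_def)
    show "\<eta> y \<cdot>\<^bsub>C\<^esub> FA id_fctr f = FA (comp_fctr G F) f \<cdot>\<^bsub>C\<^esub> \<eta> x" if "f \<in> hom C x y" for f x y
    proof (rule uniq[of "FO F y"])
      note f = homD[OF that]
      have o: "x \<in> Ob C" "y \<in> Ob C"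
        using f by auto
      have "\<epsilon> (FO F y) \<cdot>\<^bsub>D\<^esub> FA F (FA (comp_fctr G F) f \<cdot>\<^bsub>C\<^esub> \<eta> x)
          = \<epsilon> (FO F y) \<cdot>\<^bsub>D\<^esub> FA F (FA G (FA F f)) \<cdot>\<^bsub>D\<^esub> FA F (\<eta> x)"
        using f o GA(1-3)[of "FA F f"] n(1-3) by (simp add: comp_fctr_def FA_cmp B.assoc)
      also have "\<dots> = FA F f \<cdot>\<^bsub>D\<^esub> \<epsilon> (FO F x) \<cdot>\<^bsub>D\<^esub> FA F (\<eta> x)"
        using f GA[of "FA F f"] by simp
      also have "\<dots> = FA F f \<cdot>\<^bsub>D\<^esub> (\<epsilon> (FO F x) \<cdot>\<^bsub>D\<^esub> FA F (\<eta> x))"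
        using f o n(1-3)[OF o(1)] by (simp add: B.assoc)
      also have "\<dots> = FA F f"
        using f o n by simp
      also have "\<dots> = \<epsilon> (FO F y) \<cdot>\<^bsub>D\<^esub> FA F (\<eta> y) \<cdot>\<^bsub>D\<^esub> FA F f"
        using f o n by simp
      also have "\<dots> = \<epsilon> (FO F y) \<cdot>\<^bsub>D\<^esub> FA F (\<eta> y \<cdot>\<^bsub>C\<^esub> FA id_fctr f)"
        using f o n(1-3)[OF o(2)] by (simp add: id_fctr_def FA_cmp B.assoc)
      finally show "\<epsilon> (FO F y) \<cdot>\<^bsub>D\<^esub> FA F (\<eta> y \<cdot>\<^bsub>C\<^esub> FA id_fctr f)
          = \<epsilon> (FO F y) \<cdot>\<^bsub>D\<^esub> FA F (FA (comp_fctr G F) f \<cdot>\<^bsub>C\<^esub> \<eta> x)" ..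
    qed (use that n[of x] n[of y] A.dom_Ob A.cod_Ob GA[of "FA F f"] in
        \<open>auto simp: hom_def id_fctr_def comp_fctr_def\<close>)
    show "\<epsilon> (FO F x) \<cdot>\<^bsub>D\<^esub> FA F (\<eta> x) = Ide D (FO F x)" if "x \<in> Ob C" for x
      using n[OF that] by simp
    show "FA G (\<epsilon> y) \<cdot>\<^bsub>C\<^esub> \<eta> (FO G y) = Ide C (FO G y)" if y: "y \<in> Ob D" for y
    proof (rule uniq[OF y])
      have "\<epsilon> y \<cdot>\<^bsub>D\<^esub> FA F (FA G (\<epsilon> y) \<cdot>\<^bsub>C\<^esub> \<eta> (FO G y))
          = \<epsilon> y \<cdot>\<^bsub>D\<^esub> FA F (FA G (\<epsilon> y)) \<cdot>\<^bsub>D\<^esub> FA F (\<eta> (t y))"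
        using y GA(1-3)[of "\<epsilon> y"] n(1-3)[of "t y"] by (simp add: GO FA_cmp B.assoc)
      also have "\<dots> = \<epsilon> y \<cdot>\<^bsub>D\<^esub> \<epsilon> (FO F (t y)) \<cdot>\<^bsub>D\<^esub> FA F (\<eta> (t y))"
        using y GA[of "\<epsilon> y"] by simp
      also have "\<dots> = \<epsilon> y \<cdot>\<^bsub>D\<^esub> (\<epsilon> (FO F (t y)) \<cdot>\<^bsub>D\<^esub> FA F (\<eta> (t y)))"
        using y n(1-3)[of "t y"] by (simp add: B.assoc)
      also have "\<dots> = \<epsilon> y \<cdot>\<^bsub>D\<^esub> FA F (Ide C (FO G y))"
        using y n[of "t y"] by (simp add: GO)
      finally show "\<epsilon> y \<cdot>\<^bsub>D\<^esub> FA F (FA G (\<epsilon> y) \<cdot>\<^bsub>C\<^esub> \<eta> (FO G y))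
          = \<epsilon> y \<cdot>\<^bsub>D\<^esub> FA F (Ide C (FO G y))" .
    qed (use y n[of "t y"] GA[of "\<epsilon> y"] in \<open>auto simp: GO\<close>)
  qed
  then show ?thesis by blast
qed


section \<open>Calculus in a double category\<close>

locale dbl = double_category D for D :: "('o, 'v, 'h, 'c) dblcat" (structure)
begin

abbreviation "idv \<equiv> Ide (VCat D)"
abbreviation "idc \<equiv> Ide (HCat D)"
abbreviation "inv1 \<equiv> cinv (HCat D)"

lemmas assoc0 = S.B.assoc and assoc1 = S.A.assoc

lemma hpairs_simps [simp]:
  "(M, N) \<in> Ob (hpairs D) \<longleftrightarrow> M \<in> Ob (HCat D) \<and> N \<in> Ob (HCat D) \<and> hsrc D M = htgt D N"
  "(\<alpha>, \<beta>) \<in> Ar (hpairs D) \<longleftrightarrow> \<alpha> \<in> Ar (HCat D) \<and> \<beta> \<in> Ar (HCat D) \<and> csrc D \<alpha> = ctgt D \<beta>"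
  "Dom (hpairs D) (\<alpha>, \<beta>) = (Dom (HCat D) \<alpha>, Dom (HCat D) \<beta>)"
  "Cod (hpairs D) (\<alpha>, \<beta>) = (Cod (HCat D) \<alpha>, Cod (HCat D) \<beta>)"
  "Ide (hpairs D) (M, N) = (idc M, idc N)"
  "Cmp (hpairs D) (\<alpha>', \<beta>') (\<alpha>, \<beta>) = (\<alpha>' \<cdot>\<^sub>1 \<alpha>, \<beta>' \<cdot>\<^sub>1 \<beta>)"
  by (auto simp: hpairs_def prod_cat_def)

lemma hunit_simps [simp]:
  "A \<in> Ob (VCat D) \<Longrightarrow> hsrc D (hunit D A) = A"
  "A \<in> Ob (VCat D) \<Longrightarrow> htgt D (hunit D A) = A"
  "f \<in> Ar (VCat D) \<Longrightarrow> csrc D (cunit D f) = f"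
  "f \<in> Ar (VCat D) \<Longrightarrow> ctgt D (cunit D f) = f"
  using unit_Ob unit_Ar by auto

lemma hcomp_simps [simp]:
  assumes "M \<in> Ob (HCat D)" "N \<in> Ob (HCat D)" "hsrc D M = htgt D N"
  shows "M \<odot> N \<in> Ob (HCat D)" "hsrc D (M \<odot> N) = hsrc D N" "htgt D (M \<odot> N) = htgt D M"
  using assms H.FO_Ob[of "(M, N)"] hcomp_Ob[of M N] by simp_all

lemma ccomp_simps [simp]:
  assumes "\<alpha> \<in> Ar (HCat D)" "\<beta> \<in> Ar (HCat D)" "csrc D \<alpha> = ctgt D \<beta>"
  shows "\<alpha> \<star> \<beta> \<in> Ar (HCat D)" "Dom (HCat D) (\<alpha> \<star> \<beta>) = Dom (HCat D) \<alpha> \<odot> Dom (HCat D) \<beta>"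
    "Cod (HCat D) (\<alpha> \<star> \<beta>) = Cod (HCat D) \<alpha> \<odot> Cod (HCat D) \<beta>"
    "csrc D (\<alpha> \<star> \<beta>) = csrc D \<beta>" "ctgt D (\<alpha> \<star> \<beta>) = ctgt D \<alpha>"
  using assms H.FA_simps[of "(\<alpha>, \<beta>)"] hcomp_Ar[of \<alpha> \<beta>] by simp_all

lemma ccomp_ide [simp]:
  assumes "M \<in> Ob (HCat D)" "N \<in> Ob (HCat D)" "hsrc D M = htgt D N"
  shows "idc M \<star> idc N = idc (M \<odot> N)"
  using assms H.FA_ide[of "(M, N)"] by simp

lemma interchange:
  assumes "\<alpha> \<in> Ar (HCat D)" "\<beta> \<in> Ar (HCat D)" "csrc D \<alpha> = ctgt D \<beta>"
    "\<alpha>' \<in> Ar (HCat D)" "\<beta>' \<in> Ar (HCat D)" "csrc D \<alpha>' = ctgt D \<beta>'"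
    "Dom (HCat D) \<alpha>' = Cod (HCat D) \<alpha>" "Dom (HCat D) \<beta>' = Cod (HCat D) \<beta>"
  shows "(\<alpha>' \<star> \<beta>') \<cdot>\<^sub>1 (\<alpha> \<star> \<beta>) = (\<alpha>' \<cdot>\<^sub>1 \<alpha>) \<star> (\<beta>' \<cdot>\<^sub>1 \<beta>)"
  using assms H.FA_cmp[of "(\<alpha>, \<beta>)" "(\<alpha>', \<beta>')"] by simp

lemmas cmp_sides [simp] = S.FA_cmp T.FA_cmp

lemma cells_iff:
  "\<alpha> \<in> cells D f g M N \<longleftrightarrow> \<alpha> \<in> Ar (HCat D) \<and> Dom (HCat D) \<alpha> = M \<and> Cod (HCat D) \<alpha> = N
     \<and> csrc D \<alpha> = f \<and> ctgt D \<alpha> = g"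
  by (auto simp: cells_def hom_def)

lemma cellsD:
  assumes "\<alpha> \<in> cells D f g M N"
  shows "\<alpha> \<in> Ar (HCat D)" "Dom (HCat D) \<alpha> = M" "Cod (HCat D) \<alpha> = N"
    "csrc D \<alpha> = f" "ctgt D \<alpha> = g" "M \<in> Ob (HCat D)" "N \<in> Ob (HCat D)"
    "f \<in> Ar (VCat D)" "g \<in> Ar (VCat D)" "Dom (VCat D) f = hsrc D M" "Cod (VCat D) f = hsrc D N"
    "Dom (VCat D) g = htgt D M" "Cod (VCat D) g = htgt D N"
  using assms by (auto simp: cells_iff)

lemma globularD:
  assumes "\<alpha> \<in> globular D M N"
  shows "\<alpha> \<in> Ar (HCat D)" "Dom (HCat D) \<alpha> = M" "Cod (HCat D) \<alpha> = N" "M \<in> Ob (HCat D)"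
    "N \<in> Ob (HCat D)" "csrc D \<alpha> = idv (hsrc D M)" "ctgt D \<alpha> = idv (htgt D M)"
    "hsrc D N = hsrc D M" "htgt D N = htgt D M"
proof -
  note a = cellsD[OF assms[unfolded globular_def]]
  then show "\<alpha> \<in> Ar (HCat D)" "Dom (HCat D) \<alpha> = M" "Cod (HCat D) \<alpha> = N" "M \<in> Ob (HCat D)"
    "N \<in> Ob (HCat D)" "csrc D \<alpha> = idv (hsrc D M)" "ctgt D \<alpha> = idv (htgt D M)"
    by simp_all
  show "hsrc D N = hsrc D M" "htgt D N = htgt D M"
    using a(6) a(11,13)[symmetric] by simp_all
qed

lemma globular_iff:
  "\<alpha> \<in> globular D M N \<longleftrightarrow> \<alpha> \<in> Ar (HCat D) \<and> Dom (HCat D) \<alpha> = M \<and> Cod (HCat D) \<alpha> = N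
     \<and> csrc D \<alpha> = idv (hsrc D M) \<and> ctgt D \<alpha> = idv (htgt D M)"
  by (auto simp: globular_def cells_iff)

lemma Lun_simps [simp]:
  assumes "M \<in> Ob (HCat D)"
  shows "Lun D M \<in> Ar (HCat D)" "Dom (HCat D) (Lun D M) = hunit D (htgt D M) \<odot> M"
    "Cod (HCat D) (Lun D M) = M" "csrc D (Lun D M) = idv (hsrc D M)"
    "ctgt D (Lun D M) = idv (htgt D M)" "invertible (HCat D) (Lun D M)"
  using lunit_cell[OF assms] assms by (auto simp: globular_iff)

lemma Run_simps [simp]:
  assumes "M \<in> Ob (HCat D)"
  shows "Run D M \<in> Ar (HCat D)" "Dom (HCat D) (Run D M) = M \<odot> hunit D (hsrc D M)"
    "Cod (HCat D) (Run D M) = M" "csrc D (Run D M) = idv (hsrc D M)"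
    "ctgt D (Run D M) = idv (htgt D M)" "invertible (HCat D) (Run D M)"
  using runit_cell[OF assms] assms by (auto simp: globular_iff)

lemma Asc_simps [simp]:
  assumes "M \<in> Ob (HCat D)" "N \<in> Ob (HCat D)" "P \<in> Ob (HCat D)"
    "hsrc D M = htgt D N" "hsrc D N = htgt D P"
  shows "Asc D M N P \<in> Ar (HCat D)" "Dom (HCat D) (Asc D M N P) = M \<odot> N \<odot> P"
    "Cod (HCat D) (Asc D M N P) = M \<odot> (N \<odot> P)" "csrc D (Asc D M N P) = idv (hsrc D P)"
    "ctgt D (Asc D M N P) = idv (htgt D M)" "invertible (HCat D) (Asc D M N P)"
  using assoc_cell[of M N P] assms by (auto simp: globular_iff)

lemma inv1_simps [simp]:
  assumes "invertible (HCat D) \<alpha>"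
  shows "inv1 \<alpha> \<in> Ar (HCat D)" "Dom (HCat D) (inv1 \<alpha>) = Cod (HCat D) \<alpha>"
    "Cod (HCat D) (inv1 \<alpha>) = Dom (HCat D) \<alpha>"
  using S.A.cinv_simps[OF assms] by auto

text \<open>Apply \<open>csrc\<close> or \<open>ctgt\<close> to the composite of
  \<open>\<alpha>\<close> with its inverse, which is an identity cell: by functoriality the side of
  the inverse is all that remains.\<close>

lemma inv1_sides [simp]:
  assumes i: "invertible (HCat D) \<alpha>"
  shows "csrc D \<alpha> = idv A \<Longrightarrow> A \<in> Ob (VCat D) \<Longrightarrow> csrc D (inv1 \<alpha>) = idv A"
    "ctgt D \<alpha> = idv A \<Longrightarrow> A \<in> Ob (VCat D) \<Longrightarrow> ctgt D (inv1 \<alpha>) = idv A"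
proof -
  have a: "\<alpha> \<in> Ar (HCat D)"
    using i by (rule S.A.invertible_Ar)
  have c: "\<alpha> \<cdot>\<^sub>1 inv1 \<alpha> = idc (Cod (HCat D) \<alpha>)"
    using S.A.cinv_simps[OF i] by simp
  show "csrc D (inv1 \<alpha>) = idv A" if s: "csrc D \<alpha> = idv A" and A: "A \<in> Ob (VCat D)"
  proof -
    have "hsrc D (Cod (HCat D) \<alpha>) = A" "hsrc D (Dom (HCat D) \<alpha>) = A"
      using S.FA_simps[OF a] s A by auto
    then show ?thesis
      using arg_cong[OF c, of "csrc D"] a i s A by (simp del: S.A.cmp_cinv)
  qed
  show "ctgt D (inv1 \<alpha>) = idv A" if s: "ctgt D \<alpha> = idv A" and A: "A \<in> Ob (VCat D)"
  proof -
    have "htgt D (Cod (HCat D) \<alpha>) = A" "htgt D (Dom (HCat D) \<alpha>) = A"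
      using T.FA_simps[OF a] s A by auto
    then show ?thesis
      using arg_cong[OF c, of "ctgt D"] a i s A by (simp del: S.A.cmp_cinv)
  qed
qed

lemma Lun_natural:
  assumes "\<alpha> \<in> Ar (HCat D)" "ctgt D \<alpha> = g" "Dom (HCat D) \<alpha> = M" "Cod (HCat D) \<alpha> = N"
  shows "Lun D N \<cdot>\<^sub>1 (cunit D g \<star> \<alpha>) = \<alpha> \<cdot>\<^sub>1 Lun D M"
  using lunit_natural[of \<alpha> M N] assms by (simp add: hom_def)

lemma Run_natural:
  assumes "\<alpha> \<in> Ar (HCat D)" "csrc D \<alpha> = f" "Dom (HCat D) \<alpha> = M" "Cod (HCat D) \<alpha> = N"
  shows "Run D N \<cdot>\<^sub>1 (\<alpha> \<star> cunit D f) = \<alpha> \<cdot>\<^sub>1 Run D M"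
  using runit_natural[of \<alpha> M N] assms by (simp add: hom_def)

lemma Asc_natural:
  assumes "\<alpha> \<in> Ar (HCat D)" "\<beta> \<in> Ar (HCat D)" "\<gamma> \<in> Ar (HCat D)"
    "csrc D \<alpha> = ctgt D \<beta>" "csrc D \<beta> = ctgt D \<gamma>"
    "Dom (HCat D) \<alpha> = M" "Cod (HCat D) \<alpha> = M'" "Dom (HCat D) \<beta> = N" "Cod (HCat D) \<beta> = N'"
    "Dom (HCat D) \<gamma> = P" "Cod (HCat D) \<gamma> = P'"
  shows "Asc D M' N' P' \<cdot>\<^sub>1 (\<alpha> \<star> \<beta> \<star> \<gamma>) = \<alpha> \<star> (\<beta> \<star> \<gamma>) \<cdot>\<^sub>1 Asc D M N P"
  using assoc_natural[of \<alpha> M M' \<beta> N N' \<gamma> P P'] assms by (simp add: hom_def)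

text \<open>Whiskering with a unit arrow is naturally isomorphic to the identity through
  \<open>Lun\<close>, hence faithful. The unit laws below are first proved in whiskered form,
  because that is where the triangle axiom speaks.\<close>

lemma star_unit_monic:
  assumes "\<alpha> \<in> cells D f (idv A) M N" "\<beta> \<in> cells D f (idv A) M N" "A \<in> Ob (VCat D)"
    and eq: "idc (hunit D A) \<star> \<alpha> = idc (hunit D A) \<star> \<beta>"
  shows "\<alpha> = \<beta>"
proof -
  note a = cellsD[OF assms(1)] and b = cellsD[OF assms(2)]
  have A: "htgt D M = A"
    using a assms(3) by simp
  have "\<alpha> \<cdot>\<^sub>1 Lun D M = \<beta> \<cdot>\<^sub>1 Lun D M"
    using Lun_natural[of \<alpha> "idv A" M N] Lun_natural[of \<beta> "idv A" M N] a b eq assms(3) by simp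
  then show ?thesis
    using a b A by - (rule S.A.invertible_epic[of "Lun D M" \<alpha> \<beta>], auto)
qed

lemma unit_star_monic:
  assumes "\<alpha> \<in> cells D (idv A) g M N" "\<beta> \<in> cells D (idv A) g M N" "A \<in> Ob (VCat D)"
    and eq: "\<alpha> \<star> idc (hunit D A) = \<beta> \<star> idc (hunit D A)"
  shows "\<alpha> = \<beta>"
proof -
  note a = cellsD[OF assms(1)] and b = cellsD[OF assms(2)]
  have A: "hsrc D M = A"
    using a assms(3) by simp
  have "\<alpha> \<cdot>\<^sub>1 Run D M = \<beta> \<cdot>\<^sub>1 Run D M"
    using Run_natural[of \<alpha> "idv A" M N] Run_natural[of \<beta> "idv A" M N] a b eq assms(3) by simp
  then show ?thesis
    using a b A by - (rule S.A.invertible_epic[of "Run D M" \<alpha> \<beta>], auto)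
qed

text \<open>As in Kelly's argument for monoidal categories, the next two unit laws follow from the
  pentagon and the triangle.\<close>

lemma Lun_hcomp:
  assumes M: "M \<in> Ob (HCat D)" "htgt D M = A" and N: "N \<in> Ob (HCat D)" "hsrc D M = htgt D N"
  shows "Lun D (M \<odot> N) \<cdot>\<^sub>1 Asc D (hunit D A) M N = Lun D M \<star> idc N"
proof -
  let ?I = "hunit D A"
  have A: "A \<in> Ob (VCat D)"
    using M by auto
  note [simp] = M N A
  \<comment> \<open>\<open>X\<close> consists of the first two factors of the longer side of the
    pentagon for \<open>?I, ?I, M, N\<close>. It is invertible, so the wanted equation may be tested
    after whiskering with \<open>?I\<close> and precomposing with \<open>X\<close>.\<close>
  define X where "X = Asc D ?I (?I \<odot> M) N \<cdot>\<^sub>1 (Asc D ?I ?I M \<star> idc N)"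
  have i2: "invertible (HCat D) (Asc D ?I ?I M \<star> idc N)"
    by (rule S.A.invertibleI[of _ "inv1 (Asc D ?I ?I M) \<star> idc N"]) (auto simp: interchange)
  have X: "invertible (HCat D) X"
    unfolding X_def
    by (rule S.A.invertibleI[of _ "inv1 (Asc D ?I ?I M \<star> idc N) \<cdot>\<^sub>1 inv1 (Asc D ?I (?I \<odot> M) N)"])
      (use i2 in \<open>auto simp: assoc1\<close>)
  have Xs: "X \<in> Ar (HCat D)" "Dom (HCat D) X = ?I \<odot> ?I \<odot> M \<odot> N" "Cod (HCat D) X = ?I \<odot> (?I \<odot> M \<odot> N)"
    by (auto simp: X_def)
  have tri: "(idc ?I \<star> Lun D Y) \<cdot>\<^sub>1 Asc D ?I ?I Y = Run D ?I \<star> idc Y"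
    if "Y \<in> Ob (HCat D)" "htgt D Y = A" for Y
    using triangle[of ?I Y] that by simp
  have pen: "(idc ?I \<star> Asc D ?I M N) \<cdot>\<^sub>1 X = Asc D ?I ?I (M \<odot> N) \<cdot>\<^sub>1 Asc D (?I \<odot> ?I) M N"
    using pentagon[of ?I ?I M N] by (simp add: X_def assoc1)
  have "(idc ?I \<star> (Lun D (M \<odot> N) \<cdot>\<^sub>1 Asc D ?I M N)) \<cdot>\<^sub>1 X
      = (idc ?I \<star> Lun D (M \<odot> N)) \<cdot>\<^sub>1 (idc ?I \<star> Asc D ?I M N) \<cdot>\<^sub>1 X"
    by (simp add: interchange)
  also have "\<dots> = (idc ?I \<star> Lun D (M \<odot> N)) \<cdot>\<^sub>1 ((idc ?I \<star> Asc D ?I M N) \<cdot>\<^sub>1 X)"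
    using Xs by (simp add: assoc1)
  also have "\<dots> = (idc ?I \<star> Lun D (M \<odot> N)) \<cdot>\<^sub>1 Asc D ?I ?I (M \<odot> N) \<cdot>\<^sub>1 Asc D (?I \<odot> ?I) M N"
    unfolding pen by (simp add: assoc1)
  also have "\<dots> = (Run D ?I \<star> (idc M \<star> idc N)) \<cdot>\<^sub>1 Asc D (?I \<odot> ?I) M N"
    by (simp add: tri)
  also have "\<dots> = Asc D ?I M N \<cdot>\<^sub>1 (Run D ?I \<star> idc M \<star> idc N)"
    by (rule Asc_natural[symmetric]) auto
  also have "\<dots> = Asc D ?I M N \<cdot>\<^sub>1 (((idc ?I \<star> Lun D M) \<cdot>\<^sub>1 Asc D ?I ?I M) \<star> idc N)"
    by (simp add: tri)
  also have "\<dots> = Asc D ?I M N \<cdot>\<^sub>1 (idc ?I \<star> Lun D M \<star> idc N) \<cdot>\<^sub>1 (Asc D ?I ?I M \<star> idc N)"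
    by (simp add: interchange assoc1)
  also have "\<dots> = idc ?I \<star> (Lun D M \<star> idc N) \<cdot>\<^sub>1 Asc D ?I (?I \<odot> M) N \<cdot>\<^sub>1 (Asc D ?I ?I M \<star> idc N)"
    by (subst Asc_natural) auto
  also have "\<dots> = idc ?I \<star> (Lun D M \<star> idc N) \<cdot>\<^sub>1 X"
    by (simp add: X_def assoc1)
  finally have "idc ?I \<star> (Lun D (M \<odot> N) \<cdot>\<^sub>1 Asc D ?I M N) = idc ?I \<star> (Lun D M \<star> idc N)"
    using Xs by - (rule S.A.invertible_epic[OF X], auto)
  then show ?thesis
    by - (rule star_unit_monic[of _ "idv (hsrc D N)" A "hunit D A \<odot> M \<odot> N" "M \<odot> N"],
      auto simp: cells_iff)
qed

lemma Lun_eq_Run_hunit: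
  assumes A: "A \<in> Ob (VCat D)"
  shows "Lun D (hunit D A) = Run D (hunit D A)"
proof -
  let ?I = "hunit D A"
  \<comment> \<open>Naturality of \<open>Lun\<close> at the cell \<open>Lun D ?I\<close> itself;
    cancelling the outer \<open>Lun D ?I\<close> leaves an expression for \<open>Lun\<close> on the
    composite of two units.\<close>
  have "Lun D ?I \<cdot>\<^sub>1 (idc ?I \<star> Lun D ?I) = Lun D ?I \<cdot>\<^sub>1 Lun D (?I \<odot> ?I)"
    using Lun_natural[of "Lun D ?I" "idv A"] A by simp
  then have "idc ?I \<star> Lun D ?I = Lun D (?I \<odot> ?I)"
    using A by - (rule S.A.invertible_monic[of "Lun D ?I"], auto)
  \<comment> \<open>The same composite with the associator is \<open>Lun D ?I \<star> idc ?I\<close>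
    by \<open>Lun_hcomp\<close> and \<open>Run D ?I \<star> idc ?I\<close> by the triangle.\<close>
  then have "Lun D ?I \<star> idc ?I = Run D ?I \<star> idc ?I"
    using Lun_hcomp[of ?I A ?I] triangle[of ?I ?I] A by simp
  then show ?thesis
    using A by - (rule unit_star_monic[of _ A "idv A" "?I \<odot> ?I" ?I], auto simp: cells_iff)
qed

end


section \<open>The horizontal dual\<close>

text \<open>Horizontal arrows are reversed and vertical arrows kept, so source and target, left and
  right units, companions and conjoints trade places, while Cartesian and op-Cartesian cells stay
  what they are. Rebracketing runs the other way, whence the inverse associator. Each one-sided
  lemma proved for all double categories thereby yields its mirror image.\<close>

definition hop :: "('o, 'v, 'h, 'c) dblcat \<Rightarrow> ('o, 'v, 'h, 'c) dblcat" where
  "hop D = \<lparr>VCat = VCat D, HCat = HCat D, Src = Tgt D, Tgt = Src D, Unt = Unt D,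
     Hcmp = \<lparr>FO = (\<lambda>(M, N). N \<odot>\<^bsub>D\<^esub> M), FA = (\<lambda>(\<alpha>, \<beta>). \<beta> \<star>\<^bsub>D\<^esub> \<alpha>)\<rparr>,
     Asc = (\<lambda>M N P. cinv (HCat D) (Asc D P N M)), Lun = Run D, Run = Lun D\<rparr>"

lemma hop_simps [simp]:
  "VCat (hop D) = VCat D" "HCat (hop D) = HCat D" "Src (hop D) = Tgt D" "Tgt (hop D) = Src D"
  "Unt (hop D) = Unt D" "M \<odot>\<^bsub>hop D\<^esub> N = N \<odot>\<^bsub>D\<^esub> M" "\<alpha> \<star>\<^bsub>hop D\<^esub> \<beta> = \<beta> \<star>\<^bsub>D\<^esub> \<alpha>"
  "Asc (hop D) M N P = cinv (HCat D) (Asc D P N M)" "Lun (hop D) = Run D" "Run (hop D) = Lun D"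
  by (simp_all add: hop_def)

lemma cells_hop [simp]: "cells (hop D) f g M N = cells D g f M N"
  by (auto simp: cells_def)

lemma globular_hop [simp]: "globular (hop D) M N = globular D M N"
  by (simp add: globular_def)

context dbl
begin

lemma interchange_cmp:
  assumes "\<alpha> \<in> Ar (HCat D)" "\<beta> \<in> Ar (HCat D)" "csrc D \<alpha> = ctgt D \<beta>"
    "\<alpha>' \<in> Ar (HCat D)" "\<beta>' \<in> Ar (HCat D)" "csrc D \<alpha>' = ctgt D \<beta>'"
    "Dom (HCat D) \<alpha>' = Cod (HCat D) \<alpha>" "Dom (HCat D) \<beta>' = Cod (HCat D) \<beta>"
    "\<zeta> \<in> Ar (HCat D)" "Cod (HCat D) \<zeta> = Dom (HCat D) \<alpha> \<odot> Dom (HCat D) \<beta>"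
  shows "(\<alpha>' \<star> \<beta>') \<cdot>\<^sub>1 ((\<alpha> \<star> \<beta>) \<cdot>\<^sub>1 \<zeta>) = ((\<alpha>' \<cdot>\<^sub>1 \<alpha>) \<star> (\<beta>' \<cdot>\<^sub>1 \<beta>)) \<cdot>\<^sub>1 \<zeta>"
  using interchange[OF assms(1-8)] assms(9,10) ccomp_simps[OF assms(1-3)] ccomp_simps[OF assms(4-6)]
    assms(7,8)
  by (simp flip: assoc1)

lemma Asc_inv_natural:
  assumes "\<alpha> \<in> Ar (HCat D)" "\<beta> \<in> Ar (HCat D)" "\<gamma> \<in> Ar (HCat D)"
    "csrc D \<alpha> = ctgt D \<beta>" "csrc D \<beta> = ctgt D \<gamma>"
    "Dom (HCat D) \<alpha> = M" "Cod (HCat D) \<alpha> = M'" "Dom (HCat D) \<beta> = N" "Cod (HCat D) \<beta> = N'"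
    "Dom (HCat D) \<gamma> = P" "Cod (HCat D) \<gamma> = P'"
  shows "inv1 (Asc D M' N' P') \<cdot>\<^sub>1 (\<alpha> \<star> (\<beta> \<star> \<gamma>)) = \<alpha> \<star> \<beta> \<star> \<gamma> \<cdot>\<^sub>1 inv1 (Asc D M N P)"
proof -
  have [simp]: "M \<in> Ob (HCat D)" "N \<in> Ob (HCat D)" "P \<in> Ob (HCat D)"
    "M' \<in> Ob (HCat D)" "N' \<in> Ob (HCat D)" "P' \<in> Ob (HCat D)"
    using assms by auto
  have [simp]: "hsrc D M = htgt D N" "hsrc D N = htgt D P" "hsrc D M' = htgt D N'" "hsrc D N' = htgt D P'"
    using assms S.FA_simps[OF assms(1)] S.FA_simps[OF assms(2)] T.FA_simps[OF assms(2)]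
      T.FA_simps[OF assms(3)] by auto
  note [simp] = assms
  have "Asc D M' N' P' \<cdot>\<^sub>1 (\<alpha> \<star> \<beta> \<star> \<gamma> \<cdot>\<^sub>1 inv1 (Asc D M N P)) = \<alpha> \<star> (\<beta> \<star> \<gamma>)"
    using Asc_natural[OF assms] by (simp flip: assoc1) (simp add: assoc1)
  then have "inv1 (Asc D M' N' P') \<cdot>\<^sub>1 (\<alpha> \<star> (\<beta> \<star> \<gamma>))
      = inv1 (Asc D M' N' P') \<cdot>\<^sub>1 (Asc D M' N' P' \<cdot>\<^sub>1 (\<alpha> \<star> \<beta> \<star> \<gamma> \<cdot>\<^sub>1 inv1 (Asc D M N P)))"
    by simp
  then show ?thesis
    by (subst (asm) S.A.cinv_cmp_cmp) auto
qed

text \<open>The composable pairs of the dual are those of \<open>D\<close> with the coordinates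
  exchanged, so everything about \<open>hpairs\<close> is transported along
  \<open>prod.swap\<close>. Pentagon and triangle hold because they are the original ones with
  inverted associators.\<close>

lemma dbl_hop: "dbl (hop D)"
proof -
  have d: "Dom (hpairs (hop D)) p = prod.swap (Dom (hpairs D) (prod.swap p))"
    "Cod (hpairs (hop D)) p = prod.swap (Cod (hpairs D) (prod.swap p))"
    "p \<in> Ar (hpairs (hop D)) \<longleftrightarrow> prod.swap p \<in> Ar (hpairs D)" for p
    by (cases p; auto simp: hpairs_def prod_cat_def)+
  have o: "x \<in> Ob (hpairs (hop D)) \<longleftrightarrow> prod.swap x \<in> Ob (hpairs D)" for x
    by (cases x; auto simp: hpairs_def prod_cat_def)
  have i: "Ide (hpairs (hop D)) x = prod.swap (Ide (hpairs D) (prod.swap x))" for x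
    by (cases x; auto simp: hpairs_def prod_cat_def)+
  have c: "Cmp (hpairs (hop D)) q p = prod.swap (Cmp (hpairs D) (prod.swap q) (prod.swap p))" for p q
    by (cases p; cases q; auto simp: hpairs_def prod_cat_def)+
  have h: "p \<in> hom (hpairs (hop D)) x y \<longleftrightarrow> prod.swap p \<in> hom (hpairs D) (prod.swap x) (prod.swap y)"
    for p x y
    by (auto simp: hom_def d)
  have f: "FO (Hcmp (hop D)) x = FO (Hcmp D) (prod.swap x)" for x
    by (cases x; auto simp: hop_def)
  have g: "FA (Hcmp (hop D)) x = FA (Hcmp D) (prod.swap x)" for x
    by (cases x; auto simp: hop_def)
  have cat: "category (hpairs (hop D))"
  proof
    show "Dom (hpairs (hop D)) p \<in> Ob (hpairs (hop D))"
      "Cod (hpairs (hop D)) p \<in> Ob (hpairs (hop D))" if "p \<in> Ar (hpairs (hop D))" for p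
      using that by (simp_all add: d o)
    show "Ide (hpairs (hop D)) x \<in> hom (hpairs (hop D)) x x" if "x \<in> Ob (hpairs (hop D))" for x
      using that H.A.ide_hom by (simp add: h i o)
    show "Cmp (hpairs (hop D)) q p \<in> hom (hpairs (hop D)) x z"
      if "p \<in> hom (hpairs (hop D)) x y" "q \<in> hom (hpairs (hop D)) y z" for p q x y z
      using that H.A.cmp_hom by (auto simp: h c)
    show "Cmp (hpairs (hop D)) p (Ide (hpairs (hop D)) x) = p"
      "Cmp (hpairs (hop D)) (Ide (hpairs (hop D)) y) p = p"
      if "p \<in> hom (hpairs (hop D)) x y" for p x y
      using that H.A.cmp_ide H.A.ide_cmp by (auto simp: h c i)
    show "Cmp (hpairs (hop D)) (Cmp (hpairs (hop D)) r q) p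
        = Cmp (hpairs (hop D)) r (Cmp (hpairs (hop D)) q p)"
      if "p \<in> hom (hpairs (hop D)) w x" "q \<in> hom (hpairs (hop D)) x y"
        "r \<in> hom (hpairs (hop D)) y z" for p q r w x y z
      using that H.A.cmp_assoc by (auto simp: h c)
  qed
  have hc: "cat_functor (hpairs (hop D)) (HCat D) (Hcmp (hop D))"
  proof (intro cat_functor.intro cat cat_functor_axioms.intro)
    show "category (HCat D)" ..
    show "FO (Hcmp (hop D)) x \<in> Ob (HCat D)" if "x \<in> Ob (hpairs (hop D))" for x
      using that by (simp add: o f)
    show "FA (Hcmp (hop D)) p \<in> hom (HCat D) (FO (Hcmp (hop D)) x) (FO (Hcmp (hop D)) y)"
      if "p \<in> hom (hpairs (hop D)) x y" for p x y
      using that H.map_hom by (simp add: h f g)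
    show "FA (Hcmp (hop D)) (Ide (hpairs (hop D)) x) = idc (FO (Hcmp (hop D)) x)"
      if "x \<in> Ob (hpairs (hop D))" for x
      using that by (simp add: o f g i)
    show "FA (Hcmp (hop D)) (Cmp (hpairs (hop D)) q p)
        = FA (Hcmp (hop D)) q \<cdot>\<^sub>1 FA (Hcmp (hop D)) p"
      if "p \<in> hom (hpairs (hop D)) x y" "q \<in> hom (hpairs (hop D)) y z" for p q x y z
      using that H.map_cmp by (auto simp: h g c)
  qed
  have ho: "(M, N) \<in> Ob (hpairs (hop D)) \<longleftrightarrow> M \<in> Ob (HCat D) \<and> N \<in> Ob (HCat D) \<and> htgt D M = hsrc D N"
    for M N
    by (auto simp: o)
  have ha: "(\<alpha>, \<beta>) \<in> Ar (hpairs (hop D))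
      \<longleftrightarrow> \<alpha> \<in> Ar (HCat D) \<and> \<beta> \<in> Ar (HCat D) \<and> ctgt D \<alpha> = csrc D \<beta>" for \<alpha> \<beta>
    by (auto simp: d)
  show ?thesis
  proof (intro dbl.intro double_category.intro double_category_axioms.intro, simp_all only: hop_simps globular_hop)
    show "cat_functor (HCat D) (VCat D) (Tgt D)" "cat_functor (HCat D) (VCat D) (Src D)"
      "cat_functor (VCat D) (HCat D) (Unt D)"
      by (fact T.cat_functor_axioms, fact S.cat_functor_axioms, fact U.cat_functor_axioms)
    show "cat_functor (hpairs (hop D)) (HCat D) (Hcmp (hop D))"
      by (fact hc)
  next
    fix M N P
    assume "(M, N) \<in> Ob (hpairs (hop D))" "(N, P) \<in> Ob (hpairs (hop D))"
    then show "inv1 (Asc D P N M) \<in> globular D (P \<odot> (N \<odot> M)) (P \<odot> N \<odot> M)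
      \<and> invertible (HCat D) (inv1 (Asc D P N M))"
      by (auto simp: ho globular_iff intro: S.A.invertible_cinv)
  next
    fix \<alpha> \<beta> \<gamma> M M' N N' P P'
    assume "\<alpha> \<in> hom (HCat D) M M'" "\<beta> \<in> hom (HCat D) N N'" "\<gamma> \<in> hom (HCat D) P P'"
      "ctgt D \<alpha> = csrc D \<beta>" "ctgt D \<beta> = csrc D \<gamma>"
    then show "inv1 (Asc D P' N' M') \<cdot>\<^sub>1 (\<gamma> \<star> (\<beta> \<star> \<alpha>)) = \<gamma> \<star> \<beta> \<star> \<alpha> \<cdot>\<^sub>1 inv1 (Asc D P N M)"
      by (intro Asc_inv_natural) (auto simp: hom_def)
  next
    fix M N P Q
    assume "(M, N) \<in> Ob (hpairs (hop D))" "(N, P) \<in> Ob (hpairs (hop D))" "(P, Q) \<in> Ob (hpairs (hop D))"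
    then have [simp]: "M \<in> Ob (HCat D)" "N \<in> Ob (HCat D)" "P \<in> Ob (HCat D)" "Q \<in> Ob (HCat D)"
      "htgt D M = hsrc D N" "htgt D N = hsrc D P" "htgt D P = hsrc D Q"
      by (auto simp: ho)
    \<comment> \<open>\<open>?Z\<close> is one side of the pentagon of \<open>D\<close>. Both sides
      of the dual pentagon are left inverse to it, the longer one by rewriting \<open>?Z\<close>
      with the pentagon of \<open>D\<close>.\<close>
    let ?Z = "Asc D Q P (N \<odot> M) \<cdot>\<^sub>1 Asc D (Q \<odot> P) N M"
    have Z: "invertible (HCat D) ?Z"
      by (rule S.A.invertibleI[of _ "inv1 (Asc D (Q \<odot> P) N M) \<cdot>\<^sub>1 inv1 (Asc D Q P (N \<odot> M))"])
        (auto simp: assoc1)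
    show "inv1 (Asc D (Q \<odot> P) N M) \<cdot>\<^sub>1 inv1 (Asc D Q P (N \<odot> M)) =
       inv1 (Asc D Q P N) \<star> idc M \<cdot>\<^sub>1 inv1 (Asc D Q (P \<odot> N) M) \<cdot>\<^sub>1 (idc Q \<star> inv1 (Asc D P N M))"
    proof (rule S.A.invertible_epic[OF Z])
      have "inv1 (Asc D Q P N) \<star> idc M \<cdot>\<^sub>1 inv1 (Asc D Q (P \<odot> N) M) \<cdot>\<^sub>1 (idc Q \<star> inv1 (Asc D P N M)) \<cdot>\<^sub>1 ?Z
        = idc (Q \<odot> P \<odot> N \<odot> M)"
        unfolding pentagon[of Q P N M, simplified]
        by (simp add: assoc1 interchange interchange_cmp)
      moreover have "inv1 (Asc D (Q \<odot> P) N M) \<cdot>\<^sub>1 inv1 (Asc D Q P (N \<odot> M)) \<cdot>\<^sub>1 ?Z = idc (Q \<odot> P \<odot> N \<odot> M)"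
        by (simp add: assoc1)
      ultimately show "inv1 (Asc D (Q \<odot> P) N M) \<cdot>\<^sub>1 inv1 (Asc D Q P (N \<odot> M)) \<cdot>\<^sub>1 ?Z =
       inv1 (Asc D Q P N) \<star> idc M \<cdot>\<^sub>1 inv1 (Asc D Q (P \<odot> N) M) \<cdot>\<^sub>1 (idc Q \<star> inv1 (Asc D P N M)) \<cdot>\<^sub>1 ?Z"
        by simp
    qed auto
  next
    fix M N
    assume "(M, N) \<in> Ob (hpairs (hop D))"
    then have [simp]: "M \<in> Ob (HCat D)" "N \<in> Ob (HCat D)" "htgt D M = hsrc D N"
      by (auto simp: ho)
    have "Run D N \<star> idc M \<cdot>\<^sub>1 inv1 (Asc D N (hunit D (hsrc D N)) M)
      = idc N \<star> Lun D M \<cdot>\<^sub>1 Asc D N (hunit D (hsrc D N)) M \<cdot>\<^sub>1 inv1 (Asc D N (hunit D (hsrc D N)) M)"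
      using triangle[of N M] by simp
    then show "Run D N \<star> idc M \<cdot>\<^sub>1 inv1 (Asc D N (hunit D (htgt D M)) M) = idc N \<star> Lun D M"
      by (simp add: assoc1)
  qed (use Lun_natural Run_natural in \<open>auto simp: ho ha globular_iff hom_def\<close>)
qed

end


section \<open>Cartesian and op-Cartesian cells\<close>

context dbl
begin

lemma cartesianI:
  assumes c: "c \<in> cells D f g M N"
    and ex: "\<And>Q h k \<beta>. \<lbrakk>\<beta> \<in> cells D (f \<cdot>\<^sub>0 h) (g \<cdot>\<^sub>0 k) Q N; h \<in> hom (VCat D) (hsrc D Q) (hsrc D M);
      k \<in> hom (VCat D) (htgt D Q) (htgt D M)\<rbrakk> \<Longrightarrow> \<exists>\<gamma> \<in> cells D h k Q M. c \<cdot>\<^sub>1 \<gamma> = \<beta>"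
    and un: "\<And>Q h k \<gamma> \<gamma>'. \<lbrakk>\<gamma> \<in> cells D h k Q M; \<gamma>' \<in> cells D h k Q M; c \<cdot>\<^sub>1 \<gamma> = c \<cdot>\<^sub>1 \<gamma>'\<rbrakk> \<Longrightarrow> \<gamma> = \<gamma>'"
  shows "cartesian_cell D c"
  unfolding cartesian_cell_def using cellsD[OF c] ex un by metis

lemma cartesian_factor:
  assumes "cartesian_cell D c" and c: "c \<in> cells D f g M N"
    and \<beta>: "\<beta> \<in> cells D f' g' Q N" and f': "f' = f \<cdot>\<^sub>0 h" and g': "g' = g \<cdot>\<^sub>0 k"
    and "h \<in> hom (VCat D) (hsrc D Q) (hsrc D M)" "k \<in> hom (VCat D) (htgt D Q) (htgt D M)"
  obtains \<gamma> where "\<gamma> \<in> cells D h k Q M" "c \<cdot>\<^sub>1 \<gamma> = \<beta>"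
  using assms cellsD[OF c] cellsD[OF \<beta>] unfolding cartesian_cell_def by metis

lemma cartesian_monic:
  assumes cc: "cartesian_cell D c" and c: "c \<in> cells D f g M N"
    and \<gamma>: "\<gamma> \<in> cells D h k Q M" and \<gamma>': "\<gamma>' \<in> cells D h k Q M"
    and eq: "c \<cdot>\<^sub>1 \<gamma> = c \<cdot>\<^sub>1 \<gamma>'"
  shows "\<gamma> = \<gamma>'"
proof -
  note cD = cellsD[OF c] and gD = cellsD[OF \<gamma>]
  have "c \<cdot>\<^sub>1 \<gamma> \<in> cells D (csrc D c \<cdot>\<^sub>0 h) (ctgt D c \<cdot>\<^sub>0 k) Q (Cod (HCat D) c)"
    using cD gD by (auto simp: cells_iff)
  moreover have "h \<in> hom (VCat D) (hsrc D Q) (hsrc D (Dom (HCat D) c))"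
    "k \<in> hom (VCat D) (htgt D Q) (htgt D (Dom (HCat D) c))"
    using cD gD by (auto simp: hom_def)
  ultimately have "\<exists>!\<delta>. \<delta> \<in> cells D h k Q (Dom (HCat D) c) \<and> c \<cdot>\<^sub>1 \<gamma> = c \<cdot>\<^sub>1 \<delta>"
    using cc gD(6) unfolding cartesian_cell_def by blast
  then show ?thesis
    using \<gamma> \<gamma>' eq cD by metis
qed

lemma opcartesianI:
  assumes c: "c \<in> cells D f g M N"
    and ex: "\<And>Q h k \<beta>. \<lbrakk>\<beta> \<in> cells D (h \<cdot>\<^sub>0 f) (k \<cdot>\<^sub>0 g) M Q; h \<in> hom (VCat D) (hsrc D N) (hsrc D Q);
      k \<in> hom (VCat D) (htgt D N) (htgt D Q)\<rbrakk> \<Longrightarrow> \<exists>\<gamma> \<in> cells D h k N Q. \<gamma> \<cdot>\<^sub>1 c = \<beta>"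
    and un: "\<And>Q h k \<gamma> \<gamma>'. \<lbrakk>\<gamma> \<in> cells D h k N Q; \<gamma>' \<in> cells D h k N Q; \<gamma> \<cdot>\<^sub>1 c = \<gamma>' \<cdot>\<^sub>1 c\<rbrakk> \<Longrightarrow> \<gamma> = \<gamma>'"
  shows "opcartesian_cell D c"
  unfolding opcartesian_cell_def using cellsD[OF c] ex un by metis

lemma opcartesian_factor:
  assumes "opcartesian_cell D c" and c: "c \<in> cells D f g M N"
    and \<beta>: "\<beta> \<in> cells D f' g' M Q" and f': "f' = h \<cdot>\<^sub>0 f" and g': "g' = k \<cdot>\<^sub>0 g"
    and "h \<in> hom (VCat D) (hsrc D N) (hsrc D Q)" "k \<in> hom (VCat D) (htgt D N) (htgt D Q)"
  obtains \<gamma> where "\<gamma> \<in> cells D h k N Q" "\<gamma> \<cdot>\<^sub>1 c = \<beta>"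
  using assms cellsD[OF c] cellsD[OF \<beta>] unfolding opcartesian_cell_def by metis

lemma opcartesian_epic:
  assumes cc: "opcartesian_cell D c" and c: "c \<in> cells D f g M N"
    and \<gamma>: "\<gamma> \<in> cells D h k N Q" and \<gamma>': "\<gamma>' \<in> cells D h k N Q"
    and eq: "\<gamma> \<cdot>\<^sub>1 c = \<gamma>' \<cdot>\<^sub>1 c"
  shows "\<gamma> = \<gamma>'"
proof -
  note cD = cellsD[OF c] and gD = cellsD[OF \<gamma>]
  have "\<gamma> \<cdot>\<^sub>1 c \<in> cells D (h \<cdot>\<^sub>0 csrc D c) (k \<cdot>\<^sub>0 ctgt D c) (Dom (HCat D) c) Q"
    using cD gD by (auto simp: cells_iff)
  moreover have "h \<in> hom (VCat D) (hsrc D (Cod (HCat D) c)) (hsrc D Q)"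
    "k \<in> hom (VCat D) (htgt D (Cod (HCat D) c)) (htgt D Q)"
    using cD gD by (auto simp: hom_def)
  ultimately have "\<exists>!\<delta>. \<delta> \<in> cells D h k (Cod (HCat D) c) Q \<and> \<gamma> \<cdot>\<^sub>1 c = \<delta> \<cdot>\<^sub>1 c"
    using cc gD(7) unfolding opcartesian_cell_def by blast
  then show ?thesis
    using \<gamma> \<gamma>' eq cD by metis
qed

text \<open>A cell out of the domain factors as itself after the inverse. The sides of
  \<open>c\<close> are arbitrary, so that the result covers both globular comparison cells and unit
  cells of vertical isomorphisms.\<close>

lemma opcartesian_invertible:
  assumes i: "invertible (HCat D) c"
  shows "opcartesian_cell D c"
proof -
  define f g M N where "f = csrc D c" and "g = ctgt D c" and "M = Dom (HCat D) c"
    and "N = Cod (HCat D) c"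
  have c: "c \<in> cells D f g M N"
    using S.A.invertible_Ar[OF i] by (auto simp: cells_iff f_def g_def M_def N_def)
  note [simp] = cellsD[OF c] i
  \<comment> \<open>Taking sides shows that the inverse cell has right inverses of \<open>f\<close>
    and \<open>g\<close> as sides; this gives the factor the prescribed sides \<open>h\<close> and
    \<open>k\<close>.\<close>
  have "c \<cdot>\<^sub>1 inv1 c = idc N"
    by simp
  from arg_cong[OF this, of "csrc D"] arg_cong[OF this, of "ctgt D"]
  have [simp]: "f \<cdot>\<^sub>0 csrc D (inv1 c) = idv (hsrc D N)" "g \<cdot>\<^sub>0 ctgt D (inv1 c) = idv (htgt D N)"
    by (simp_all del: S.A.cmp_cinv)
  show ?thesis
  proof (rule opcartesianI[OF c])
    fix Q h k \<beta>
    assume b: "\<beta> \<in> cells D (h \<cdot>\<^sub>0 f) (k \<cdot>\<^sub>0 g) M Q"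
      and h: "h \<in> hom (VCat D) (hsrc D N) (hsrc D Q)" and k: "k \<in> hom (VCat D) (htgt D N) (htgt D Q)"
    show "\<exists>\<gamma> \<in> cells D h k N Q. \<gamma> \<cdot>\<^sub>1 c = \<beta>"
      using cellsD[OF b] homD[OF h] homD[OF k]
      by (intro bexI[of _ "\<beta> \<cdot>\<^sub>1 inv1 c"]) (auto simp: cells_iff assoc1 assoc0)
  next
    fix Q h k \<gamma> \<gamma>'
    assume c: "\<gamma> \<in> cells D h k N Q" "\<gamma>' \<in> cells D h k N Q" and eq: "\<gamma> \<cdot>\<^sub>1 c = \<gamma>' \<cdot>\<^sub>1 c"
    show "\<gamma> = \<gamma>'"
      by (rule S.A.invertible_epic[OF i _ _ _ _ eq]) (use cellsD(1,2)[OF c(1)] cellsD(1,2)[OF c(2)] in auto)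
  qed
qed

lemma opcartesian_cmp:
  assumes a: "opcartesian_cell D a" "a \<in> cells D f g M N"
    and b: "opcartesian_cell D b" "b \<in> cells D f' g' N P"
  shows "opcartesian_cell D (b \<cdot>\<^sub>1 a)"
proof (rule opcartesianI)
  note [simp] = cellsD[OF a(2)] cellsD[OF b(2)]
  show "b \<cdot>\<^sub>1 a \<in> cells D (f' \<cdot>\<^sub>0 f) (g' \<cdot>\<^sub>0 g) M P"
    by (auto simp: cells_iff)
  fix Q h k
  show "\<exists>\<gamma> \<in> cells D h k P Q. \<gamma> \<cdot>\<^sub>1 (b \<cdot>\<^sub>1 a) = \<beta>"
    if \<beta>: "\<beta> \<in> cells D (h \<cdot>\<^sub>0 (f' \<cdot>\<^sub>0 f)) (k \<cdot>\<^sub>0 (g' \<cdot>\<^sub>0 g)) M Q"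
      and h: "h \<in> hom (VCat D) (hsrc D P) (hsrc D Q)"
      and k: "k \<in> hom (VCat D) (htgt D P) (htgt D Q)" for \<beta>
  proof -
    note [simp] = homD[OF h] homD[OF k]
    obtain \<gamma> where \<gamma>: "\<gamma> \<in> cells D (h \<cdot>\<^sub>0 f') (k \<cdot>\<^sub>0 g') N Q" "\<gamma> \<cdot>\<^sub>1 a = \<beta>"
      by (rule opcartesian_factor[OF a \<beta>, of "h \<cdot>\<^sub>0 f'" "k \<cdot>\<^sub>0 g'"]) (auto simp: assoc0 hom_def)
    obtain \<delta> where \<delta>: "\<delta> \<in> cells D h k P Q" "\<delta> \<cdot>\<^sub>1 b = \<gamma>"
      by (rule opcartesian_factor[OF b \<gamma>(1), of h k]) (auto simp: hom_def)
    show ?thesis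
      using \<delta> \<gamma> cellsD[OF \<delta>(1)] by (intro bexI[of _ \<delta>]) (auto simp flip: assoc1)
  qed
  show "\<gamma> = \<gamma>'"
    if \<gamma>: "\<gamma> \<in> cells D h k P Q" "\<gamma>' \<in> cells D h k P Q"
      and eq: "\<gamma> \<cdot>\<^sub>1 (b \<cdot>\<^sub>1 a) = \<gamma>' \<cdot>\<^sub>1 (b \<cdot>\<^sub>1 a)" for \<gamma> \<gamma>'
  proof -
    note [simp] = cellsD[OF \<gamma>(1)] cellsD[OF \<gamma>(2)]
    have "\<gamma> \<cdot>\<^sub>1 b = \<gamma>' \<cdot>\<^sub>1 b"
      using eq by - (rule opcartesian_epic[OF a, of _ "h \<cdot>\<^sub>0 f'" "k \<cdot>\<^sub>0 g'" Q],
        auto simp: cells_iff assoc1)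
    then show ?thesis
      by (rule opcartesian_epic[OF b \<gamma>])
  qed
qed

text \<open>Op-Cartesian cells with the same domain and sides factor through each other, and
  uniqueness of factorizations makes the two factors mutually inverse.\<close>

lemma opcartesian_comparison:
  assumes a: "opcartesian_cell D a" "a \<in> cells D f g M N"
    and b: "opcartesian_cell D b" "b \<in> cells D f g M P"
  obtains m where "m \<in> globular D N P" "m \<cdot>\<^sub>1 a = b" "invertible (HCat D) m"
proof -
  note [simp] = cellsD[OF a(2)] cellsD[OF b(2)]
  have [simp]: "hsrc D P = hsrc D N" "htgt D P = htgt D N"
    using cellsD(11,13)[OF a(2)] cellsD(11,13)[OF b(2)] by simp_all
  have i: "idv (hsrc D N) \<in> hom (VCat D) (hsrc D N) (hsrc D N)"
    "idv (htgt D N) \<in> hom (VCat D) (htgt D N) (htgt D N)"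
    by (auto simp: hom_def)
  obtain m where m: "m \<in> cells D (idv (hsrc D N)) (idv (htgt D N)) N P" "m \<cdot>\<^sub>1 a = b"
    using i by (auto intro: opcartesian_factor[OF a b(2), of "idv (hsrc D N)" "idv (htgt D N)"])
  obtain n where n: "n \<in> cells D (idv (hsrc D N)) (idv (htgt D N)) P N" "n \<cdot>\<^sub>1 b = a"
    using i by (auto intro: opcartesian_factor[OF b a(2), of "idv (hsrc D N)" "idv (htgt D N)"])
  note [simp] = cellsD(1-5)[OF m(1)] cellsD(1-5)[OF n(1)]
  have "n \<cdot>\<^sub>1 m = idc N"
    by (rule opcartesian_epic[OF a, of _ "idv (hsrc D N)" "idv (htgt D N)" N])
      (auto simp: cells_iff assoc1 m n)
  moreover have "m \<cdot>\<^sub>1 n = idc P"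
    by (rule opcartesian_epic[OF b, of _ "idv (hsrc D N)" "idv (htgt D N)" P])
      (auto simp: cells_iff assoc1 m n)
  ultimately have "invertible (HCat D) m"
    by (intro S.A.invertibleI[of _ n]) auto
  then show ?thesis
    using m that by (auto simp: globular_def)
qed

text \<open>The equational form of a companion. \<open>\<epsilon>\<close> and \<open>\<eta>\<close>
  are its binding cells: vertically they compose to the unit cell of \<open>f\<close>, horizontally
  to the identity of \<open>K\<close> up to unit isomorphisms. In contrast to the universal property
  in \<open>companion\<close>, these equations serve Cartesian and op-Cartesian arguments
  alike.\<close>

definition companion_cells :: "'v \<Rightarrow> 'h \<Rightarrow> 'c \<Rightarrow> 'c \<Rightarrow> bool" where
  "companion_cells f K \<epsilon> \<eta> \<longleftrightarrow>
     \<epsilon> \<in> cells D f (idv (Cod (VCat D) f)) K (hunit D (Cod (VCat D) f)) \<and>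
     \<eta> \<in> cells D (idv (Dom (VCat D) f)) f (hunit D (Dom (VCat D) f)) K \<and>
     \<epsilon> \<cdot>\<^sub>1 \<eta> = cunit D f \<and> Lun D K \<cdot>\<^sub>1 (\<epsilon> \<star> \<eta>) = Run D K"

lemma companion_cellsD:
  assumes "companion_cells f K \<epsilon> \<eta>" "Dom (VCat D) f = A" "Cod (VCat D) f = B"
  shows "f \<in> Ar (VCat D)" "K \<in> Ob (HCat D)" "hsrc D K = A" "htgt D K = B"
    "A \<in> Ob (VCat D)" "B \<in> Ob (VCat D)"
    "\<epsilon> \<in> Ar (HCat D)" "Dom (HCat D) \<epsilon> = K" "Cod (HCat D) \<epsilon> = hunit D B" "csrc D \<epsilon> = f" "ctgt D \<epsilon> = idv B"
    "\<eta> \<in> Ar (HCat D)" "Dom (HCat D) \<eta> = hunit D A" "Cod (HCat D) \<eta> = K" "csrc D \<eta> = idv A" "ctgt D \<eta> = f"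
    "\<epsilon> \<cdot>\<^sub>1 \<eta> = cunit D f" "Lun D K \<cdot>\<^sub>1 (\<epsilon> \<star> \<eta>) = Run D K"
proof -
  have e: "\<epsilon> \<in> cells D f (idv B) K (hunit D B)" and n: "\<eta> \<in> cells D (idv A) f (hunit D A) K"
    and eq: "\<epsilon> \<cdot>\<^sub>1 \<eta> = cunit D f" "Lun D K \<cdot>\<^sub>1 (\<epsilon> \<star> \<eta>) = Run D K"
    using assms by (auto simp: companion_cells_def)
  note e' = cellsD[OF e] and n' = cellsD[OF n]
  show "f \<in> Ar (VCat D)" "K \<in> Ob (HCat D)" "hsrc D K = A" "htgt D K = B"
    "A \<in> Ob (VCat D)" "B \<in> Ob (VCat D)"
    "\<epsilon> \<in> Ar (HCat D)" "Dom (HCat D) \<epsilon> = K" "Cod (HCat D) \<epsilon> = hunit D B" "csrc D \<epsilon> = f" "ctgt D \<epsilon> = idv B"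
    "\<eta> \<in> Ar (HCat D)" "Dom (HCat D) \<eta> = hunit D A" "Cod (HCat D) \<eta> = K" "csrc D \<eta> = idv A" "ctgt D \<eta> = f"
    "\<epsilon> \<cdot>\<^sub>1 \<eta> = cunit D f" "Lun D K \<cdot>\<^sub>1 (\<epsilon> \<star> \<eta>) = Run D K"
    using e' n' eq assms(2,3) by auto
qed

text \<open>\<open>\<eta>\<close> is the factorization of the unit cell of \<open>f\<close> through
  the Cartesian cell \<open>\<epsilon>\<close>. The horizontal law is tested after
  \<open>\<epsilon>\<close>, where it reduces to naturality of \<open>Lun\<close> and
  \<open>Run\<close> and to their agreement on a unit arrow.\<close>

lemma companion_cells_exist:
  assumes "companion D f K"
  obtains \<epsilon> \<eta> where "companion_cells f K \<epsilon> \<eta>" "cartesian_cell D \<epsilon>"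
proof -
  define A B where "A = Dom (VCat D) f" and "B = Cod (VCat D) f"
  obtain \<epsilon> where e: "\<epsilon> \<in> cells D f (idv B) K (hunit D B)" and c: "cartesian_cell D \<epsilon>"
    using assms unfolding companion_def Let_def B_def by blast
  have f [simp]: "f \<in> Ar (VCat D)" "Dom (VCat D) f = A" "Cod (VCat D) f = B"
    "A \<in> Ob (VCat D)" "B \<in> Ob (VCat D)" "hsrc D K = A" "htgt D K = B"
  proof -
    show f: "f \<in> Ar (VCat D)" "Dom (VCat D) f = A" "Cod (VCat D) f = B"
      using cellsD(8)[OF e] by (simp_all add: A_def B_def)
    show AB: "A \<in> Ob (VCat D)" "B \<in> Ob (VCat D)"
      using f by (auto simp: A_def B_def)
    show "hsrc D K = A" "htgt D K = B"
      using cellsD(10,12)[OF e] f AB by auto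
  qed
  note [simp] = cellsD(1-7)[OF e]
  obtain \<eta> where n: "\<eta> \<in> cells D (idv A) f (hunit D A) K" and en: "\<epsilon> \<cdot>\<^sub>1 \<eta> = cunit D f"
    by (rule cartesian_factor[OF c e, of "cunit D f" f f "hunit D A" "idv A" f])
      (auto simp: cells_iff hom_def)
  note [simp] = cellsD(1-5)[OF n]
  have "\<epsilon> \<cdot>\<^sub>1 (Lun D K \<cdot>\<^sub>1 (\<epsilon> \<star> \<eta>)) = \<epsilon> \<cdot>\<^sub>1 Lun D K \<cdot>\<^sub>1 (\<epsilon> \<star> \<eta>)"
    by (simp add: assoc1)
  also have "\<dots> = Lun D (hunit D B) \<cdot>\<^sub>1 (idc (hunit D B) \<star> \<epsilon>) \<cdot>\<^sub>1 (\<epsilon> \<star> \<eta>)"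
    using Lun_natural[of \<epsilon> "idv B" K "hunit D B"] by simp
  also have "\<dots> = Run D (hunit D B) \<cdot>\<^sub>1 (\<epsilon> \<star> cunit D f)"
    by (simp add: assoc1 interchange en Lun_eq_Run_hunit)
  also have "\<dots> = \<epsilon> \<cdot>\<^sub>1 Run D K"
    by (rule Run_natural) auto
  finally have "Lun D K \<cdot>\<^sub>1 (\<epsilon> \<star> \<eta>) = Run D K"
    by - (rule cartesian_monic[OF c e, of _ "idv A" "idv B" "K \<odot> hunit D A"], auto simp: cells_iff)
  then show ?thesis
    using that e n en c by (simp add: companion_cells_def)
qed

text \<open>The section \<open>s\<close> identifies \<open>N\<close> with \<open>g\<^sub>* \<odot> M\<close>.\<close>

lemma opcartesian_of_companion_section:
  assumes p: "p \<in> cells D (idv A) g M N" and A: "A \<in> Ob (VCat D)"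
    and K: "companion_cells g K \<epsilon> \<eta>"
    and s: "s \<in> globular D N (K \<odot> M)"
    and s1: "Lun D N \<cdot>\<^sub>1 (\<epsilon> \<star> p) \<cdot>\<^sub>1 s = idc N"
    and s2: "s \<cdot>\<^sub>1 (p \<cdot>\<^sub>1 Lun D M) = \<eta> \<star> idc M"
  shows "opcartesian_cell D p"
proof (rule opcartesianI[OF p])
  note p' = cellsD[OF p]
  define Y Z where "Y = htgt D M" and "Z = htgt D N"
  have o [simp]: "hsrc D M = A" "hsrc D N = A" "htgt D M = Y" "htgt D N = Z"
    using p' A by (auto simp: Y_def Z_def)
  note [simp] = p'(1-9) A
  have g: "Dom (VCat D) g = Y" "Cod (VCat D) g = Z"
    using p' by auto
  note [simp] = g companion_cellsD(1-16)[OF K g] globularD(1-3,6,7)[OF s]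
  fix Q h k
  show "\<exists>\<gamma> \<in> cells D h k N Q. \<gamma> \<cdot>\<^sub>1 p = \<beta>"
    if b: "\<beta> \<in> cells D (h \<cdot>\<^sub>0 idv A) (k \<cdot>\<^sub>0 g) M Q"
      and h: "h \<in> hom (VCat D) (hsrc D N) (hsrc D Q)"
      and k: "k \<in> hom (VCat D) (htgt D N) (htgt D Q)" for \<beta>
  proof
    note [simp] = homD[OF h] homD[OF k] cellsD(1-5,7)[OF b]
    \<comment> \<open>\<open>?u\<close> leads from \<open>K\<close> to a unit arrow and has source
      side \<open>k \<cdot>\<^sub>0 g\<close>, the target side of \<open>\<beta>\<close>, so the two
      cells can be placed side by side. After \<open>s\<close> this gives the factor, and
      \<open>s2\<close> is what makes it one.\<close>
    let ?u = "cunit D k \<cdot>\<^sub>1 \<epsilon>"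
    let ?g = "Lun D Q \<cdot>\<^sub>1 (?u \<star> \<beta>) \<cdot>\<^sub>1 s"
    show c: "?g \<in> cells D h k N Q"
      by (auto simp: cells_iff)
    have "?g \<cdot>\<^sub>1 p \<cdot>\<^sub>1 Lun D M = Lun D Q \<cdot>\<^sub>1 (?u \<star> \<beta>) \<cdot>\<^sub>1 (s \<cdot>\<^sub>1 (p \<cdot>\<^sub>1 Lun D M))"
      by (simp add: assoc1)
    also have "\<dots> = Lun D Q \<cdot>\<^sub>1 ((?u \<cdot>\<^sub>1 \<eta>) \<star> \<beta>)"
      by (simp add: s2 assoc1 interchange)
    also have "?u \<cdot>\<^sub>1 \<eta> = cunit D (k \<cdot>\<^sub>0 g)"
      by (simp add: assoc1 companion_cellsD(17)[OF K g] U.FA_cmp)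
    also have "Lun D Q \<cdot>\<^sub>1 (cunit D (k \<cdot>\<^sub>0 g) \<star> \<beta>) = \<beta> \<cdot>\<^sub>1 Lun D M"
      by (rule Lun_natural) auto
    finally show "?g \<cdot>\<^sub>1 p = \<beta>"
      using cellsD(1-3)[OF c] by - (rule S.A.invertible_epic[of "Lun D M"], auto)
  qed
  show "\<gamma> = \<gamma>'"
    if c: "\<gamma> \<in> cells D h k N Q" "\<gamma>' \<in> cells D h k N Q" and eq: "\<gamma> \<cdot>\<^sub>1 p = \<gamma>' \<cdot>\<^sub>1 p" for \<gamma> \<gamma>'
  proof -
    \<comment> \<open>The formula for the factor, applied to
      \<open>\<delta> \<cdot>\<^sub>1 p\<close>, returns \<open>\<delta>\<close>; this rests on
      \<open>s1\<close> and gives uniqueness.\<close>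
    have "\<delta> = Lun D Q \<cdot>\<^sub>1 ((cunit D k \<cdot>\<^sub>1 \<epsilon>) \<star> (\<delta> \<cdot>\<^sub>1 p)) \<cdot>\<^sub>1 s" if d: "\<delta> \<in> cells D h k N Q" for \<delta>
    proof -
      note [simp] = cellsD(1-5,7-13)[OF d]
      have "Lun D Q \<cdot>\<^sub>1 ((cunit D k \<cdot>\<^sub>1 \<epsilon>) \<star> (\<delta> \<cdot>\<^sub>1 p)) \<cdot>\<^sub>1 s
          = Lun D Q \<cdot>\<^sub>1 (cunit D k \<star> \<delta>) \<cdot>\<^sub>1 ((\<epsilon> \<star> p) \<cdot>\<^sub>1 s)"
        by (simp add: assoc1 interchange_cmp)
      also have "\<dots> = \<delta> \<cdot>\<^sub>1 (Lun D N \<cdot>\<^sub>1 (\<epsilon> \<star> p) \<cdot>\<^sub>1 s)"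
        by (subst Lun_natural) (auto simp: assoc1)
      also have "\<dots> = \<delta>"
        by (simp add: s1)
      finally show ?thesis ..
    qed
    from this[OF c(1)] this[OF c(2)] eq show ?thesis
      by metis
  qed
qed

text \<open>Take \<open>M\<close> to be the unit arrow and \<open>s\<close> the inverse of
  \<open>Run D K\<close>. Then \<open>s1\<close> is the horizontal companion law and
  \<open>s2\<close> is naturality of \<open>Run\<close>.\<close>

lemma companion_unit_opcartesian:
  assumes K: "companion_cells g K \<epsilon> \<eta>"
  shows "opcartesian_cell D \<eta>"
proof (rule opcartesian_of_companion_section[OF _ _ K])
  define A B where "A = Dom (VCat D) g" and "B = Cod (VCat D) g"
  note [simp] = companion_cellsD[OF K A_def[symmetric] B_def[symmetric]]
  show "\<eta> \<in> cells D (idv A) g (hunit D A) K" "A \<in> Ob (VCat D)"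
    "inv1 (Run D K) \<in> globular D K (K \<odot> hunit D A)"
    by (auto simp: cells_iff globular_iff)
  show "Lun D K \<cdot>\<^sub>1 (\<epsilon> \<star> \<eta>) \<cdot>\<^sub>1 inv1 (Run D K) = idc K"
    by simp
  have "Run D K \<cdot>\<^sub>1 (\<eta> \<star> idc (hunit D A)) = \<eta> \<cdot>\<^sub>1 Run D (hunit D A)"
    using Run_natural[of \<eta> "idv A" "hunit D A" K] by simp
  then have "inv1 (Run D K) \<cdot>\<^sub>1 (\<eta> \<cdot>\<^sub>1 Lun D (hunit D A))
      = inv1 (Run D K) \<cdot>\<^sub>1 (Run D K \<cdot>\<^sub>1 (\<eta> \<star> idc (hunit D A)))"
    by (simp add: Lun_eq_Run_hunit)
  then show "inv1 (Run D K) \<cdot>\<^sub>1 (\<eta> \<cdot>\<^sub>1 Lun D (hunit D A)) = \<eta> \<star> idc (hunit D A)"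
    by simp
qed

text \<open>The codomain is \<open>K \<odot> L\<close> itself and the section is the identity, so
  only \<open>s1\<close> has content: it is the horizontal companion law whiskered by
  \<open>L\<close> and carried across the associator.\<close>

lemma companion_star_opcartesian:
  assumes K: "companion_cells g K \<epsilon> \<eta>" and L: "L \<in> Ob (HCat D)" "htgt D L = Dom (VCat D) g"
  shows "opcartesian_cell D ((\<eta> \<star> idc L) \<cdot>\<^sub>1 inv1 (Lun D L))"
proof (rule opcartesian_of_companion_section[OF _ _ K])
  define A B where "A = Dom (VCat D) g" and "B = Cod (VCat D) g"
  note [simp] = companion_cellsD[OF K A_def[symmetric] B_def[symmetric]] A_def[symmetric] L
  let ?p = "(\<eta> \<star> idc L) \<cdot>\<^sub>1 inv1 (Lun D L)"
  show "?p \<in> cells D (idv (hsrc D L)) g L (K \<odot> L)" "hsrc D L \<in> Ob (VCat D)"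
    "idc (K \<odot> L) \<in> globular D (K \<odot> L) (K \<odot> L)"
    by (auto simp: cells_iff globular_iff)
  show "idc (K \<odot> L) \<cdot>\<^sub>1 (?p \<cdot>\<^sub>1 Lun D L) = \<eta> \<star> idc L"
    by (simp add: assoc1)
  have "Lun D (K \<odot> L) \<cdot>\<^sub>1 (\<epsilon> \<star> ?p) = Lun D (K \<odot> L) \<cdot>\<^sub>1 ((\<epsilon> \<star> (\<eta> \<star> idc L)) \<cdot>\<^sub>1 (idc K \<star> inv1 (Lun D L)))"
    by (simp add: interchange)
  \<comment> \<open>The associator and its inverse are inserted to bring \<open>\<epsilon>\<close>
    and \<open>\<eta>\<close> together in one factor. There they combine to \<open>Run D K\<close>,
    which the triangle turns back into \<open>Lun D L\<close>.\<close>
  also have "idc K \<star> inv1 (Lun D L) = Asc D K (hunit D A) L \<cdot>\<^sub>1 (inv1 (Asc D K (hunit D A) L) \<cdot>\<^sub>1 (idc K \<star> inv1 (Lun D L)))"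
    by simp
  also have "Lun D (K \<odot> L) \<cdot>\<^sub>1 ((\<epsilon> \<star> (\<eta> \<star> idc L)) \<cdot>\<^sub>1 \<dots>)
      = Lun D (K \<odot> L) \<cdot>\<^sub>1 ((\<epsilon> \<star> (\<eta> \<star> idc L)) \<cdot>\<^sub>1 Asc D K (hunit D A) L) \<cdot>\<^sub>1 (inv1 (Asc D K (hunit D A) L) \<cdot>\<^sub>1 (idc K \<star> inv1 (Lun D L)))"
    by (simp add: assoc1)
  also have "(\<epsilon> \<star> (\<eta> \<star> idc L)) \<cdot>\<^sub>1 Asc D K (hunit D A) L = Asc D (hunit D B) K L \<cdot>\<^sub>1 (\<epsilon> \<star> \<eta> \<star> idc L)"
    by (rule Asc_natural[symmetric]) auto
  also have "Lun D (K \<odot> L) \<cdot>\<^sub>1 (Asc D (hunit D B) K L \<cdot>\<^sub>1 (\<epsilon> \<star> \<eta> \<star> idc L))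
      = Run D K \<star> idc L"
    using Lun_hcomp[of K B L] by (simp add: interchange flip: assoc1)
  also have "\<dots> = (idc K \<star> Lun D L) \<cdot>\<^sub>1 Asc D K (hunit D A) L"
    using triangle[of K L] by simp
  finally show "Lun D (K \<odot> L) \<cdot>\<^sub>1 (\<epsilon> \<star> ?p) \<cdot>\<^sub>1 idc (K \<odot> L) = idc (K \<odot> L)"
    by (simp add: assoc1 interchange)
qed

end

section \<open>Companions, conjoints and fibrancy under the horizontal dual\<close>

lemma cartesian_cell_hop [simp]: "cartesian_cell (hop D) c = cartesian_cell D c"
  unfolding cartesian_cell_def hop_simps cells_hop by blast

lemma opcartesian_cell_hop [simp]: "opcartesian_cell (hop D) c = opcartesian_cell D c"
  unfolding opcartesian_cell_def hop_simps cells_hop by blast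

lemma companion_hop [simp]: "companion (hop D) f K = conjoint D f K"
  by (simp add: companion_def conjoint_def)

lemma fibrant_hop: "fibrant D \<Longrightarrow> fibrant (hop D)"
  by (simp add: fibrant_def)

context dbl
begin

text \<open>The op-Cartesian cell \<open>U\<^sub>T \<rightarrow> g\<^sub>* \<odot> f\<^sup>*\<close> is \<open>U\<^sub>T \<rightarrow> f\<^sup>* \<rightarrow> g\<^sub>* \<odot> f\<^sup>*\<close>.\<close>

lemma opcartesian_hunit_exists:
  assumes f: "f \<in> hom (VCat D) T A" and g: "g \<in> hom (VCat D) T B"
    and K: "companion D g K" and L: "conjoint D f L"
  obtains \<sigma> where "\<sigma> \<in> cells D f g (hunit D T) (K \<odot> L)" "opcartesian_cell D \<sigma>"
proof -
  interpret op: dbl "hop D" by (rule dbl_hop)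
  note [simp] = homD[OF f] homD[OF g]
  obtain \<epsilon> \<eta> where K': "companion_cells g K \<epsilon> \<eta>"
    using companion_cells_exist[OF K] by metis
  obtain \<epsilon>' \<eta>' where L': "op.companion_cells f L \<epsilon>' \<eta>'"
    using op.companion_cells_exist[of f L] L by (metis companion_hop)
  have T: "T \<in> Ob (VCat D)"
    using homD[OF f] S.B.dom_Ob by metis
  note k = companion_cellsD[OF K', of T B, simplified]
  note l = op.companion_cellsD[OF L', of T A, simplified]
  \<comment> \<open>In \<open>hop D\<close> the conjoint \<open>L\<close> is a companion, so its
    binding cell out of the unit arrow is op-Cartesian; seen in \<open>D\<close> the sides are
    exchanged.\<close>
  have n: "\<eta>' \<in> cells D f (idv T) (hunit D T) L" "opcartesian_cell D \<eta>'"
    using l op.companion_unit_opcartesian[OF L'] by (auto simp: cells_iff)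
  let ?p = "(\<eta> \<star> idc L) \<cdot>\<^sub>1 inv1 (Lun D L)"
  have p: "?p \<in> cells D (idv A) g L (K \<odot> L)" "opcartesian_cell D ?p"
    using k l companion_star_opcartesian[OF K', of L] by (auto simp: cells_iff)
  have "?p \<cdot>\<^sub>1 \<eta>' \<in> cells D f g (hunit D T) (K \<odot> L)"
    using cellsD[OF p(1)] cellsD[OF n(1)] T by (auto simp: cells_iff)
  moreover have "opcartesian_cell D (?p \<cdot>\<^sub>1 \<eta>')"
    by (rule opcartesian_cmp[OF n(2,1) p(2,1)])
  ultimately show ?thesis
    by (rule that)
qed

text \<open>\<open>Lun_hcomp\<close> in the horizontal dual, whose associator is the inverse one and
  is moved back across the equation.\<close>

lemma Run_hcomp:
  assumes "M \<in> Ob (HCat D)" "N \<in> Ob (HCat D)" "hsrc D M = htgt D N" "hsrc D N = A"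
  shows "(idc M \<star> Run D N) \<cdot>\<^sub>1 Asc D M N (hunit D A) = Run D (M \<odot> N)"
proof -
  interpret op: dbl "hop D" by (rule dbl_hop)
  have "Run D (M \<odot> N) \<cdot>\<^sub>1 inv1 (Asc D M N (hunit D A)) = idc M \<star> Run D N"
    using op.Lun_hcomp[of N A M] assms by simp
  then have "(idc M \<star> Run D N) \<cdot>\<^sub>1 Asc D M N (hunit D A)
      = Run D (M \<odot> N) \<cdot>\<^sub>1 inv1 (Asc D M N (hunit D A)) \<cdot>\<^sub>1 Asc D M N (hunit D A)"
    by simp
  also have "\<dots> = Run D (M \<odot> N)"
    using assms by (auto simp: assoc1)
  finally show ?thesis .
qed

text \<open>Restriction of \<open>M\<close> along \<open>(h, 1)\<close> is \<open>M \<odot> h\<^sub>*\<close>, so it commutes with \<open>K \<odot> -\<close>.\<close>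

lemma star_cartesian:
  assumes c: "cartesian_cell D c" "c \<in> cells D h (idv Z) M' M" and Z: "Z \<in> Ob (VCat D)"
    and K: "K \<in> Ob (HCat D)" "hsrc D K = Z"
    and H: "companion_cells h H \<epsilon> \<eta>"
  shows "cartesian_cell D (idc K \<star> c)"
proof -
  define B C where "B = Dom (VCat D) h" and "C = Cod (VCat D) h"
  note c' = cellsD[OF c(2)]
  have o [simp]: "hsrc D M' = B" "hsrc D M = C" "htgt D M' = Z" "htgt D M = Z"
    using c' Z by (simp_all add: B_def C_def)
  note [simp] = c'(1-9) Z K
  note [simp] = companion_cellsD(1-16)[OF H B_def[symmetric] C_def[symmetric]] B_def[symmetric] C_def[symmetric]
  have en: "\<epsilon> \<cdot>\<^sub>1 \<eta> = cunit D h"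
    using H by (simp add: companion_cells_def)
  \<comment> \<open>\<open>r\<close> contracts \<open>M \<odot> H\<close> to the restriction
    \<open>M'\<close>. By \<open>rc\<close> below it undoes \<open>c \<star> \<eta>\<close>, up to
    the right unit.\<close>
  obtain r where r: "r \<in> cells D (idv B) (idv Z) (M \<odot> H) M'" and cr: "c \<cdot>\<^sub>1 r = Run D M \<cdot>\<^sub>1 (idc M \<star> \<epsilon>)"
    by (rule cartesian_factor[OF c, of "Run D M \<cdot>\<^sub>1 (idc M \<star> \<epsilon>)" h "idv Z" "M \<odot> H" "idv B" "idv Z"])
      (auto simp: cells_iff hom_def)
  note [simp] = cellsD(1-5)[OF r]
  have rc: "r \<cdot>\<^sub>1 (c \<star> \<eta>) = Run D M'"
  proof (rule cartesian_monic[OF c])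
    have "c \<cdot>\<^sub>1 (r \<cdot>\<^sub>1 (c \<star> \<eta>)) = c \<cdot>\<^sub>1 r \<cdot>\<^sub>1 (c \<star> \<eta>)"
      by (simp add: assoc1)
    also have "\<dots> = Run D M \<cdot>\<^sub>1 (c \<star> cunit D h)"
      by (simp add: cr assoc1 interchange en)
    also have "\<dots> = c \<cdot>\<^sub>1 Run D M'"
      by (rule Run_natural) auto
    finally show "c \<cdot>\<^sub>1 (r \<cdot>\<^sub>1 (c \<star> \<eta>)) = c \<cdot>\<^sub>1 Run D M'" .
  qed (auto simp: cells_iff)
  \<comment> \<open>The factor of \<open>v\<close>: append a unit arrow to \<open>Q\<close>, send it
    into \<open>H\<close> by \<open>\<eta>\<close> after the unit cell of \<open>m\<close>,
    reassociate, and contract by \<open>r\<close>. The part \<open>h\<close> of the source side of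
    \<open>v\<close> is absorbed by \<open>H\<close>, leaving \<open>m\<close>.\<close>
  define lift where "lift m Q v = (idc K \<star> r) \<cdot>\<^sub>1 Asc D K M H \<cdot>\<^sub>1 (v \<star> (\<eta> \<cdot>\<^sub>1 cunit D m)) \<cdot>\<^sub>1 inv1 (Run D Q)"
    for m Q v
  have ic: "idc K \<star> c \<in> cells D h (idv (htgt D K)) (K \<odot> M') (K \<odot> M)"
    by (auto simp: cells_iff)
  show ?thesis
  proof (rule cartesianI[OF ic])
    fix Q m n v
    assume v: "v \<in> cells D (h \<cdot>\<^sub>0 m) (idv (htgt D K) \<cdot>\<^sub>0 n) Q (K \<odot> M)"
      and m: "m \<in> hom (VCat D) (hsrc D Q) (hsrc D (K \<odot> M'))"
      and n: "n \<in> hom (VCat D) (htgt D Q) (htgt D (K \<odot> M'))"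
    note [simp] = homD(1)[OF m] homD(2-)[OF m, simplified] homD(1)[OF n] homD(2-)[OF n, simplified]
    have v': "v \<in> cells D (h \<cdot>\<^sub>0 m) n Q (K \<odot> M)"
      using v by simp
    note [simp] = cellsD(1-6)[OF v']
    show "\<exists>\<gamma> \<in> cells D m n Q (K \<odot> M'). (idc K \<star> c) \<cdot>\<^sub>1 \<gamma> = v"
    proof
      show "lift m Q v \<in> cells D m n Q (K \<odot> M')"
        by (auto simp: cells_iff lift_def)
      have "(idc K \<star> c) \<cdot>\<^sub>1 lift m Q v
          = (idc K \<star> (c \<cdot>\<^sub>1 r)) \<cdot>\<^sub>1 (Asc D K M H \<cdot>\<^sub>1 (v \<star> (\<eta> \<cdot>\<^sub>1 cunit D m)) \<cdot>\<^sub>1 inv1 (Run D Q))"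
        by (simp add: lift_def assoc1 interchange_cmp)
      also have "\<dots> = (idc K \<star> Run D M) \<cdot>\<^sub>1 (idc K \<star> (idc M \<star> \<epsilon>) \<cdot>\<^sub>1 Asc D K M H)
          \<cdot>\<^sub>1 (v \<star> (\<eta> \<cdot>\<^sub>1 cunit D m)) \<cdot>\<^sub>1 inv1 (Run D Q)"
        by (simp add: cr assoc1 interchange_cmp)
      also have "idc K \<star> (idc M \<star> \<epsilon>) \<cdot>\<^sub>1 Asc D K M H = Asc D K M (hunit D C) \<cdot>\<^sub>1 (idc K \<star> idc M \<star> \<epsilon>)"
        by (rule Asc_natural[symmetric]) auto
      also have "(idc K \<star> Run D M) \<cdot>\<^sub>1 (Asc D K M (hunit D C) \<cdot>\<^sub>1 (idc K \<star> idc M \<star> \<epsilon>))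
          = Run D (K \<odot> M) \<cdot>\<^sub>1 (idc K \<star> idc M \<star> \<epsilon>)"
        using Run_hcomp[of K M C] by (simp flip: assoc1)
      also have "\<dots> \<cdot>\<^sub>1 (v \<star> (\<eta> \<cdot>\<^sub>1 cunit D m)) = Run D (K \<odot> M) \<cdot>\<^sub>1 (v \<star> (\<epsilon> \<cdot>\<^sub>1 \<eta> \<cdot>\<^sub>1 cunit D m))"
        by (simp add: assoc1 interchange)
      also have "\<epsilon> \<cdot>\<^sub>1 \<eta> \<cdot>\<^sub>1 cunit D m = cunit D (h \<cdot>\<^sub>0 m)"
        by (simp add: en U.FA_cmp)
      also have "Run D (K \<odot> M) \<cdot>\<^sub>1 (v \<star> cunit D (h \<cdot>\<^sub>0 m)) = v \<cdot>\<^sub>1 Run D Q"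
        by (rule Run_natural) auto
      finally show "(idc K \<star> c) \<cdot>\<^sub>1 lift m Q v = v"
        by (simp add: assoc1)
    qed
  next
    fix Q m n s s'
    assume s: "s \<in> cells D m n Q (K \<odot> M')" "s' \<in> cells D m n Q (K \<odot> M')"
      and eq: "(idc K \<star> c) \<cdot>\<^sub>1 s = (idc K \<star> c) \<cdot>\<^sub>1 s'"
    \<comment> \<open>By \<open>rc\<close>, \<open>lift\<close> recovers a cell from its composite
      with \<open>idc K \<star> c\<close>, which is uniqueness.\<close>
    have "lift m Q ((idc K \<star> c) \<cdot>\<^sub>1 s) = s" if s: "s \<in> cells D m n Q (K \<odot> M')" for s
    proof -
      note [simp] = cellsD(1-6,8-13)[OF s]
      have "lift m Q ((idc K \<star> c) \<cdot>\<^sub>1 s) = (idc K \<star> r) \<cdot>\<^sub>1 (Asc D K M H \<cdot>\<^sub>1 (idc K \<star> c \<star> \<eta>))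
          \<cdot>\<^sub>1 (s \<star> cunit D m) \<cdot>\<^sub>1 inv1 (Run D Q)"
        by (simp add: lift_def assoc1 interchange_cmp)
      also have "Asc D K M H \<cdot>\<^sub>1 (idc K \<star> c \<star> \<eta>) = idc K \<star> (c \<star> \<eta>) \<cdot>\<^sub>1 Asc D K M' (hunit D B)"
        by (rule Asc_natural) auto
      also have "(idc K \<star> r) \<cdot>\<^sub>1 (idc K \<star> (c \<star> \<eta>) \<cdot>\<^sub>1 Asc D K M' (hunit D B)) = Run D (K \<odot> M')"
        by (simp add: interchange_cmp rc Run_hcomp)
      also have "Run D (K \<odot> M') \<cdot>\<^sub>1 (s \<star> cunit D m) = s \<cdot>\<^sub>1 Run D Q"
        by (rule Run_natural) auto
      finally show ?thesis
        by (simp add: assoc1)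
    qed
    from this[OF s(1)] this[OF s(2)] eq show "s = s'"
      by metis
  qed
qed

end


section \<open>Products in a Cartesian double category\<close>

text \<open>The part of the Cartesian structure that is used: every axiom is stable under \<open>hop\<close> and
  under exchanging the two factors.\<close>

locale cart_dbl = dbl D for D :: "('o, 'v, 'h, 'c) dblcat" (structure) +
  fixes prod0 :: "'o \<Rightarrow> 'o \<Rightarrow> 'o"  (infixr "\<otimes>\<^sub>0" 75)
    and fst0 snd0 :: "'o \<Rightarrow> 'o \<Rightarrow> 'v"
    and prod1 :: "'h \<Rightarrow> 'h \<Rightarrow> 'h"  (infixr "\<otimes>\<^sub>1" 75)
    and fst1 snd1 :: "'h \<Rightarrow> 'h \<Rightarrow> 'c"
    and one0 :: 'o and one1 :: 'h
  assumes prod0_Ob: "\<lbrakk>A \<in> Ob (VCat D); B \<in> Ob (VCat D)\<rbrakk> \<Longrightarrow> A \<otimes>\<^sub>0 B \<in> Ob (VCat D)"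
    and fst0_hom: "\<lbrakk>A \<in> Ob (VCat D); B \<in> Ob (VCat D)\<rbrakk> \<Longrightarrow> fst0 A B \<in> hom (VCat D) (A \<otimes>\<^sub>0 B) A"
    and snd0_hom: "\<lbrakk>A \<in> Ob (VCat D); B \<in> Ob (VCat D)\<rbrakk> \<Longrightarrow> snd0 A B \<in> hom (VCat D) (A \<otimes>\<^sub>0 B) B"
    and pair0_exists: "\<lbrakk>f \<in> hom (VCat D) C A; g \<in> hom (VCat D) C B\<rbrakk>
      \<Longrightarrow> \<exists>k \<in> hom (VCat D) C (A \<otimes>\<^sub>0 B). fst0 A B \<cdot>\<^sub>0 k = f \<and> snd0 A B \<cdot>\<^sub>0 k = g"
    and pair0_unique: "\<lbrakk>A \<in> Ob (VCat D); B \<in> Ob (VCat D); k \<in> hom (VCat D) C (A \<otimes>\<^sub>0 B);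
        k' \<in> hom (VCat D) C (A \<otimes>\<^sub>0 B); fst0 A B \<cdot>\<^sub>0 k = fst0 A B \<cdot>\<^sub>0 k';
        snd0 A B \<cdot>\<^sub>0 k = snd0 A B \<cdot>\<^sub>0 k'\<rbrakk> \<Longrightarrow> k = k'"
    and prod1_Ob: "\<lbrakk>M \<in> Ob (HCat D); N \<in> Ob (HCat D)\<rbrakk> \<Longrightarrow> M \<otimes>\<^sub>1 N \<in> Ob (HCat D)
      \<and> hsrc D (M \<otimes>\<^sub>1 N) = hsrc D M \<otimes>\<^sub>0 hsrc D N \<and> htgt D (M \<otimes>\<^sub>1 N) = htgt D M \<otimes>\<^sub>0 htgt D N"
    and fst1_cell: "\<lbrakk>M \<in> Ob (HCat D); N \<in> Ob (HCat D)\<rbrakk> \<Longrightarrow> fst1 M N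
      \<in> cells D (fst0 (hsrc D M) (hsrc D N)) (fst0 (htgt D M) (htgt D N)) (M \<otimes>\<^sub>1 N) M"
    and snd1_cell: "\<lbrakk>M \<in> Ob (HCat D); N \<in> Ob (HCat D)\<rbrakk> \<Longrightarrow> snd1 M N
      \<in> cells D (snd0 (hsrc D M) (hsrc D N)) (snd0 (htgt D M) (htgt D N)) (M \<otimes>\<^sub>1 N) N"
    and pair1_exists: "\<lbrakk>\<alpha> \<in> hom (HCat D) Q M; \<beta> \<in> hom (HCat D) Q N\<rbrakk>
      \<Longrightarrow> \<exists>\<gamma> \<in> hom (HCat D) Q (M \<otimes>\<^sub>1 N). fst1 M N \<cdot>\<^sub>1 \<gamma> = \<alpha> \<and> snd1 M N \<cdot>\<^sub>1 \<gamma> = \<beta>"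
    and pair1_unique: "\<lbrakk>M \<in> Ob (HCat D); N \<in> Ob (HCat D); \<gamma> \<in> hom (HCat D) Q (M \<otimes>\<^sub>1 N);
        \<gamma>' \<in> hom (HCat D) Q (M \<otimes>\<^sub>1 N); fst1 M N \<cdot>\<^sub>1 \<gamma> = fst1 M N \<cdot>\<^sub>1 \<gamma>';
        snd1 M N \<cdot>\<^sub>1 \<gamma> = snd1 M N \<cdot>\<^sub>1 \<gamma>'\<rbrakk> \<Longrightarrow> \<gamma> = \<gamma>'"
    and prod1_hcomp: "\<lbrakk>M \<in> Ob (HCat D); N \<in> Ob (HCat D); hsrc D M = htgt D N;
        M' \<in> Ob (HCat D); N' \<in> Ob (HCat D); hsrc D M' = htgt D N'\<rbrakk>
      \<Longrightarrow> \<exists>\<mu> \<in> globular D ((M \<otimes>\<^sub>1 M') \<odot> (N \<otimes>\<^sub>1 N')) ((M \<odot> N) \<otimes>\<^sub>1 (M' \<odot> N')). invertible (HCat D) \<mu>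
        \<and> fst1 (M \<odot> N) (M' \<odot> N') \<cdot>\<^sub>1 \<mu> = fst1 M M' \<star> fst1 N N'
        \<and> snd1 (M \<odot> N) (M' \<odot> N') \<cdot>\<^sub>1 \<mu> = snd1 M M' \<star> snd1 N N'"
    and prod1_hunit: "\<lbrakk>A \<in> Ob (VCat D); B \<in> Ob (VCat D)\<rbrakk>
      \<Longrightarrow> \<exists>\<upsilon> \<in> globular D (hunit D (A \<otimes>\<^sub>0 B)) (hunit D A \<otimes>\<^sub>1 hunit D B). invertible (HCat D) \<upsilon>
        \<and> fst1 (hunit D A) (hunit D B) \<cdot>\<^sub>1 \<upsilon> = cunit D (fst0 A B)
        \<and> snd1 (hunit D A) (hunit D B) \<cdot>\<^sub>1 \<upsilon> = cunit D (snd0 A B)"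
    and one_Ob: "one0 \<in> Ob (VCat D)" "one1 \<in> Ob (HCat D)" "hsrc D one1 = one0" "htgt D one1 = one0"
    and one0_exists: "A \<in> Ob (VCat D) \<Longrightarrow> \<exists>f. f \<in> hom (VCat D) A one0"
    and one0_unique: "\<lbrakk>f \<in> hom (VCat D) A one0; g \<in> hom (VCat D) A one0\<rbrakk> \<Longrightarrow> f = g"
    and one1_exists: "M \<in> Ob (HCat D) \<Longrightarrow> \<exists>\<alpha>. \<alpha> \<in> hom (HCat D) M one1"
    and one1_unique: "\<lbrakk>\<alpha> \<in> hom (HCat D) M one1; \<beta> \<in> hom (HCat D) M one1\<rbrakk> \<Longrightarrow> \<alpha> = \<beta>"
begin

lemma cart_dbl_swap:
  "cart_dbl D (\<lambda>A B. B \<otimes>\<^sub>0 A) (\<lambda>A B. snd0 B A) (\<lambda>A B. fst0 B A)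
     (\<lambda>M N. N \<otimes>\<^sub>1 M) (\<lambda>M N. snd1 N M) (\<lambda>M N. fst1 N M) one0 one1"
proof unfold_locales
  show "\<exists>k \<in> hom (VCat D) C (B \<otimes>\<^sub>0 A). snd0 B A \<cdot>\<^sub>0 k = f \<and> fst0 B A \<cdot>\<^sub>0 k = g"
    if "f \<in> hom (VCat D) C A" "g \<in> hom (VCat D) C B" for f g A B C
    using pair0_exists[OF that(2,1)] by blast
  show "\<exists>\<gamma> \<in> hom (HCat D) Q (N \<otimes>\<^sub>1 M). snd1 N M \<cdot>\<^sub>1 \<gamma> = \<alpha> \<and> fst1 N M \<cdot>\<^sub>1 \<gamma> = \<beta>"
    if "\<alpha> \<in> hom (HCat D) Q M" "\<beta> \<in> hom (HCat D) Q N" for \<alpha> \<beta> Q M N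
    using pair1_exists[OF that(2,1)] by blast
  show "\<exists>\<mu> \<in> globular D ((M' \<otimes>\<^sub>1 M) \<odot> (N' \<otimes>\<^sub>1 N)) ((M' \<odot> N') \<otimes>\<^sub>1 (M \<odot> N)). invertible (HCat D) \<mu>
        \<and> snd1 (M' \<odot> N') (M \<odot> N) \<cdot>\<^sub>1 \<mu> = snd1 M' M \<star> snd1 N' N
        \<and> fst1 (M' \<odot> N') (M \<odot> N) \<cdot>\<^sub>1 \<mu> = fst1 M' M \<star> fst1 N' N"
    if "M \<in> Ob (HCat D)" "N \<in> Ob (HCat D)" "hsrc D M = htgt D N"
       "M' \<in> Ob (HCat D)" "N' \<in> Ob (HCat D)" "hsrc D M' = htgt D N'" for M N M' N'
    using prod1_hcomp[OF that(4-6) that(1-3)] by blast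
  show "\<exists>\<upsilon> \<in> globular D (hunit D (B \<otimes>\<^sub>0 A)) (hunit D B \<otimes>\<^sub>1 hunit D A). invertible (HCat D) \<upsilon>
        \<and> snd1 (hunit D B) (hunit D A) \<cdot>\<^sub>1 \<upsilon> = cunit D (snd0 B A)
        \<and> fst1 (hunit D B) (hunit D A) \<cdot>\<^sub>1 \<upsilon> = cunit D (fst0 B A)"
    if "A \<in> Ob (VCat D)" "B \<in> Ob (VCat D)" for A B
    using prod1_hunit[OF that(2,1)] by blast
qed (fact prod0_Ob fst0_hom snd0_hom fst1_cell snd1_cell one_Ob one0_exists one0_unique one1_exists
      one1_unique | auto simp: prod0_Ob fst0_hom snd0_hom prod1_Ob intro: fst1_cell snd1_cell pair0_unique pair1_unique)+

lemma cart_dbl_hop: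
  "cart_dbl (hop D) prod0 fst0 snd0 prod1 fst1 snd1 one0 one1"
proof (intro cart_dbl.intro dbl_hop cart_dbl_axioms.intro, simp_all only: hop_simps globular_hop cells_hop)
  show "\<exists>\<mu> \<in> globular D ((N \<otimes>\<^sub>1 N') \<odot> (M \<otimes>\<^sub>1 M')) ((N \<odot> M) \<otimes>\<^sub>1 (N' \<odot> M')). invertible (HCat D) \<mu>
        \<and> fst1 (N \<odot> M) (N' \<odot> M') \<cdot>\<^sub>1 \<mu> = fst1 N N' \<star> fst1 M M'
        \<and> snd1 (N \<odot> M) (N' \<odot> M') \<cdot>\<^sub>1 \<mu> = snd1 N N' \<star> snd1 M M'"
    if "M \<in> Ob (HCat D)" "N \<in> Ob (HCat D)" "htgt D M = hsrc D N"
       "M' \<in> Ob (HCat D)" "N' \<in> Ob (HCat D)" "htgt D M' = hsrc D N'" for M N M' N'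
    using prod1_hcomp[of N M N' M'] that by simp
qed (fact prod0_Ob fst0_hom snd0_hom fst1_cell snd1_cell pair0_exists pair1_exists prod1_hunit one_Ob
      one0_exists one0_unique one1_exists one1_unique pair0_unique pair1_unique | auto simp: prod1_Ob)+

lemma prod0_simps [simp]:
  assumes "A \<in> Ob (VCat D)" "B \<in> Ob (VCat D)"
  shows "A \<otimes>\<^sub>0 B \<in> Ob (VCat D)"
    "fst0 A B \<in> Ar (VCat D)" "Dom (VCat D) (fst0 A B) = A \<otimes>\<^sub>0 B" "Cod (VCat D) (fst0 A B) = A"
    "snd0 A B \<in> Ar (VCat D)" "Dom (VCat D) (snd0 A B) = A \<otimes>\<^sub>0 B" "Cod (VCat D) (snd0 A B) = B"
  using prod0_Ob[OF assms] homD[OF fst0_hom[OF assms]] homD[OF snd0_hom[OF assms]] by auto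

lemma prod1_simps [simp]:
  assumes "M \<in> Ob (HCat D)" "N \<in> Ob (HCat D)"
  shows "M \<otimes>\<^sub>1 N \<in> Ob (HCat D)" "hsrc D (M \<otimes>\<^sub>1 N) = hsrc D M \<otimes>\<^sub>0 hsrc D N"
    "htgt D (M \<otimes>\<^sub>1 N) = htgt D M \<otimes>\<^sub>0 htgt D N"
    "fst1 M N \<in> Ar (HCat D)" "Dom (HCat D) (fst1 M N) = M \<otimes>\<^sub>1 N" "Cod (HCat D) (fst1 M N) = M"
    "csrc D (fst1 M N) = fst0 (hsrc D M) (hsrc D N)" "ctgt D (fst1 M N) = fst0 (htgt D M) (htgt D N)"
    "snd1 M N \<in> Ar (HCat D)" "Dom (HCat D) (snd1 M N) = M \<otimes>\<^sub>1 N" "Cod (HCat D) (snd1 M N) = N"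
    "csrc D (snd1 M N) = snd0 (hsrc D M) (hsrc D N)" "ctgt D (snd1 M N) = snd0 (htgt D M) (htgt D N)"
  using prod1_Ob[OF assms] cellsD(1-5)[OF fst1_cell[OF assms]] cellsD(1-5)[OF snd1_cell[OF assms]]
  by auto

lemma pair0:
  assumes "f \<in> Ar (VCat D)" "g \<in> Ar (VCat D)" "Dom (VCat D) f = C" "Dom (VCat D) g = C"
    "Cod (VCat D) f = A" "Cod (VCat D) g = B"
  obtains k where "k \<in> Ar (VCat D)" "Dom (VCat D) k = C" "Cod (VCat D) k = A \<otimes>\<^sub>0 B"
    "fst0 A B \<cdot>\<^sub>0 k = f" "snd0 A B \<cdot>\<^sub>0 k = g"
  using pair0_exists[of f C A g B] assms by (auto simp: hom_def)

lemma pair0_eqI: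
  assumes "A \<in> Ob (VCat D)" "B \<in> Ob (VCat D)" "k \<in> Ar (VCat D)" "k' \<in> Ar (VCat D)"
    "Dom (VCat D) k = C" "Dom (VCat D) k' = C"
    "Cod (VCat D) k = A \<otimes>\<^sub>0 B" "Cod (VCat D) k' = A \<otimes>\<^sub>0 B"
    "fst0 A B \<cdot>\<^sub>0 k = fst0 A B \<cdot>\<^sub>0 k'" "snd0 A B \<cdot>\<^sub>0 k = snd0 A B \<cdot>\<^sub>0 k'"
  shows "k = k'"
  by (rule pair0_unique[of A B _ C]) (use assms in \<open>auto simp: hom_def\<close>)

lemma pair1_eqI:
  assumes "M \<in> Ob (HCat D)" "N \<in> Ob (HCat D)" "\<gamma> \<in> Ar (HCat D)" "\<gamma>' \<in> Ar (HCat D)"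
    "Dom (HCat D) \<gamma> = Q" "Dom (HCat D) \<gamma>' = Q"
    "Cod (HCat D) \<gamma> = M \<otimes>\<^sub>1 N" "Cod (HCat D) \<gamma>' = M \<otimes>\<^sub>1 N"
    "fst1 M N \<cdot>\<^sub>1 \<gamma> = fst1 M N \<cdot>\<^sub>1 \<gamma>'" "snd1 M N \<cdot>\<^sub>1 \<gamma> = snd1 M N \<cdot>\<^sub>1 \<gamma>'"
  shows "\<gamma> = \<gamma>'"
  by (rule pair1_unique[of M N _ Q]) (use assms in \<open>auto simp: hom_def\<close>)

text \<open>The universal property of the product of horizontal arrows does not mention sides. They
  are found by applying the source and target functors to the projection equations and using
  uniqueness of vertical pairs.\<close>

lemma pair1:
  assumes \<alpha>: "\<alpha> \<in> cells D f g Q M" and \<beta>: "\<beta> \<in> cells D f' g' Q N"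
    and h: "h \<in> Ar (VCat D)" "Dom (VCat D) h = hsrc D Q" "Cod (VCat D) h = hsrc D M \<otimes>\<^sub>0 hsrc D N"
    and k: "k \<in> Ar (VCat D)" "Dom (VCat D) k = htgt D Q" "Cod (VCat D) k = htgt D M \<otimes>\<^sub>0 htgt D N"
    and fh: "fst0 (hsrc D M) (hsrc D N) \<cdot>\<^sub>0 h = f" "snd0 (hsrc D M) (hsrc D N) \<cdot>\<^sub>0 h = f'"
    and gk: "fst0 (htgt D M) (htgt D N) \<cdot>\<^sub>0 k = g" "snd0 (htgt D M) (htgt D N) \<cdot>\<^sub>0 k = g'"
  obtains \<gamma> where "\<gamma> \<in> cells D h k Q (M \<otimes>\<^sub>1 N)" "fst1 M N \<cdot>\<^sub>1 \<gamma> = \<alpha>" "snd1 M N \<cdot>\<^sub>1 \<gamma> = \<beta>"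
proof -
  note a = cellsD[OF \<alpha>] and b = cellsD[OF \<beta>]
  obtain \<gamma> where g: "\<gamma> \<in> hom (HCat D) Q (M \<otimes>\<^sub>1 N)" "fst1 M N \<cdot>\<^sub>1 \<gamma> = \<alpha>" "snd1 M N \<cdot>\<^sub>1 \<gamma> = \<beta>"
    using pair1_exists[of \<alpha> Q M \<beta> N] a b by (auto simp: hom_def)
  note g' = homD[OF g(1)]
  have o: "M \<in> Ob (HCat D)" "N \<in> Ob (HCat D)" "Q \<in> Ob (HCat D)"
    using a b by auto
  have "csrc D \<gamma> = h"
    by (rule pair0_eqI[of "hsrc D M" "hsrc D N" _ _ "hsrc D Q"])
      (use o g' h fh a(4) b(4) arg_cong[OF g(2), of "csrc D"] arg_cong[OF g(3), of "csrc D"] in auto)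
  moreover have "ctgt D \<gamma> = k"
    by (rule pair0_eqI[of "htgt D M" "htgt D N" _ _ "htgt D Q"])
      (use o g' k gk a(5) b(5) arg_cong[OF g(2), of "ctgt D"] arg_cong[OF g(3), of "ctgt D"] in auto)
  ultimately show ?thesis
    using g g' by (intro that[of \<gamma>]) (auto simp: cells_iff)
qed

text \<open>Restricting the terminal horizontal arrow gives a local terminal object.\<close>

lemma codiscrete_exists:
  assumes fib: "fibrant D" and A: "A \<in> Ob (VCat D)"
  obtains E where "E \<in> Ob (HCat D)" "hsrc D E = A" "htgt D E = one0"
    "\<And>Q m n. \<lbrakk>Q \<in> Ob (HCat D); m \<in> hom (VCat D) (hsrc D Q) A; n \<in> hom (VCat D) (htgt D Q) one0\<rbrakk>
      \<Longrightarrow> \<exists>x. x \<in> cells D m n Q E"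
    "\<And>Q m n x y. \<lbrakk>x \<in> cells D m n Q E; y \<in> cells D m n Q E\<rbrakk> \<Longrightarrow> x = y"
proof -
  note [simp] = one_Ob A
  obtain a where a: "a \<in> hom (VCat D) A one0"
    using one0_exists[OF A] ..
  note [simp] = homD[OF a]
  \<comment> \<open>Only the source side is restricted, along the map from \<open>A\<close> to the
    terminal object. In profunctor terms \<open>E\<close> is constant at a one-element set.\<close>
  obtain E e where e: "e \<in> cells D a (idv one0) E one1" and c: "cartesian_cell D e"
    using fib unfolding fibrant_def
    by (metis S.B.ide_simps homD(1,3) a one_Ob)
  note e' = cellsD[OF e]
  have E: "E \<in> Ob (HCat D)" "hsrc D E = A" "htgt D E = one0"
    using e' by auto
  show ?thesis
  proof (rule that[OF E])
    fix Q m n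
    assume Q: "Q \<in> Ob (HCat D)" and m: "m \<in> hom (VCat D) (hsrc D Q) A"
      and n: "n \<in> hom (VCat D) (htgt D Q) one0"
    obtain t where t: "t \<in> hom (HCat D) Q one1"
      using one1_exists[OF Q] ..
    note [simp] = homD[OF t] homD[OF m] homD[OF n]
    \<comment> \<open>Both sides end in a terminal object, so they have the required form whatever
      \<open>m\<close> and \<open>n\<close> are.\<close>
    have "csrc D t = a \<cdot>\<^sub>0 m" "ctgt D t = idv one0 \<cdot>\<^sub>0 n"
      by (rule one0_unique; simp add: hom_def)+
    then have t': "t \<in> cells D (a \<cdot>\<^sub>0 m) (idv one0 \<cdot>\<^sub>0 n) Q one1"
      by (simp add: cells_iff)
    show "\<exists>x. x \<in> cells D m n Q E"
      using cartesian_factor[OF c e t' refl refl] m n E by metis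
  next
    fix Q m n x y
    assume x: "x \<in> cells D m n Q E" and y: "y \<in> cells D m n Q E"
    have "e \<cdot>\<^sub>1 x = e \<cdot>\<^sub>1 y"
      by (rule one1_unique[of _ Q]) (use e' cellsD[OF x] cellsD[OF y] in \<open>auto simp: hom_def\<close>)
    then show "x = y"
      by (rule cartesian_monic[OF c e x y])
  qed
qed

lemma companion_cells_fibrant:
  assumes "fibrant D" "f \<in> Ar (VCat D)"
  obtains K \<epsilon> \<eta> where "companion_cells f K \<epsilon> \<eta>" "cartesian_cell D \<epsilon>"
proof -
  have "\<exists>K. companion D f K"
    using assms unfolding fibrant_def companion_def Let_def
    by (metis S.B.cod_Ob' S.B.ide_simps(1,3) U.FO_Ob hunit_simps(1,2))
  then show ?thesis
    using companion_cells_exist that by metis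
qed

text \<open>The coend formula behind this lemma: with \<open>P = (U\<^sub>A \<times> H)(\<langle>f, 1\<rangle>, 1)\<close>, summing
  \<open>P(b; a, y) = A(f b, a) \<times> H(b, y)\<close> over \<open>a\<close> leaves \<open>H(b, y)\<close>. The inverse picks the identity
  of \<open>f b\<close>; the terminal arrow \<open>E : A \<rightarrow> 1\<close> makes all choices of an element of
  \<open>A(f b, -)\<close> agree.\<close>

lemma opcartesian_snd_restriction:
  assumes fib: "fibrant D" and A: "A \<in> Ob (VCat D)"
    and H: "H \<in> Ob (HCat D)" "hsrc D H = B" "htgt D H = Y"
    and h: "h \<in> hom (VCat D) B (A \<otimes>\<^sub>0 B)" "snd0 A B \<cdot>\<^sub>0 h = idv B"
    and c: "cartesian_cell D c" "c \<in> cells D h (idv (A \<otimes>\<^sub>0 Y)) P (hunit D A \<otimes>\<^sub>1 H)"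
  shows "opcartesian_cell D (snd1 (hunit D A) H \<cdot>\<^sub>1 c)"
proof -
  have BY [simp]: "B \<in> Ob (VCat D)" "Y \<in> Ob (VCat D)"
    using H by auto
  note [simp] = A H one_Ob homD[OF h(1)] h(2) cellsD(1,2,4-6)[OF c(2)]
  let ?U = "hunit D A" and ?V = "hunit D Y" and ?g = "snd0 A Y"
  define M where "M = ?U \<otimes>\<^sub>1 H"
  have M [simp]: "M \<in> Ob (HCat D)" "hsrc D M = A \<otimes>\<^sub>0 B" "htgt D M = A \<otimes>\<^sub>0 Y"
    by (simp_all add: M_def)
  have c' [simp]: "Cod (HCat D) c = M"
    using cellsD(3)[OF c(2)] by (simp add: M_def)
  have P [simp]: "hsrc D P = B" "htgt D P = A \<otimes>\<^sub>0 Y"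
    using cellsD(10,12)[OF c(2)] by auto
  have pr [simp]: "Dom (HCat D) (fst1 ?U H) = M" "Dom (HCat D) (snd1 ?U H) = M"
    by (simp_all add: M_def)
  \<comment> \<open>The projection has target side \<open>?g\<close>, so
    \<open>opcartesian_of_companion_section\<close> asks for a section \<open>s\<close> from
    \<open>H\<close> to \<open>K \<odot> P\<close>.\<close>
  obtain K \<epsilon> \<eta> where K: "companion_cells ?g K \<epsilon> \<eta>" and eps: "cartesian_cell D \<epsilon>"
    by (rule companion_cells_fibrant[OF fib, of ?g]) auto
  have gd: "Dom (VCat D) ?g = A \<otimes>\<^sub>0 Y" "Cod (VCat D) ?g = Y"
    by auto
  note [simp] = companion_cellsD(1-16)[OF K gd]
  have e: "\<epsilon> \<in> cells D ?g (idv Y) K ?V"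
    by (simp add: cells_iff)
  have en: "\<epsilon> \<cdot>\<^sub>1 \<eta> = cunit D ?g"
    using companion_cellsD(17)[OF K gd] .
  \<comment> \<open>\<open>star_cartesian\<close> uses a companion of the restricted side
    \<open>h\<close> to keep \<open>c\<close> Cartesian under whiskering with
    \<open>K\<close>.\<close>
  obtain C \<epsilon>' \<eta>' where C: "companion_cells h C \<epsilon>' \<eta>'"
    by (rule companion_cells_fibrant[OF fib, of h]) auto
  obtain E where E [simp]: "E \<in> Ob (HCat D)" "hsrc D E = A" "htgt D E = one0"
    and E_ex: "\<And>Q m n. \<lbrakk>Q \<in> Ob (HCat D); m \<in> hom (VCat D) (hsrc D Q) A; n \<in> hom (VCat D) (htgt D Q) one0\<rbrakk>
      \<Longrightarrow> \<exists>x. x \<in> cells D m n Q E"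
    and E_un: "\<And>Q m n x y. \<lbrakk>x \<in> cells D m n Q E; y \<in> cells D m n Q E\<rbrakk> \<Longrightarrow> x = y"
    using codiscrete_exists[OF fib A] by metis
  obtain z where z: "z \<in> hom (VCat D) Y one0"
    using one0_exists[of Y] by auto
  note [simp] = homD[OF z]
  \<comment> \<open>The canonical map from \<open>Y\<close> to its product with the terminal object,
    needed because products with \<open>E\<close> have target
    \<open>one0 \<otimes>\<^sub>0 Y\<close> rather than \<open>Y\<close>.\<close>
  obtain zz where zz [simp]: "zz \<in> Ar (VCat D)" "Dom (VCat D) zz = Y" "Cod (VCat D) zz = one0 \<otimes>\<^sub>0 Y"
    "fst0 one0 Y \<cdot>\<^sub>0 zz = z" "snd0 one0 Y \<cdot>\<^sub>0 zz = idv Y"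
    by (rule pair0[of z "idv Y" Y one0 Y]) auto
  \<comment> \<open>In profunctor terms \<open>K((a, y), y') = Y(y, y')\<close>, and multiplying by
    the one-element \<open>E\<close> changes nothing. \<open>j\<close> is this comparison; its
    domain is a product, so \<open>prod1_hcomp\<close> applies where \<open>K\<close> itself would
    not allow it.\<close>
  obtain j where j: "j \<in> cells D (idv (A \<otimes>\<^sub>0 Y)) (snd0 one0 Y) (E \<otimes>\<^sub>1 ?V) K"
    and ej: "\<epsilon> \<cdot>\<^sub>1 j = snd1 E ?V"
    by (rule cartesian_factor[OF eps e, of "snd1 E ?V" ?g "snd0 one0 Y" "E \<otimes>\<^sub>1 ?V"
          "idv (A \<otimes>\<^sub>0 Y)" "snd0 one0 Y"]) (auto simp: cells_iff hom_def)
  note [simp] = cellsD(1-5)[OF j]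
  \<comment> \<open>\<open>h\<close> is the pairing of \<open>f\<close> with the identity of
    \<open>B\<close>.\<close>
  define f where "f = fst0 A B \<cdot>\<^sub>0 h"
  have f [simp]: "f \<in> Ar (VCat D)" "Dom (VCat D) f = B" "Cod (VCat D) f = A"
    by (simp_all add: f_def)
  obtain \<kappa> where k: "\<kappa> \<in> cells D f z H E"
    using E_ex[of H f z] by (auto simp: hom_def)
  note [simp] = cellsD(1-5)[OF k]
  obtain \<mu> where mu: "\<mu> \<in> globular D ((E \<otimes>\<^sub>1 ?V) \<odot> (?U \<otimes>\<^sub>1 H)) ((E \<odot> ?U) \<otimes>\<^sub>1 (?V \<odot> H))"
    and mu_inv [simp]: "invertible (HCat D) \<mu>"
    and mu_fst: "fst1 (E \<odot> ?U) (?V \<odot> H) \<cdot>\<^sub>1 \<mu> = fst1 E ?V \<star> fst1 ?U H"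
    and mu_snd: "snd1 (E \<odot> ?U) (?V \<odot> H) \<cdot>\<^sub>1 \<mu> = snd1 E ?V \<star> snd1 ?U H"
    using prod1_hcomp[of E ?U ?V H] by auto
  have mu' [simp]: "\<mu> \<in> Ar (HCat D)" "Dom (HCat D) \<mu> = (E \<otimes>\<^sub>1 ?V) \<odot> M"
    "Cod (HCat D) \<mu> = (E \<odot> ?U) \<otimes>\<^sub>1 (?V \<odot> H)" "csrc D \<mu> = idv (A \<otimes>\<^sub>0 B)" "ctgt D \<mu> = idv (one0 \<otimes>\<^sub>0 Y)"
    using globularD(1-3,6,7)[OF mu] by (simp_all add: M_def)
  \<comment> \<open>The two components are the locally terminal cell into \<open>E\<close> and the
    identity of \<open>H\<close>, each followed by an inverse unit isomorphism. This is the choice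
    of the identity of \<open>f b\<close> in the coend.\<close>
  obtain \<gamma> where gam: "\<gamma> \<in> cells D h zz H ((E \<odot> ?U) \<otimes>\<^sub>1 (?V \<odot> H))"
    and gam_fst: "fst1 (E \<odot> ?U) (?V \<odot> H) \<cdot>\<^sub>1 \<gamma> = inv1 (Run D E) \<cdot>\<^sub>1 \<kappa>"
    and gam_snd: "snd1 (E \<odot> ?U) (?V \<odot> H) \<cdot>\<^sub>1 \<gamma> = inv1 (Lun D H)"
    by (rule pair1[of "inv1 (Run D E) \<cdot>\<^sub>1 \<kappa>" f z H "E \<odot> ?U" "inv1 (Lun D H)" "idv B" "idv Y" "?V \<odot> H" h zz])
      (auto simp: cells_iff f_def)
  note [simp] = cellsD(1-5)[OF gam]
  define w where "w = inv1 \<mu> \<cdot>\<^sub>1 \<gamma>"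
  have w [simp]: "w \<in> Ar (HCat D)" "Dom (HCat D) w = H" "Cod (HCat D) w = (E \<otimes>\<^sub>1 ?V) \<odot> M"
    "csrc D w = h" "ctgt D w = zz" and mu_w: "\<mu> \<cdot>\<^sub>1 w = \<gamma>"
    by (simp_all add: w_def)
  define v where "v = (j \<star> idc M) \<cdot>\<^sub>1 w"
  have v: "v \<in> cells D h (idv Y) H (K \<odot> M)"
    by (auto simp: cells_iff v_def)
  note [simp] = cellsD(1-5)[OF v]
  define Kc where "Kc = idc K \<star> c"
  have Kc: "cartesian_cell D Kc"
    unfolding Kc_def by (rule star_cartesian[OF c _ _ _ C]) auto
  have Kc': "Kc \<in> cells D h (idv Y) (K \<odot> P) (K \<odot> M)"
    by (auto simp: cells_iff Kc_def)
  \<comment> \<open>The cell \<open>v\<close> into \<open>K \<odot> M\<close> has source side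
    \<open>h\<close>, so it descends along the Cartesian \<open>Kc\<close> to a globular cell into
    \<open>K \<odot> P\<close>.\<close>
  obtain s where s: "s \<in> cells D (idv B) (idv Y) H (K \<odot> P)" and Kcs: "Kc \<cdot>\<^sub>1 s = v"
    by (rule cartesian_factor[OF Kc Kc' v, of "idv B" "idv Y"]) (auto simp: hom_def)
  note [simp] = cellsD(1-5)[OF s] cellsD(1-5)[OF Kc']
  let ?p = "snd1 ?U H \<cdot>\<^sub>1 c"
  have p: "?p \<in> cells D (idv B) ?g P H"
    by (auto simp: cells_iff)
  note [simp] = cellsD(1-5)[OF p]
  obtain t where t: "t \<in> hom (VCat D) (A \<otimes>\<^sub>0 Y) one0"
    using one0_exists[of "A \<otimes>\<^sub>0 Y"] by auto
  note [simp] = homD[OF t]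
  obtain tt where tt [simp]: "tt \<in> Ar (VCat D)" "Dom (VCat D) tt = A \<otimes>\<^sub>0 Y" "Cod (VCat D) tt = one0 \<otimes>\<^sub>0 Y"
    "fst0 one0 Y \<cdot>\<^sub>0 tt = t" "snd0 one0 Y \<cdot>\<^sub>0 tt = ?g"
    by (rule pair0[of t ?g "A \<otimes>\<^sub>0 Y" one0 Y]) auto
  obtain a where a: "a \<in> cells D (fst0 A Y) t (hunit D (A \<otimes>\<^sub>0 Y)) E"
    using E_ex[of "hunit D (A \<otimes>\<^sub>0 Y)" "fst0 A Y" t] by (auto simp: hom_def)
  note [simp] = cellsD(1-5)[OF a]
  \<comment> \<open>A lift of \<open>\<eta>\<close> along \<open>j\<close> (see \<open>jb\<close>),
    since \<open>w\<close> ends in a composite with \<open>E \<otimes>\<^sub>1 ?V\<close> instead of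
    \<open>K\<close>.\<close>
  obtain b where b: "b \<in> cells D (idv (A \<otimes>\<^sub>0 Y)) tt (hunit D (A \<otimes>\<^sub>0 Y)) (E \<otimes>\<^sub>1 ?V)"
    and b_fst: "fst1 E ?V \<cdot>\<^sub>1 b = a" and b_snd: "snd1 E ?V \<cdot>\<^sub>1 b = cunit D ?g"
    by (rule pair1[OF a, of "cunit D ?g" ?g ?g ?V "idv (A \<otimes>\<^sub>0 Y)" tt]) (auto simp: cells_iff)
  note [simp] = cellsD(1-5)[OF b]
  have jb: "j \<cdot>\<^sub>1 b = \<eta>"
  proof (rule cartesian_monic[OF eps e])
    show "\<epsilon> \<cdot>\<^sub>1 (j \<cdot>\<^sub>1 b) = \<epsilon> \<cdot>\<^sub>1 \<eta>"
      using ej b_snd by (simp add: en flip: assoc1)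
  qed (auto simp: cells_iff)
  \<comment> \<open>Condition \<open>s2\<close> lifted along \<open>j\<close>: composing with
    \<open>j \<star> idc M\<close> gives \<open>s2\<close> after \<open>Kc\<close>. Before that
    composition it can be checked on the two components of a product.\<close>
  have wp: "w \<cdot>\<^sub>1 (?p \<cdot>\<^sub>1 Lun D P) = b \<star> c"
  proof (rule S.A.invertible_monic[OF mu_inv])
    show "\<mu> \<cdot>\<^sub>1 (w \<cdot>\<^sub>1 (?p \<cdot>\<^sub>1 Lun D P)) = \<mu> \<cdot>\<^sub>1 (b \<star> c)"
    proof (rule pair1_eqI[of "E \<odot> ?U" "?V \<odot> H" _ _ "hunit D (A \<otimes>\<^sub>0 Y) \<odot> P"])
      let ?l = "inv1 (Run D E) \<cdot>\<^sub>1 \<kappa> \<cdot>\<^sub>1 (?p \<cdot>\<^sub>1 Lun D P)" and ?r = "a \<star> (fst1 ?U H \<cdot>\<^sub>1 c)"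
      have "fst1 (E \<odot> ?U) (?V \<odot> H) \<cdot>\<^sub>1 (\<mu> \<cdot>\<^sub>1 (w \<cdot>\<^sub>1 (?p \<cdot>\<^sub>1 Lun D P)))
          = fst1 (E \<odot> ?U) (?V \<odot> H) \<cdot>\<^sub>1 \<gamma> \<cdot>\<^sub>1 (?p \<cdot>\<^sub>1 Lun D P)"
        by (simp add: assoc1 flip: mu_w)
      also have "\<dots> = ?l"
        by (simp only: gam_fst)
      \<comment> \<open>Once the unit isomorphism is removed, both cells end in \<open>E\<close> and
        have the same sides, so local terminality identifies them. The second component below is
        naturality of \<open>Lun\<close>.\<close>
      also have "?l = ?r"
      proof (rule S.A.invertible_monic[of "Run D E"])
        have "\<kappa> \<cdot>\<^sub>1 (?p \<cdot>\<^sub>1 Lun D P) \<in> cells D f (z \<cdot>\<^sub>0 ?g) (hunit D (A \<otimes>\<^sub>0 Y) \<odot> P) E"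
          by (auto simp: cells_iff)
        moreover have "Run D E \<cdot>\<^sub>1 ?r \<in> cells D f t (hunit D (A \<otimes>\<^sub>0 Y) \<odot> P) E"
          by (auto simp: cells_iff f_def)
        moreover have "z \<cdot>\<^sub>0 ?g = t"
          by (rule one0_unique) (auto simp: hom_def)
        ultimately have "\<kappa> \<cdot>\<^sub>1 (?p \<cdot>\<^sub>1 Lun D P) = Run D E \<cdot>\<^sub>1 ?r"
          using E_un by metis
        then show "Run D E \<cdot>\<^sub>1 ?l = Run D E \<cdot>\<^sub>1 ?r"
          by (simp add: assoc1)
      qed auto
      also have "?r = (fst1 E ?V \<star> fst1 ?U H) \<cdot>\<^sub>1 (b \<star> c)"
        by (simp add: interchange b_fst)
      also have "\<dots> = fst1 (E \<odot> ?U) (?V \<odot> H) \<cdot>\<^sub>1 (\<mu> \<cdot>\<^sub>1 (b \<star> c))"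
        by (simp add: assoc1 flip: mu_fst)
      finally show "fst1 (E \<odot> ?U) (?V \<odot> H) \<cdot>\<^sub>1 (\<mu> \<cdot>\<^sub>1 (w \<cdot>\<^sub>1 (?p \<cdot>\<^sub>1 Lun D P)))
          = fst1 (E \<odot> ?U) (?V \<odot> H) \<cdot>\<^sub>1 (\<mu> \<cdot>\<^sub>1 (b \<star> c))" .
      have "snd1 (E \<odot> ?U) (?V \<odot> H) \<cdot>\<^sub>1 (\<mu> \<cdot>\<^sub>1 (w \<cdot>\<^sub>1 (?p \<cdot>\<^sub>1 Lun D P)))
          = snd1 (E \<odot> ?U) (?V \<odot> H) \<cdot>\<^sub>1 \<gamma> \<cdot>\<^sub>1 (?p \<cdot>\<^sub>1 Lun D P)"
        by (simp add: assoc1 flip: mu_w)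
      also have "\<dots> = inv1 (Lun D H) \<cdot>\<^sub>1 (?p \<cdot>\<^sub>1 Lun D P)"
        by (simp only: gam_snd)
      also have "\<dots> = inv1 (Lun D H) \<cdot>\<^sub>1 (Lun D H \<cdot>\<^sub>1 (cunit D ?g \<star> ?p))"
        by (subst Lun_natural) auto
      also have "\<dots> = cunit D ?g \<star> ?p"
        by simp
      also have "\<dots> = (snd1 E ?V \<star> snd1 ?U H) \<cdot>\<^sub>1 (b \<star> c)"
        by (simp add: interchange b_snd)
      also have "\<dots> = snd1 (E \<odot> ?U) (?V \<odot> H) \<cdot>\<^sub>1 (\<mu> \<cdot>\<^sub>1 (b \<star> c))"
        by (simp add: assoc1 flip: mu_snd)
      finally show "snd1 (E \<odot> ?U) (?V \<odot> H) \<cdot>\<^sub>1 (\<mu> \<cdot>\<^sub>1 (w \<cdot>\<^sub>1 (?p \<cdot>\<^sub>1 Lun D P)))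
          = snd1 (E \<odot> ?U) (?V \<odot> H) \<cdot>\<^sub>1 (\<mu> \<cdot>\<^sub>1 (b \<star> c))" .
    qed auto
  qed auto
  show ?thesis
  proof (rule opcartesian_of_companion_section[OF p _ K])
    show "s \<in> globular D H (K \<odot> P)"
      by (simp add: globular_iff)
    have "Lun D H \<cdot>\<^sub>1 (\<epsilon> \<star> ?p) \<cdot>\<^sub>1 s = Lun D H \<cdot>\<^sub>1 (\<epsilon> \<star> snd1 ?U H) \<cdot>\<^sub>1 (Kc \<cdot>\<^sub>1 s)"
      by (simp add: assoc1 interchange_cmp Kc_def)
    also have "\<dots> = Lun D H \<cdot>\<^sub>1 ((snd1 E ?V \<star> snd1 ?U H) \<cdot>\<^sub>1 w)"
      unfolding Kcs by (simp add: v_def assoc1 interchange_cmp ej)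
    also have "\<dots> = Lun D H \<cdot>\<^sub>1 (snd1 (E \<odot> ?U) (?V \<odot> H) \<cdot>\<^sub>1 \<gamma>)"
      by (simp add: assoc1 flip: mu_snd mu_w)
    also have "\<dots> = idc H"
      by (simp add: gam_snd)
    finally show "Lun D H \<cdot>\<^sub>1 (\<epsilon> \<star> ?p) \<cdot>\<^sub>1 s = idc H" .
    show "s \<cdot>\<^sub>1 (?p \<cdot>\<^sub>1 Lun D P) = \<eta> \<star> idc P"
    proof (rule cartesian_monic[OF Kc Kc'])
      have "Kc \<cdot>\<^sub>1 (s \<cdot>\<^sub>1 (?p \<cdot>\<^sub>1 Lun D P)) = Kc \<cdot>\<^sub>1 s \<cdot>\<^sub>1 (?p \<cdot>\<^sub>1 Lun D P)"
        by (simp add: assoc1)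
      also have "\<dots> = (j \<star> idc M) \<cdot>\<^sub>1 (w \<cdot>\<^sub>1 (?p \<cdot>\<^sub>1 Lun D P))"
        unfolding Kcs by (simp add: v_def assoc1)
      also have "\<dots> = Kc \<cdot>\<^sub>1 (\<eta> \<star> idc P)"
        unfolding wp Kc_def by (simp add: interchange jb)
      finally show "Kc \<cdot>\<^sub>1 (s \<cdot>\<^sub>1 (?p \<cdot>\<^sub>1 Lun D P)) = Kc \<cdot>\<^sub>1 (\<eta> \<star> idc P)" .
    qed (auto simp: cells_iff)
  qed auto
qed

end


section \<open>Tabulators from Eilenberg--Moore objects\<close>

text \<open>The last two clauses say that composition with \<open>\<pi>\<close> is surjective and
  injective from co-pointed maps out of the inclusion of \<open>H\<close> onto cells from the unit
  of \<open>H\<close> to \<open>F\<close>. Thus \<open>P\<close> represents, among co-pointed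
  endomorphisms, the cells that a tabulator of \<open>F\<close> has to represent among
  objects.\<close>

definition tabulating_copointed :: "('o, 'v, 'h, 'c) dblcat \<Rightarrow> 'h \<Rightarrow> 'h \<Rightarrow> 'c \<Rightarrow> 'c \<Rightarrow> bool" where
  "tabulating_copointed D F P \<epsilon> \<pi> \<longleftrightarrow> copointed D P \<epsilon> \<and> \<pi> \<in> hom (HCat D) P F \<and>
     (\<forall>H \<in> Ob (VCat D). \<forall>\<beta> \<in> hom (HCat D) (hunit D H) F.
        \<exists>f \<phi>. copt_map D (hunit D H, Ide (HCat D) (hunit D H)) (P, \<epsilon>) f \<phi> \<and> \<pi> \<cdot>\<^sub>1\<^bsub>D\<^esub> \<phi> = \<beta>) \<and>
     (\<forall>H \<in> Ob (VCat D). \<forall>f \<phi> f' \<phi>'.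
        copt_map D (hunit D H, Ide (HCat D) (hunit D H)) (P, \<epsilon>) f \<phi> \<longrightarrow>
        copt_map D (hunit D H, Ide (HCat D) (hunit D H)) (P, \<epsilon>) f' \<phi>' \<longrightarrow>
        \<pi> \<cdot>\<^sub>1\<^bsub>D\<^esub> \<phi> = \<pi> \<cdot>\<^sub>1\<^bsub>D\<^esub> \<phi>' \<longrightarrow> f = f' \<and> \<phi> = \<phi>')"

text \<open>\<open>P\<close> is the local product of \<open>U\<close> and \<open>p\<^sub>2\<^sup>* \<odot> F \<odot> p\<^sub>1\<^sub>*\<close> on \<open>A \<times> X\<close>, that is,
  \<open>P((a, x), (a', x')) = A(a, a') \<times> F(a, x') \<times> X(x, x')\<close>, obtained by two restrictions along
  diagonals.\<close>

lemma (in cart_dbl) tabulating_copointed_exists: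
  assumes fib: "fibrant D" and F: "F \<in> Ob (HCat D)"
  obtains P \<epsilon> \<pi> where "tabulating_copointed D F P \<epsilon> \<pi>" "opcartesian_cell D \<pi>"
proof -
  define A X W where "A = hsrc D F" and "X = htgt D F" and "W = A \<otimes>\<^sub>0 X"
  have AX [simp]: "A \<in> Ob (VCat D)" "X \<in> Ob (VCat D)" "hsrc D F = A" "htgt D F = X"
    using F by (auto simp: A_def X_def)
  have W [simp]: "W \<in> Ob (VCat D)" and W': "A \<otimes>\<^sub>0 X = W"
    by (auto simp: W_def)
  note [simp] = F
  have pW [simp]: "Dom (VCat D) (fst0 A X) = W" "Dom (VCat D) (snd0 A X) = W"
    by (auto simp: W_def)
  let ?U = "hunit D A" and ?V = "hunit D X"
  define N where "N = F \<otimes>\<^sub>1 ?V"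
  have N [simp]: "N \<in> Ob (HCat D)" "hsrc D N = W" "htgt D N = X \<otimes>\<^sub>0 X"
    "Dom (HCat D) (fst1 F ?V) = N" "Dom (HCat D) (snd1 F ?V) = N"
    by (simp_all add: N_def W_def)
  obtain d where d [simp]: "d \<in> Ar (VCat D)" "Dom (VCat D) d = X" "Cod (VCat D) d = X \<otimes>\<^sub>0 X"
    "fst0 X X \<cdot>\<^sub>0 d = idv X" "snd0 X X \<cdot>\<^sub>0 d = idv X"
    by (rule pair0[of "idv X" "idv X" X X X]) auto
  \<comment> \<open>Restriction of the target along the diagonal: in profunctor terms
    \<open>G((a, x), x') = F(a, x') \<times> X(x, x')\<close>.\<close>
  obtain G g where g: "g \<in> cells D (idv W) d G N" and cg: "cartesian_cell D g"
    using fib[unfolded fibrant_def, rule_format, of "idv W" d N] by auto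
  note [simp] = cellsD(1-6)[OF g]
  have G [simp]: "hsrc D G = W" "htgt D G = X"
    using cellsD(10,12)[OF g] by auto
  define \<rho> where "\<rho> = fst1 F ?V \<cdot>\<^sub>1 g"
  have rho: "\<rho> \<in> cells D (fst0 A X) (idv X) G F"
    by (auto simp: cells_iff \<rho>_def)
  note [simp] = cellsD(1-5)[OF rho]
  have rho_op: "opcartesian_cell D \<rho>"
  proof -
    \<comment> \<open>Here the target is restricted and the projection is the first one. Reversing
      the horizontal arrows and exchanging the factors turns this into the case of
      \<open>opcartesian_snd_restriction\<close>.\<close>
    interpret op: cart_dbl "hop D" prod0 fst0 snd0 prod1 fst1 snd1 one0 one1
      by (rule cart_dbl_hop)
    interpret sw: cart_dbl "hop D" "\<lambda>A B. B \<otimes>\<^sub>0 A" "\<lambda>A B. snd0 B A" "\<lambda>A B. fst0 B A"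
       "\<lambda>M N. N \<otimes>\<^sub>1 M" "\<lambda>M N. snd1 N M" "\<lambda>M N. fst1 N M" one0 one1
      by (rule op.cart_dbl_swap)
    show ?thesis
      using sw.opcartesian_snd_restriction[of X F X A d g G] fib fibrant_hop cg g
      by (auto simp: hom_def N_def W_def \<rho>_def)
  qed
  define M where "M = ?U \<otimes>\<^sub>1 G"
  have M [simp]: "M \<in> Ob (HCat D)" "hsrc D M = A \<otimes>\<^sub>0 W" "htgt D M = W"
    "Dom (HCat D) (fst1 ?U G) = M" "Dom (HCat D) (snd1 ?U G) = M"
    by (simp_all add: M_def W_def)
  obtain h where h [simp]: "h \<in> Ar (VCat D)" "Dom (VCat D) h = W" "Cod (VCat D) h = A \<otimes>\<^sub>0 W"
    "fst0 A W \<cdot>\<^sub>0 h = fst0 A X" "snd0 A W \<cdot>\<^sub>0 h = idv W"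
    by (rule pair0[of "fst0 A X" "idv W" W A W]) auto
  \<comment> \<open>Restriction of the source along \<open>h\<close>, the first projection paired
    with the identity; it contributes the factor \<open>A(a, a')\<close>.\<close>
  obtain P c where c: "c \<in> cells D h (idv W) P M" and cc: "cartesian_cell D c"
    using fib[unfolded fibrant_def, rule_format, of h "idv W" M] by auto
  note [simp] = cellsD(1-6)[OF c]
  have P [simp]: "hsrc D P = W" "htgt D P = W"
    using cellsD(10,12)[OF c] by auto
  define \<tau> where "\<tau> = snd1 ?U G \<cdot>\<^sub>1 c"
  have tau: "\<tau> \<in> cells D (idv W) (snd0 A X) P G"
    by (auto simp: cells_iff \<tau>_def)
  note [simp] = cellsD(1-5)[OF tau]
  have tau_op: "opcartesian_cell D \<tau>"
    unfolding \<tau>_def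
    by (rule opcartesian_snd_restriction[OF fib, of A G W X h c P]) (use c cc in \<open>auto simp: hom_def W' M_def\<close>)
  define \<pi> where "\<pi> = \<rho> \<cdot>\<^sub>1 \<tau>"
  have pi: "\<pi> \<in> cells D (fst0 A X) (snd0 A X) P F"
    by (auto simp: cells_iff \<pi>_def)
  have pi_op: "opcartesian_cell D \<pi>"
    unfolding \<pi>_def by (rule opcartesian_cmp[OF tau_op tau rho_op rho])
  \<comment> \<open>\<open>P\<close> has three components: \<open>\<pi>\<close> into
    \<open>F\<close>, and \<open>e1\<close>, \<open>e2\<close> into the unit arrows of
    \<open>A\<close> and \<open>X\<close>. The last two are paired and carried through
    \<open>\<upsilon>\<close> into the unit of \<open>W\<close>, which gives the
    co-pointing.\<close>
  define e1 where "e1 = fst1 ?U G \<cdot>\<^sub>1 c"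
  define e2 where "e2 = snd1 F ?V \<cdot>\<^sub>1 (g \<cdot>\<^sub>1 \<tau>)"
  have e1: "e1 \<in> cells D (fst0 A X) (fst0 A X) P ?U"
    by (auto simp: cells_iff e1_def)
  have e2: "e2 \<in> cells D (snd0 A X) (snd0 A X) P ?V"
    by (auto simp: cells_iff e2_def simp flip: assoc0)
  note [simp] = cellsD(1-5)[OF pi] cellsD(1-5)[OF e1] cellsD(1-5)[OF e2]
  obtain \<upsilon> where u: "\<upsilon> \<in> globular D (hunit D W) (?U \<otimes>\<^sub>1 ?V)" and u_inv [simp]: "invertible (HCat D) \<upsilon>"
    and u_fst: "fst1 ?U ?V \<cdot>\<^sub>1 \<upsilon> = cunit D (fst0 A X)" and u_snd: "snd1 ?U ?V \<cdot>\<^sub>1 \<upsilon> = cunit D (snd0 A X)"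
    using prod1_hunit[of A X] by (auto simp: W')
  note [simp] = globularD(1-3)[OF u] globularD(6,7)[OF u, simplified]
  obtain e where e: "e \<in> cells D (idv W) (idv W) P (?U \<otimes>\<^sub>1 ?V)"
    and e_fst: "fst1 ?U ?V \<cdot>\<^sub>1 e = e1" and e_snd: "snd1 ?U ?V \<cdot>\<^sub>1 e = e2"
    by (rule pair1[OF e1 e2, of "idv W" "idv W"]) (auto simp: W_def)
  note [simp] = cellsD(1-5)[OF e]
  define \<epsilon> where "\<epsilon> = inv1 \<upsilon> \<cdot>\<^sub>1 e"
  have eps: "\<epsilon> \<in> globular D P (hunit D W)"
    by (auto simp: globular_iff \<epsilon>_def)
  note [simp] = globularD(1-3)[OF eps] globularD(6,7)[OF eps, simplified]
  have eps_fst: "cunit D (fst0 A X) \<cdot>\<^sub>1 \<epsilon> = e1" and eps_snd: "cunit D (snd0 A X) \<cdot>\<^sub>1 \<epsilon> = e2"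
    by (simp_all add: \<epsilon>_def assoc1 e_fst e_snd flip: u_fst u_snd)
  have cop: "copointed D P \<epsilon>"
    using eps by (simp add: copointed_def)
  have copt_mapD: "f \<in> Ar (VCat D)" "Dom (VCat D) f = H" "Cod (VCat D) f = W" "\<phi> \<in> Ar (HCat D)"
      "Dom (HCat D) \<phi> = hunit D H" "Cod (HCat D) \<phi> = P" "csrc D \<phi> = f" "ctgt D \<phi> = f" "\<epsilon> \<cdot>\<^sub>1 \<phi> = cunit D f"
    if "copt_map D (hunit D H, idc (hunit D H)) (P, \<epsilon>) f \<phi>" "H \<in> Ob (VCat D)" for H f \<phi>
    using that by (auto simp: copt_map_def hom_def cells_iff)
  have ex: "\<exists>f \<phi>. copt_map D (hunit D H, idc (hunit D H)) (P, \<epsilon>) f \<phi> \<and> \<pi> \<cdot>\<^sub>1 \<phi> = \<beta>"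
    if H: "H \<in> Ob (VCat D)" and b: "\<beta> \<in> hom (HCat D) (hunit D H) F" for H \<beta>
  proof -
    note [simp] = H homD[OF b]
    obtain m where m [simp]: "m \<in> Ar (VCat D)" "Dom (VCat D) m = H" "Cod (VCat D) m = W"
      and m_fst: "fst0 A X \<cdot>\<^sub>0 m = csrc D \<beta>" and m_snd: "snd0 A X \<cdot>\<^sub>0 m = ctgt D \<beta>"
      by (rule pair0[of "csrc D \<beta>" "ctgt D \<beta>" H A X]) (auto simp: W_def)
    have b': "\<beta> \<in> cells D (fst0 A X \<cdot>\<^sub>0 m) (snd0 A X \<cdot>\<^sub>0 m) (hunit D H) F"
      by (simp add: cells_iff m_fst m_snd)
    have cm: "cunit D (k \<cdot>\<^sub>0 m) \<in> cells D (k \<cdot>\<^sub>0 m) (k \<cdot>\<^sub>0 m) (hunit D H) (hunit D B)"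
      if "k \<in> Ar (VCat D)" "Dom (VCat D) k = W" "Cod (VCat D) k = B" for k B
      using that by (auto simp: cells_iff)
    \<comment> \<open>A co-pointed map over \<open>m\<close> must satisfy
      \<open>\<epsilon> \<cdot>\<^sub>1 \<phi> = cunit D m\<close>. This forces the components of
      \<open>\<phi>\<close> in the unit arrows to be the unit cells of the two components of
      \<open>m\<close>; only the component in \<open>F\<close> is free, and it is
      \<open>\<beta>\<close>.\<close>
    obtain \<gamma> where \<gamma>: "\<gamma> \<in> cells D m (d \<cdot>\<^sub>0 (snd0 A X \<cdot>\<^sub>0 m)) (hunit D H) N"
      and \<gamma>_fst: "fst1 F ?V \<cdot>\<^sub>1 \<gamma> = \<beta>" and \<gamma>_snd: "snd1 F ?V \<cdot>\<^sub>1 \<gamma> = cunit D (snd0 A X \<cdot>\<^sub>0 m)"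
      by (rule pair1[OF b' cm[of "snd0 A X" X], of m "d \<cdot>\<^sub>0 (snd0 A X \<cdot>\<^sub>0 m)"])
        (auto simp: N_def W_def simp flip: assoc0)
    obtain \<delta> where \<delta>: "\<delta> \<in> cells D m (snd0 A X \<cdot>\<^sub>0 m) (hunit D H) G" and g\<delta>: "g \<cdot>\<^sub>1 \<delta> = \<gamma>"
      by (rule cartesian_factor[OF cg g \<gamma>, of m "snd0 A X \<cdot>\<^sub>0 m"]) (auto simp: hom_def)
    obtain \<zeta> where \<zeta>: "\<zeta> \<in> cells D (h \<cdot>\<^sub>0 m) m (hunit D H) M"
      and \<zeta>_fst: "fst1 ?U G \<cdot>\<^sub>1 \<zeta> = cunit D (fst0 A X \<cdot>\<^sub>0 m)" and \<zeta>_snd: "snd1 ?U G \<cdot>\<^sub>1 \<zeta> = \<delta>"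
      by (rule pair1[OF cm[of "fst0 A X" A] \<delta>, of "h \<cdot>\<^sub>0 m" m])
        (auto simp: M_def W' simp flip: assoc0)
    obtain \<phi> where \<phi>: "\<phi> \<in> cells D m m (hunit D H) P" and c\<phi>: "c \<cdot>\<^sub>1 \<phi> = \<zeta>"
      by (rule cartesian_factor[OF cc c \<zeta>, of m m]) (auto simp: hom_def)
    note [simp] = cellsD(1-5)[OF \<phi>]
    have \<tau>\<phi>: "\<tau> \<cdot>\<^sub>1 \<phi> = \<delta>"
      by (simp add: \<tau>_def assoc1 c\<phi> \<zeta>_snd)
    have \<pi>\<phi>: "\<pi> \<cdot>\<^sub>1 \<phi> = \<beta>"
      using cellsD(1-5)[OF \<delta>] by (simp add: \<pi>_def \<rho>_def assoc1 \<tau>\<phi> g\<delta> \<gamma>_fst)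
    have e1\<phi>: "e1 \<cdot>\<^sub>1 \<phi> = cunit D (fst0 A X \<cdot>\<^sub>0 m)"
      by (simp add: e1_def assoc1 c\<phi> \<zeta>_fst)
    have e2\<phi>: "e2 \<cdot>\<^sub>1 \<phi> = cunit D (snd0 A X \<cdot>\<^sub>0 m)"
      using cellsD(1-5)[OF \<delta>] by (simp add: e2_def assoc1 \<tau>\<phi> g\<delta> \<gamma>_snd)
    have "\<upsilon> \<cdot>\<^sub>1 (\<epsilon> \<cdot>\<^sub>1 \<phi>) = \<upsilon> \<cdot>\<^sub>1 cunit D m"
    proof (rule pair1_eqI[of ?U ?V _ _ "hunit D H"])
      have "fst1 ?U ?V \<cdot>\<^sub>1 (\<upsilon> \<cdot>\<^sub>1 (\<epsilon> \<cdot>\<^sub>1 \<phi>)) = fst1 ?U ?V \<cdot>\<^sub>1 \<upsilon> \<cdot>\<^sub>1 \<epsilon> \<cdot>\<^sub>1 \<phi>"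
        by (simp add: assoc1)
      also have "\<dots> = fst1 ?U ?V \<cdot>\<^sub>1 \<upsilon> \<cdot>\<^sub>1 cunit D m"
        unfolding u_fst eps_fst e1\<phi> by (simp add: U.FA_cmp)
      finally show "fst1 ?U ?V \<cdot>\<^sub>1 (\<upsilon> \<cdot>\<^sub>1 (\<epsilon> \<cdot>\<^sub>1 \<phi>)) = fst1 ?U ?V \<cdot>\<^sub>1 (\<upsilon> \<cdot>\<^sub>1 cunit D m)"
        by (simp add: assoc1)
      have "snd1 ?U ?V \<cdot>\<^sub>1 (\<upsilon> \<cdot>\<^sub>1 (\<epsilon> \<cdot>\<^sub>1 \<phi>)) = snd1 ?U ?V \<cdot>\<^sub>1 \<upsilon> \<cdot>\<^sub>1 \<epsilon> \<cdot>\<^sub>1 \<phi>"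
        by (simp add: assoc1)
      also have "\<dots> = snd1 ?U ?V \<cdot>\<^sub>1 \<upsilon> \<cdot>\<^sub>1 cunit D m"
        unfolding u_snd eps_snd e2\<phi> by (simp add: U.FA_cmp)
      finally show "snd1 ?U ?V \<cdot>\<^sub>1 (\<upsilon> \<cdot>\<^sub>1 (\<epsilon> \<cdot>\<^sub>1 \<phi>)) = snd1 ?U ?V \<cdot>\<^sub>1 (\<upsilon> \<cdot>\<^sub>1 cunit D m)"
        by (simp add: assoc1)
    qed auto
    then have "\<epsilon> \<cdot>\<^sub>1 \<phi> = cunit D m"
      by - (rule S.A.invertible_monic[OF u_inv], auto)
    then have "copt_map D (hunit D H, idc (hunit D H)) (P, \<epsilon>) m \<phi>"
      using \<phi> by (simp add: copt_map_def hom_def)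
    with \<pi>\<phi> show ?thesis
      by blast
  qed
  \<comment> \<open>The sides of \<open>\<pi> \<cdot>\<^sub>1 \<phi>\<close> are the components of
    \<open>f\<close>. Once \<open>f\<close> is known, compatibility with \<open>\<epsilon>\<close>
    fixes the components along \<open>e1\<close> and \<open>e2\<close>, and these together with the
    one along \<open>\<pi>\<close> determine \<open>\<phi>\<close>.\<close>
  have un: "f = f' \<and> \<phi> = \<phi>'"
    if H: "H \<in> Ob (VCat D)" and f: "copt_map D (hunit D H, idc (hunit D H)) (P, \<epsilon>) f \<phi>"
      and f': "copt_map D (hunit D H, idc (hunit D H)) (P, \<epsilon>) f' \<phi>'"
      and eq: "\<pi> \<cdot>\<^sub>1 \<phi> = \<pi> \<cdot>\<^sub>1 \<phi>'" for H f \<phi> f' \<phi>'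
  proof -
    note [simp] = copt_mapD(1-8)[OF f H] copt_mapD(1-8)[OF f' H] H
    have "f = f'"
      using arg_cong[OF eq, of "csrc D"] arg_cong[OF eq, of "ctgt D"]
      by - (rule pair0_eqI[of A X _ _ H], auto simp: W_def)
    then have e\<phi>: "\<epsilon> \<cdot>\<^sub>1 \<phi> = \<epsilon> \<cdot>\<^sub>1 \<phi>'" and ff: "f' = f"
      using copt_mapD(9)[OF f H] copt_mapD(9)[OF f' H] by auto
    have e1\<phi>: "e1 \<cdot>\<^sub>1 \<phi> = e1 \<cdot>\<^sub>1 \<phi>'" and e2\<phi>: "e2 \<cdot>\<^sub>1 \<phi> = e2 \<cdot>\<^sub>1 \<phi>'"
      by (simp_all add: assoc1 e\<phi> flip: eps_fst eps_snd)
    have \<tau>\<phi>: "\<tau> \<cdot>\<^sub>1 \<phi> = \<tau> \<cdot>\<^sub>1 \<phi>'"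
    proof (rule cartesian_monic[OF cg g])
      show "g \<cdot>\<^sub>1 (\<tau> \<cdot>\<^sub>1 \<phi>) = g \<cdot>\<^sub>1 (\<tau> \<cdot>\<^sub>1 \<phi>')"
        using eq e2\<phi> by - (rule pair1_eqI[of F ?V _ _ "hunit D H"],
          auto simp: \<pi>_def \<rho>_def e2_def assoc1 N_def)
    qed (auto simp: cells_iff ff)
    have "\<phi> = \<phi>'"
    proof (rule cartesian_monic[OF cc c])
      show "c \<cdot>\<^sub>1 \<phi> = c \<cdot>\<^sub>1 \<phi>'"
        using \<tau>\<phi> e1\<phi> by - (rule pair1_eqI[of ?U G _ _ "hunit D H"],
          auto simp: \<tau>_def e1_def assoc1 M_def)
    qed (auto simp: cells_iff ff)
    with ff show ?thesis by simp
  qed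
  have "tabulating_copointed D F P \<epsilon> \<pi>"
    unfolding tabulating_copointed_def
    using cop ex un by (auto simp: hom_def)
  then show ?thesis
    using pi_op that by blast
qed

lemma copt_simps [simp]:
  "Dom (Copt D) (p, a, r) = p" "Cod (Copt D) (p, a, r) = r"
  "(p, (f, \<phi>), r) \<in> Ar (Copt D) \<longleftrightarrow> case_prod (copointed D) p \<and> case_prod (copointed D) r \<and> copt_map D p r f \<phi>"
  "Cmp (Copt D) (p', (g, \<psi>), r) (p, (f, \<phi>), r') = (p, (g \<cdot>\<^sub>0\<^bsub>D\<^esub> f, \<psi> \<cdot>\<^sub>1\<^bsub>D\<^esub> \<phi>), r)"
  "(P, \<epsilon>) \<in> Ob (Copt D) \<longleftrightarrow> copointed D P \<epsilon>"
  "FO (copt_incl D) A = (hunit D A, Ide (HCat D) (hunit D A))"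
  "FA (copt_incl D) b = ((hunit D (Dom (VCat D) b), Ide (HCat D) (hunit D (Dom (VCat D) b))),
     (b, cunit D b), (hunit D (Cod (VCat D) b), Ide (HCat D) (hunit D (Cod (VCat D) b))))"
  by (auto simp: Copt_def copt_incl_def Let_def)

text \<open>Two bijections are composed: vertical arrows from \<open>H\<close> to \<open>T\<close>
  with co-pointed maps from the inclusion of \<open>H\<close> to \<open>P\<close>, by
  \<open>\<theta>\<close>, and these maps with cells from the unit of \<open>H\<close> to
  \<open>F\<close>, by \<open>\<pi>\<close>. Functoriality of the inclusion is supplied by the
  adjunction that provides \<open>\<theta>\<close>.\<close>

lemma (in dbl) tabulator_of_EM:
  assumes t: "tabulating_copointed D F P \<epsilon> \<pi>"
    and u: "universal_arrow (VCat D) (Copt D) (copt_incl D) T \<theta> (P, \<epsilon>)"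
    and I: "cat_functor (VCat D) (Copt D) (copt_incl D)"
  shows "universal_arrow (VCat D) (HCat D) (Unt D) T (\<pi> \<cdot>\<^sub>1 copt_cell \<theta>) F"
proof -
  interpret I: cat_functor "VCat D" "Copt D" "copt_incl D"
    by (rule I)
  let ?I = "\<lambda>H. (hunit D H, idc (hunit D H))"
  have T [simp]: "T \<in> Ob (VCat D)" and th: "\<theta> \<in> hom (Copt D) (?I T) (P, \<epsilon>)"
    and fac: "\<And>H a. \<lbrakk>H \<in> Ob (VCat D); a \<in> hom (Copt D) (?I H) (P, \<epsilon>)\<rbrakk>
      \<Longrightarrow> \<exists>!b. b \<in> hom (VCat D) H T \<and> Cmp (Copt D) \<theta> (FA (copt_incl D) b) = a"
    using u by (auto simp: universal_arrow_def)
  have cop: "copointed D P \<epsilon>" and pi: "\<pi> \<in> hom (HCat D) P F"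
    and ex: "\<And>H \<beta>. \<lbrakk>H \<in> Ob (VCat D); \<beta> \<in> hom (HCat D) (hunit D H) F\<rbrakk>
      \<Longrightarrow> \<exists>f \<phi>. copt_map D (?I H) (P, \<epsilon>) f \<phi> \<and> \<pi> \<cdot>\<^sub>1 \<phi> = \<beta>"
    and un: "\<And>H f \<phi> f' \<phi>'. \<lbrakk>H \<in> Ob (VCat D); copt_map D (?I H) (P, \<epsilon>) f \<phi>;
      copt_map D (?I H) (P, \<epsilon>) f' \<phi>'; \<pi> \<cdot>\<^sub>1 \<phi> = \<pi> \<cdot>\<^sub>1 \<phi>'\<rbrakk> \<Longrightarrow> f = f' \<and> \<phi> = \<phi>'"
    using t unfolding tabulating_copointed_def by blast+
  obtain w \<phi>\<^sub>0 where \<theta>: "\<theta> = (?I T, (w, \<phi>\<^sub>0), (P, \<epsilon>))" and m: "copt_map D (?I T) (P, \<epsilon>) w \<phi>\<^sub>0"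
    using homD[OF th] by (cases \<theta>) auto
  have [simp]: "\<phi>\<^sub>0 \<in> Ar (HCat D)" "Dom (HCat D) \<phi>\<^sub>0 = hunit D T" "Cod (HCat D) \<phi>\<^sub>0 = P"
    using m by (auto simp: copt_map_def cells_iff)
  note [simp] = homD[OF pi]
  have inc: "copointed D (hunit D H) (idc (hunit D H))" if "H \<in> Ob (VCat D)" for H
    using that by (simp add: copointed_def globular_iff)
  have cmp: "Cmp (Copt D) \<theta> (FA (copt_incl D) b) = (?I H, (w \<cdot>\<^sub>0 b, \<phi>\<^sub>0 \<cdot>\<^sub>1 cunit D b), (P, \<epsilon>))"
    and map: "copt_map D (?I H) (P, \<epsilon>) (w \<cdot>\<^sub>0 b) (\<phi>\<^sub>0 \<cdot>\<^sub>1 cunit D b)"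
    if b: "b \<in> hom (VCat D) H T" for b H
  proof -
    note b' = homD[OF b]
    show c: "Cmp (Copt D) \<theta> (FA (copt_incl D) b) = (?I H, (w \<cdot>\<^sub>0 b, \<phi>\<^sub>0 \<cdot>\<^sub>1 cunit D b), (P, \<epsilon>))"
      using b' by (simp add: \<theta>)
    have "Cmp (Copt D) \<theta> (FA (copt_incl D) b) \<in> hom (Copt D) (?I H) (P, \<epsilon>)"
      using I.B.cmp_hom[OF I.map_hom[OF b]] th by simp
    then show "copt_map D (?I H) (P, \<epsilon>) (w \<cdot>\<^sub>0 b) (\<phi>\<^sub>0 \<cdot>\<^sub>1 cunit D b)"
      unfolding c by (auto simp: hom_def)
  qed
  have cc: "copt_cell \<theta> = \<phi>\<^sub>0"
    by (simp add: \<theta>)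
  show ?thesis
    unfolding cc
  proof (rule universal_arrowI)
    show "T \<in> Ob (VCat D)" "\<pi> \<cdot>\<^sub>1 \<phi>\<^sub>0 \<in> hom (HCat D) (hunit D T) F"
      by (auto simp: hom_def)
    show "\<exists>b. b \<in> hom (VCat D) H T \<and> \<pi> \<cdot>\<^sub>1 \<phi>\<^sub>0 \<cdot>\<^sub>1 cunit D b = \<beta>"
      if H: "H \<in> Ob (VCat D)" and \<beta>: "\<beta> \<in> hom (HCat D) (hunit D H) F" for H \<beta>
    proof -
      obtain f \<phi> where f: "copt_map D (?I H) (P, \<epsilon>) f \<phi>" and eq: "\<pi> \<cdot>\<^sub>1 \<phi> = \<beta>"
        using ex[OF H \<beta>] by blast
      have "(?I H, (f, \<phi>), (P, \<epsilon>)) \<in> hom (Copt D) (?I H) (P, \<epsilon>)"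
        using f cop inc[OF H] by (simp add: hom_def)
      from fac[OF H this] obtain b where b: "b \<in> hom (VCat D) H T"
        and "Cmp (Copt D) \<theta> (FA (copt_incl D) b) = (?I H, (f, \<phi>), (P, \<epsilon>))"
        by blast
      then have "\<phi> = \<phi>\<^sub>0 \<cdot>\<^sub>1 cunit D b"
        by (simp add: cmp[OF b] del: copt_simps)
      then show ?thesis
        using b eq homD[OF b] by (intro exI[of _ b]) (simp add: assoc1)
    qed
    show "b = b'"
      if H: "H \<in> Ob (VCat D)" and b: "b \<in> hom (VCat D) H T" and b': "b' \<in> hom (VCat D) H T"
        and eq: "\<pi> \<cdot>\<^sub>1 \<phi>\<^sub>0 \<cdot>\<^sub>1 cunit D b = \<pi> \<cdot>\<^sub>1 \<phi>\<^sub>0 \<cdot>\<^sub>1 cunit D b'" for H b b'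
    proof -
      have "w \<cdot>\<^sub>0 b = w \<cdot>\<^sub>0 b' \<and> \<phi>\<^sub>0 \<cdot>\<^sub>1 cunit D b = \<phi>\<^sub>0 \<cdot>\<^sub>1 cunit D b'"
        using eq homD[OF b] homD[OF b'] by (intro un[OF H map[OF b] map[OF b']]) (simp add: assoc1)
      then have c: "Cmp (Copt D) \<theta> (FA (copt_incl D) b) = Cmp (Copt D) \<theta> (FA (copt_incl D) b')"
        by (simp add: cmp[OF b] cmp[OF b'] del: copt_simps)
      have "Cmp (Copt D) \<theta> (FA (copt_incl D) b') \<in> hom (Copt D) (?I H) (P, \<epsilon>)"
        using I.B.cmp_hom[OF I.map_hom[OF b']] th by simp
      from fac[OF H this] show ?thesis
        using b b' c by blast
    qed
  qed
qed

text \<open>Terminal objects of one comma category are isomorphic over it. Strength of tabulators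
  refers to every right adjoint of the unit functor, whereas the construction yields one particular
  tabulator.\<close>

lemma (in cat_functor) universal_arrow_iso:
  assumes u: "universal_arrow C D F t \<epsilon> y" and u': "universal_arrow C D F t' \<epsilon>' y"
  obtains b where "b \<in> hom C t' t" "invertible C b" "\<epsilon> \<cdot>\<^bsub>D\<^esub> FA F b = \<epsilon>'"
proof -
  have t: "t \<in> Ob C" "\<epsilon> \<in> hom D (FO F t) y"
    and ex: "\<And>x \<beta>. \<lbrakk>x \<in> Ob C; \<beta> \<in> hom D (FO F x) y\<rbrakk> \<Longrightarrow> \<exists>!b. b \<in> hom C x t \<and> \<epsilon> \<cdot>\<^bsub>D\<^esub> FA F b = \<beta>"
    using u by (auto simp: universal_arrow_def)
  have t': "t' \<in> Ob C" "\<epsilon>' \<in> hom D (FO F t') y"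
    and ex': "\<And>x \<beta>. \<lbrakk>x \<in> Ob C; \<beta> \<in> hom D (FO F x) y\<rbrakk> \<Longrightarrow> \<exists>!b. b \<in> hom C x t' \<and> \<epsilon>' \<cdot>\<^bsub>D\<^esub> FA F b = \<beta>"
    using u' by (auto simp: universal_arrow_def)
  obtain b where b: "b \<in> hom C t' t" "\<epsilon> \<cdot>\<^bsub>D\<^esub> FA F b = \<epsilon>'"
    using ex[OF t'] by blast
  obtain a where a: "a \<in> hom C t t'" "\<epsilon>' \<cdot>\<^bsub>D\<^esub> FA F a = \<epsilon>"
    using ex'[OF t] by blast
  note [simp] = homD[OF b(1)] homD[OF a(1)] homD[OF t(2)] homD[OF t'(2)] t(1) t'(1)
  have "\<epsilon> \<cdot>\<^bsub>D\<^esub> FA F (b \<cdot>\<^bsub>C\<^esub> a) = \<epsilon>" "\<epsilon>' \<cdot>\<^bsub>D\<^esub> FA F (a \<cdot>\<^bsub>C\<^esub> b) = \<epsilon>'"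
    by (simp_all add: FA_cmp a b flip: B.assoc)
  moreover have "\<epsilon> \<cdot>\<^bsub>D\<^esub> FA F (Ide C t) = \<epsilon>" "\<epsilon>' \<cdot>\<^bsub>D\<^esub> FA F (Ide C t') = \<epsilon>'"
    by simp_all
  moreover have "b \<cdot>\<^bsub>C\<^esub> a \<in> hom C t t" "a \<cdot>\<^bsub>C\<^esub> b \<in> hom C t' t'" "Ide C t \<in> hom C t t" "Ide C t' \<in> hom C t' t'"
    by (auto simp: hom_def)
  ultimately have "b \<cdot>\<^bsub>C\<^esub> a = Ide C t" "a \<cdot>\<^bsub>C\<^esub> b = Ide C t'"
    using ex[OF t] ex'[OF t'] by blast+
  then have "invertible C b"
    by (intro A.invertibleI[of _ a]) auto
  with b show ?thesis
    using that by blast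
qed

section \<open>Strength of a cell out of a unit arrow as op-Cartesianness\<close>

context dbl
begin

text \<open>Fibrancy provides a companion and a conjoint to instantiate the quantified choices. Then
  \<open>\<iota>\<close> is an op-Cartesian cell followed by an invertible one.\<close>

lemma opcartesian_of_induced:
  assumes fib: "fibrant D" and ind: "induced_cell_invertible D T F \<iota>"
    and i: "\<iota> \<in> hom (HCat D) (hunit D T) F" and T: "T \<in> Ob (VCat D)"
  shows "opcartesian_cell D \<iota>"
proof -
  note [simp] = homD[OF i] T
  have F [simp]: "F \<in> Ob (HCat D)"
    using S.A.cod_Ob'[of \<iota>] by simp
  have ex: "\<exists>K. \<exists>\<alpha>\<in>cells D f g K (hunit D B). cartesian_cell D \<alpha>"
    if "f \<in> Ar (VCat D)" "g \<in> Ar (VCat D)" "Cod (VCat D) f = B" "Cod (VCat D) g = B" for f g B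
    using fib[unfolded fibrant_def, rule_format, of f g "hunit D B"] that S.B.cod_Ob'[of f] by auto
  obtain K where K: "companion D (ctgt D \<iota>) K"
    using ex[of "ctgt D \<iota>" "idv (htgt D F)" "htgt D F"] by (auto simp: companion_def Let_def)
  obtain L where L: "conjoint D (csrc D \<iota>) L"
    using ex[of "idv (hsrc D F)" "csrc D \<iota>" "hsrc D F"] by (auto simp: conjoint_def Let_def)
  obtain \<sigma> m where s: "\<sigma> \<in> cells D (csrc D \<iota>) (ctgt D \<iota>) (hunit D T) (K \<odot> L)" "opcartesian_cell D \<sigma>"
    and m: "m \<in> globular D (K \<odot> L) F" "m \<cdot>\<^sub>1 \<sigma> = \<iota>" "invertible (HCat D) m"
    using ind K L unfolding induced_cell_invertible_def by meson
  have "opcartesian_cell D (m \<cdot>\<^sub>1 \<sigma>)"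
    by (rule opcartesian_cmp[OF s(2,1) opcartesian_invertible[OF m(3)] m(1)[unfolded globular_def]])
  then show ?thesis
    by (simp add: m)
qed

text \<open>For any companion and conjoint an op-Cartesian cell into their composite exists by
  \<open>opcartesian_hunit_exists\<close>, and its comparison with the op-Cartesian
  \<open>\<iota>\<close> is invertible.\<close>

lemma induced_of_opcartesian:
  assumes op: "opcartesian_cell D \<iota>" and i: "\<iota> \<in> hom (HCat D) (hunit D T) F" and T: "T \<in> Ob (VCat D)"
  shows "induced_cell_invertible D T F \<iota>"
proof -
  note [simp] = homD[OF i] T
  have F [simp]: "F \<in> Ob (HCat D)"
    using S.A.cod_Ob'[of \<iota>] by simp
  have i': "\<iota> \<in> cells D (csrc D \<iota>) (ctgt D \<iota>) (hunit D T) F"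
    by (simp add: cells_iff)
  have "\<exists>\<sigma> \<in> cells D (csrc D \<iota>) (ctgt D \<iota>) (hunit D T) (K \<odot> L). opcartesian_cell D \<sigma>"
    if "companion D (ctgt D \<iota>) K" "conjoint D (csrc D \<iota>) L" for K L
    by (rule opcartesian_hunit_exists[of "csrc D \<iota>" T "hsrc D F" "ctgt D \<iota>" "htgt D F" K L])
      (use that in \<open>auto simp: hom_def\<close>)
  moreover have "\<exists>m \<in> globular D N F. m \<cdot>\<^sub>1 \<sigma> = \<iota> \<and> invertible (HCat D) m"
    if "\<sigma> \<in> cells D (csrc D \<iota>) (ctgt D \<iota>) (hunit D T) N" "opcartesian_cell D \<sigma>" for \<sigma> N
    using opcartesian_comparison[OF that(2,1) op i'] by metis
  ultimately show ?thesis
    unfolding induced_cell_invertible_def by blast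
qed

end

section \<open>Existence and strength of tabulators from Eilenberg-Moore objects\<close>

context cart_dbl
begin

lemma has_tabulators_of_EM:
  assumes fib: "fibrant D" and EM: "has_EM_objects D"
  shows "has_tabulators D"
  unfolding has_tabulators_def
proof (rule U.adjunction_of_universal_arrows)
  fix F assume F: "F \<in> Ob (HCat D)"
  obtain EM \<eta> \<theta> where EM: "adjunction (VCat D) (Copt D) (copt_incl D) EM \<eta> \<theta>"
    using EM by (auto simp: has_EM_objects_def)
  interpret EM: adjunction "VCat D" "Copt D" "copt_incl D" EM \<eta> \<theta>
    by (rule EM)
  obtain P \<epsilon> \<pi> where t: "tabulating_copointed D F P \<epsilon> \<pi>"
    using tabulating_copointed_exists[OF fib F] .
  have "(P, \<epsilon>) \<in> Ob (Copt D)"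
    using t by (simp add: tabulating_copointed_def)
  from tabulator_of_EM[OF t EM.counit_universal[OF this]]
  show "\<exists>t \<epsilon>. universal_arrow (VCat D) (HCat D) (Unt D) t \<epsilon> F"
    using EM.L.cat_functor_axioms by blast
qed

lemma strong_tabulators_of_strong_EM:
  assumes fib: "fibrant D" and EM: "has_EM_objects D" and str: "strong_EM_objects D"
  shows "strong_tabulators D"
  unfolding strong_tabulators_def
proof (intro allI impI ballI)
  fix Tab \<eta>' \<iota> F
  assume Tab: "adjunction (VCat D) (HCat D) (Unt D) Tab \<eta>' \<iota>" and F: "F \<in> Ob (HCat D)"
  interpret Tab: adjunction "VCat D" "HCat D" "Unt D" Tab \<eta>' \<iota>
    by (rule Tab)
  obtain EM \<eta> \<theta> where EM: "adjunction (VCat D) (Copt D) (copt_incl D) EM \<eta> \<theta>"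
    using EM by (auto simp: has_EM_objects_def)
  interpret EM: adjunction "VCat D" "Copt D" "copt_incl D" EM \<eta> \<theta>
    by (rule EM)
  obtain P \<epsilon> \<pi> where t: "tabulating_copointed D F P \<epsilon> \<pi>" and pi_op: "opcartesian_cell D \<pi>"
    using tabulating_copointed_exists[OF fib F] .
  have cop: "copointed D P \<epsilon>" and pi: "\<pi> \<in> hom (HCat D) P F"
    using t by (simp_all add: tabulating_copointed_def)
  then have Pob: "(P, \<epsilon>) \<in> Ob (Copt D)"
    by simp
  define T \<theta>\<^sub>P where "T = FO EM (P, \<epsilon>)" and "\<theta>\<^sub>P = copt_cell (\<theta> (P, \<epsilon>))"
  have u: "universal_arrow (VCat D) (Copt D) (copt_incl D) T (\<theta> (P, \<epsilon>)) (P, \<epsilon>)"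
    unfolding T_def by (rule EM.counit_universal[OF Pob])
  have T: "T \<in> Ob (VCat D)" and th: "\<theta>\<^sub>P \<in> hom (HCat D) (hunit D T) P"
    using u by (cases "\<theta> (P, \<epsilon>)"; auto simp: universal_arrow_def hom_def copt_map_def cells_def \<theta>\<^sub>P_def)+
  have "induced_cell_invertible D T P \<theta>\<^sub>P"
    using str EM cop unfolding strong_EM_objects_def T_def \<theta>\<^sub>P_def by blast
  then have th_op: "opcartesian_cell D \<theta>\<^sub>P"
    by (rule opcartesian_of_induced[OF fib _ th T])
  have v: "universal_arrow (VCat D) (HCat D) (Unt D) T (\<pi> \<cdot>\<^sub>1 \<theta>\<^sub>P) F"
    unfolding \<theta>\<^sub>P_def by (rule tabulator_of_EM[OF t u EM.L.cat_functor_axioms])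
  have v': "universal_arrow (VCat D) (HCat D) (Unt D) (FO Tab F) (\<iota> F) F"
    by (rule Tab.counit_universal[OF F])
  \<comment> \<open>The given tabulator cell differs from the constructed one by the unit cell of a
    vertical isomorphism; that cell is invertible, hence op-Cartesian.\<close>
  obtain b where b: "b \<in> hom (VCat D) (FO Tab F) T" "invertible (VCat D) b"
    and eq: "\<pi> \<cdot>\<^sub>1 \<theta>\<^sub>P \<cdot>\<^sub>1 cunit D b = \<iota> F"
    using U.universal_arrow_iso[OF v v'] by metis
  note [simp] = homD[OF b(1)] homD[OF th] homD[OF pi]
  have c: "\<alpha> \<in> cells D (csrc D \<alpha>) (ctgt D \<alpha>) M N" if "\<alpha> \<in> Ar (HCat D)" "Dom (HCat D) \<alpha> = M" "Cod (HCat D) \<alpha> = N"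
    for \<alpha> M N
    using that by (simp add: cells_iff)
  have "opcartesian_cell D (\<pi> \<cdot>\<^sub>1 \<theta>\<^sub>P)"
    by (rule opcartesian_cmp[OF th_op c pi_op c]) auto
  then have "opcartesian_cell D (\<pi> \<cdot>\<^sub>1 \<theta>\<^sub>P \<cdot>\<^sub>1 cunit D b)"
    using opcartesian_invertible[OF U.FA_invertible[OF b(2)]]
    by - (rule opcartesian_cmp[OF _ c _ c], auto)
  then have "opcartesian_cell D (\<iota> F)"
    by (simp only: eq)
  then show "induced_cell_invertible D (FO Tab F) F (\<iota> F)"
    using v' by (intro induced_of_opcartesian) (auto simp: universal_arrow_def)
qed

end


section \<open>The Cartesian structure from the double adjunctions\<close>

lemma prod_cat_simps [simp]:
  "Ob (prod_cat C C') = Ob C \<times> Ob C'" "Ar (prod_cat C C') = Ar C \<times> Ar C'"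
  "Dom (prod_cat C C') (f, f') = (Dom C f, Dom C' f')" "Cod (prod_cat C C') (f, f') = (Cod C f, Cod C' f')"
  "Ide (prod_cat C C') (x, x') = (Ide C x, Ide C' x')"
  "Cmp (prod_cat C C') (g, g') (f, f') = (g \<cdot>\<^bsub>C\<^esub> f, g' \<cdot>\<^bsub>C'\<^esub> f')"
  by (auto simp: prod_cat_def)

lemma hom_prod_cat [simp]: "hom (prod_cat C C') (x, x') (y, y') = hom C x y \<times> hom C' x' y'"
  by (auto simp: hom_def)

lemma prod_dbl_simps [simp]:
  "VCat (prod_dbl D E) = prod_cat (VCat D) (VCat E)" "HCat (prod_dbl D E) = prod_cat (HCat D) (HCat E)"
  "hsrc (prod_dbl D E) (M, M') = (hsrc D M, hsrc E M')" "htgt (prod_dbl D E) (M, M') = (htgt D M, htgt E M')"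
  "csrc (prod_dbl D E) (\<alpha>, \<alpha>') = (csrc D \<alpha>, csrc E \<alpha>')" "ctgt (prod_dbl D E) (\<alpha>, \<alpha>') = (ctgt D \<alpha>, ctgt E \<alpha>')"
  "hunit (prod_dbl D E) (A, A') = (hunit D A, hunit E A')" "cunit (prod_dbl D E) (f, f') = (cunit D f, cunit E f')"
  "(M, M') \<odot>\<^bsub>prod_dbl D E\<^esub> (N, N') = (M \<odot>\<^bsub>D\<^esub> N, M' \<odot>\<^bsub>E\<^esub> N')"
  "(\<alpha>, \<alpha>') \<star>\<^bsub>prod_dbl D E\<^esub> (\<beta>, \<beta>') = (\<alpha> \<star>\<^bsub>D\<^esub> \<beta>, \<alpha>' \<star>\<^bsub>E\<^esub> \<beta>')"
  by (auto simp: prod_dbl_def prod_fctr_def)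

lemma hpairs_prod_dbl [simp]:
  "((M, M'), (N, N')) \<in> Ob (hpairs (prod_dbl D E))
    \<longleftrightarrow> (M, N) \<in> Ob (hpairs D) \<and> (M', N') \<in> Ob (hpairs E)"
  by (auto simp: hpairs_def)

lemma diagonal_simps [simp]:
  "FO (DF0 (diagonal D)) A = (A, A)" "FA (DF0 (diagonal D)) f = (f, f)"
  "FO (DF1 (diagonal D)) M = (M, M)" "FA (DF1 (diagonal D)) \<alpha> = (\<alpha>, \<alpha>)"
  by (auto simp: diagonal_def)

text \<open>A universal arrow from a diagonal functor is a binary product, its two components being
  the projections. In the uniqueness clause \<open>category C\<close> ensures that the common
  composites with the projections are arrows of the right type.\<close>

lemma universal_arrow_diagonal:
  assumes "universal_arrow C (prod_cat C C) F t e (x, y)"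
    and F: "\<And>x. FO F x = (x, x)" "\<And>f. FA F f = (f, f)"
  shows "t \<in> Ob C" "fst e \<in> hom C t x" "snd e \<in> hom C t y"
    "\<And>z f g. \<lbrakk>z \<in> Ob C; f \<in> hom C z x; g \<in> hom C z y\<rbrakk>
      \<Longrightarrow> \<exists>k \<in> hom C z t. fst e \<cdot>\<^bsub>C\<^esub> k = f \<and> snd e \<cdot>\<^bsub>C\<^esub> k = g"
    "\<And>z k k'. \<lbrakk>category C; z \<in> Ob C; k \<in> hom C z t; k' \<in> hom C z t; fst e \<cdot>\<^bsub>C\<^esub> k = fst e \<cdot>\<^bsub>C\<^esub> k';
      snd e \<cdot>\<^bsub>C\<^esub> k = snd e \<cdot>\<^bsub>C\<^esub> k'\<rbrakk> \<Longrightarrow> k = k'"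
proof -
  obtain p q where e: "e = (p, q)"
    by (cases e)
  have t: "t \<in> Ob C" and pq: "p \<in> hom C t x" "q \<in> hom C t y"
    and ex: "\<And>z f g. \<lbrakk>z \<in> Ob C; f \<in> hom C z x; g \<in> hom C z y\<rbrakk>
      \<Longrightarrow> \<exists>!k. k \<in> hom C z t \<and> p \<cdot>\<^bsub>C\<^esub> k = f \<and> q \<cdot>\<^bsub>C\<^esub> k = g"
    using assms(1) by (auto simp: universal_arrow_def F e)
  show "t \<in> Ob C" "fst e \<in> hom C t x" "snd e \<in> hom C t y"
    using t pq by (simp_all add: e)
  show "\<exists>k \<in> hom C z t. fst e \<cdot>\<^bsub>C\<^esub> k = f \<and> snd e \<cdot>\<^bsub>C\<^esub> k = g"
    if "z \<in> Ob C" "f \<in> hom C z x" "g \<in> hom C z y" for z f g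
    using ex[OF that] by (auto simp: e)
  show "k = k'" if c: "category C" and z: "z \<in> Ob C" and k: "k \<in> hom C z t" "k' \<in> hom C z t"
      and eq: "fst e \<cdot>\<^bsub>C\<^esub> k = fst e \<cdot>\<^bsub>C\<^esub> k'" "snd e \<cdot>\<^bsub>C\<^esub> k = snd e \<cdot>\<^bsub>C\<^esub> k'" for z k k'
  proof -
    interpret category C by (rule c)
    show ?thesis
      using ex[OF z cmp_hom[OF k(1) pq(1)] cmp_hom[OF k(1) pq(2)]] k eq by (auto simp: e)
  qed
qed

text \<open>Products and projections are the right adjoint of the diagonal and the components of the
  counit, the terminal arrows likewise. That projections of horizontal arrows lie over projections
  of objects, and are compatible with composites and units, holds because the counit is a vertical
  transformation.\<close>

lemma cart_dbl_of_cartesian: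
  fixes D :: "('o, 'v, 'h, 'c) dblcat"
  assumes D: "double_category D" and "cartesian_double_category D"
  obtains prod0 fst0 snd0 prod1 fst1 snd1 one0 one1
  where "cart_dbl D prod0 fst0 snd0 prod1 fst1 snd1 one0 one1"
proof -
  interpret dbl D
    using D by (rule dbl.intro)
  let ?DD = "prod_dbl D D"
  obtain R \<eta>\<^sub>0 \<eta>\<^sub>1 \<epsilon>\<^sub>0 \<epsilon>\<^sub>1 where "double_adjunction D ?DD (diagonal D) R \<eta>\<^sub>0 \<eta>\<^sub>1 \<epsilon>\<^sub>0 \<epsilon>\<^sub>1"
    using assms(2) by (auto simp: cartesian_double_category_def)
  then interpret P: double_adjunction D ?DD "diagonal D" R \<eta>\<^sub>0 \<eta>\<^sub>1 \<epsilon>\<^sub>0 \<epsilon>\<^sub>1 .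
  obtain R' \<eta>\<^sub>0' \<eta>\<^sub>1' \<epsilon>\<^sub>0' \<epsilon>\<^sub>1' where
    "double_adjunction D terminal_dbl to_terminal R' \<eta>\<^sub>0' \<eta>\<^sub>1' \<epsilon>\<^sub>0' \<epsilon>\<^sub>1'"
    using assms(2) by (auto simp: cartesian_double_category_def)
  then interpret I: double_adjunction D terminal_dbl to_terminal R' \<eta>\<^sub>0' \<eta>\<^sub>1' \<epsilon>\<^sub>0' \<epsilon>\<^sub>1' .
  define prod0 where "prod0 A B = FO (DF0 R) (A, B)" for A B
  define prod1 where "prod1 M N = FO (DF1 R) (M, N)" for M N
  define fst0 where "fst0 A B = fst (\<epsilon>\<^sub>0 (A, B))" for A B
  define snd0 where "snd0 A B = snd (\<epsilon>\<^sub>0 (A, B))" for A B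
  define fst1 where "fst1 M N = fst (\<epsilon>\<^sub>1 (M, N))" for M N
  define snd1 where "snd1 M N = snd (\<epsilon>\<^sub>1 (M, N))" for M N
  define one0 where "one0 = FO (DF0 R') ()"
  define one1 where "one1 = FO (DF1 R') ()"
  have u0: "universal_arrow (VCat D) (prod_cat (VCat D) (VCat D)) (DF0 (diagonal D)) (prod0 A B) (\<epsilon>\<^sub>0 (A, B)) (A, B)"
    if "A \<in> Ob (VCat D)" "B \<in> Ob (VCat D)" for A B
    using P.adj0.counit_universal[of "(A, B)"] that by (simp add: prod0_def)
  have u1: "universal_arrow (HCat D) (prod_cat (HCat D) (HCat D)) (DF1 (diagonal D)) (prod1 M N) (\<epsilon>\<^sub>1 (M, N)) (M, N)"
    if "M \<in> Ob (HCat D)" "N \<in> Ob (HCat D)" for M N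
    using P.adj1.counit_universal[of "(M, N)"] that by (simp add: prod1_def)
  note d0 = universal_arrow_diagonal[OF u0 diagonal_simps(1,2), folded fst0_def snd0_def]
  note d1 = universal_arrow_diagonal[OF u1 diagonal_simps(3,4), folded fst1_def snd1_def]
  have p1: "hsrc D (prod1 M N) = prod0 (hsrc D M) (hsrc D N)" "htgt D (prod1 M N) = prod0 (htgt D M) (htgt D N)"
    if "M \<in> Ob (HCat D)" "N \<in> Ob (HCat D)" for M N
    using P.R.src_Ob[of "(M, N)"] P.R.tgt_Ob[of "(M, N)"] that by (auto simp: prod0_def prod1_def)
  have s1: "csrc D (fst1 M N) = fst0 (hsrc D M) (hsrc D N)" "ctgt D (fst1 M N) = fst0 (htgt D M) (htgt D N)"
    "csrc D (snd1 M N) = snd0 (hsrc D M) (hsrc D N)" "ctgt D (snd1 M N) = snd0 (htgt D M) (htgt D N)"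
    if "M \<in> Ob (HCat D)" "N \<in> Ob (HCat D)" for M N
    using P.counit.trans_src[of "(M, N)"] P.counit.trans_tgt[of "(M, N)"] that
    by (cases "\<epsilon>\<^sub>1 (M, N)"; auto simp: fst0_def snd0_def fst1_def snd1_def dest: sym)+
  let ?t = "to_terminal :: ('o, 'v, 'h, 'c, unit, unit, unit, unit) dfctr"
  have i0: "universal_arrow (VCat D) (VCat terminal_dbl) (DF0 ?t) one0 (\<epsilon>\<^sub>0' ()) ()"
    using I.adj0.counit_universal[of "()"] by (simp add: one0_def terminal_dbl_def terminal_cat_def)
  have i1: "universal_arrow (HCat D) (HCat terminal_dbl) (DF1 ?t) one1 (\<epsilon>\<^sub>1' ()) ()"
    using I.adj1.counit_universal[of "()"] by (simp add: one1_def terminal_dbl_def terminal_cat_def)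
  \<comment> \<open>The terminal category has one arrow, so a universal arrow from the functor into
    it is a terminal object.\<close>
  have t0: "\<exists>!f. f \<in> hom (VCat D) A one0" if "A \<in> Ob (VCat D)" for A
    using i0 that by (auto simp: universal_arrow_def terminal_dbl_def terminal_cat_def hom_def)
  have t1: "\<exists>!f. f \<in> hom (HCat D) M one1" if "M \<in> Ob (HCat D)" for M
    using i1 that by (auto simp: universal_arrow_def terminal_dbl_def terminal_cat_def hom_def)
  have o1: "one0 \<in> Ob (VCat D)" "one1 \<in> Ob (HCat D)"
    using i0 i1 by (auto simp: universal_arrow_def)
  have o2: "hsrc D one1 = one0" "htgt D one1 = one0"
    using I.R.src_Ob[of "()"] I.R.tgt_Ob[of "()"]
    by (auto simp: one0_def one1_def terminal_dbl_def terminal_cat_def const_unit_def)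
  have e1: "fst (\<epsilon>\<^sub>1 (M, N)) \<in> hom (HCat D) (prod1 M N) M" "snd (\<epsilon>\<^sub>1 (M, N)) \<in> hom (HCat D) (prod1 M N) N"
    if "M \<in> Ob (HCat D)" "N \<in> Ob (HCat D)" for M N
    using d1(2,3)[OF that] by (simp_all add: fst1_def snd1_def)
  have "cart_dbl D prod0 fst0 snd0 prod1 fst1 snd1 one0 one1"
  proof
    show "\<exists>\<mu> \<in> globular D (prod1 M M' \<odot>\<^bsub>D\<^esub> prod1 N N') (prod1 (M \<odot>\<^bsub>D\<^esub> N) (M' \<odot>\<^bsub>D\<^esub> N')). invertible (HCat D) \<mu>
        \<and> fst1 (M \<odot>\<^bsub>D\<^esub> N) (M' \<odot>\<^bsub>D\<^esub> N') \<cdot>\<^sub>1\<^bsub>D\<^esub> \<mu> = fst1 M M' \<star>\<^bsub>D\<^esub> fst1 N N'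
        \<and> snd1 (M \<odot>\<^bsub>D\<^esub> N) (M' \<odot>\<^bsub>D\<^esub> N') \<cdot>\<^sub>1\<^bsub>D\<^esub> \<mu> = snd1 M M' \<star>\<^bsub>D\<^esub> snd1 N N'"
      if M: "M \<in> Ob (HCat D)" and N: "N \<in> Ob (HCat D)" and MN: "hsrc D M = htgt D N"
       and M': "M' \<in> Ob (HCat D)" and N': "N' \<in> Ob (HCat D)" and MN': "hsrc D M' = htgt D N'" for M N M' N'
    proof (intro bexI conjI)
      \<comment> \<open>The structure cell of the right adjoint, invertible because that adjoint is
        a pseudo double functor.\<close>
      let ?\<mu> = "DMul R (M, M') (N, N')"
      have hp: "((M, M'), (N, N')) \<in> Ob (hpairs ?DD)"
        using that by simp
      show g: "?\<mu> \<in> globular D (prod1 M M' \<odot>\<^bsub>D\<^esub> prod1 N N') (prod1 (M \<odot>\<^bsub>D\<^esub> N) (M' \<odot>\<^bsub>D\<^esub> N'))"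
        using P.R.mul_cell[OF hp] by (simp add: prod1_def)
      show "invertible (HCat D) ?\<mu>"
        by (rule P.R.mul_invertible[OF hp])
      obtain p p' where p [simp]: "\<epsilon>\<^sub>1 (M, M') = (p, p')"
        by fastforce
      obtain q q' where q [simp]: "\<epsilon>\<^sub>1 (N, N') = (q, q')"
        by fastforce
      note [simp] = globularD(1-3)[OF g] that d1(1)[OF M M'] d1(1)[OF N N'] p1
      note [simp] = homD[OF e1(1)[OF M M'], simplified] homD[OF e1(2)[OF M M'], simplified]
        homD[OF e1(1)[OF N N'], simplified] homD[OF e1(2)[OF N N'], simplified]
        s1[OF M M', unfolded fst1_def snd1_def p fst_conv snd_conv]
        s1[OF N N', unfolded fst1_def snd1_def q fst_conv snd_conv]
      \<comment> \<open>Compatibility of the counit with horizontal composition. The structure cells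
        of the diagonal and of the identity functor are identities, so only those of
        \<open>R\<close> remain.\<close>
      have "\<epsilon>\<^sub>1 (M \<odot>\<^bsub>D\<^esub> N, M' \<odot>\<^bsub>D\<^esub> N') \<cdot>\<^sub>1\<^bsub>?DD\<^esub> (?\<mu>, ?\<mu>)
          = (fst (\<epsilon>\<^sub>1 (M, M')) \<star>\<^bsub>D\<^esub> fst (\<epsilon>\<^sub>1 (N, N')), snd (\<epsilon>\<^sub>1 (M, M')) \<star>\<^bsub>D\<^esub> snd (\<epsilon>\<^sub>1 (N, N')))"
        using P.counit.trans_mul[OF hp]
        by (simp add: comp_dfctr_def id_dfctr_def diagonal_def Let_def flip: prod1_def)
      then show "fst1 (M \<odot>\<^bsub>D\<^esub> N) (M' \<odot>\<^bsub>D\<^esub> N') \<cdot>\<^sub>1\<^bsub>D\<^esub> ?\<mu> = fst1 M M' \<star>\<^bsub>D\<^esub> fst1 N N'"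
        "snd1 (M \<odot>\<^bsub>D\<^esub> N) (M' \<odot>\<^bsub>D\<^esub> N') \<cdot>\<^sub>1\<^bsub>D\<^esub> ?\<mu> = snd1 M M' \<star>\<^bsub>D\<^esub> snd1 N N'"
        by (cases "\<epsilon>\<^sub>1 (M \<odot>\<^bsub>D\<^esub> N, M' \<odot>\<^bsub>D\<^esub> N')"; simp add: fst1_def snd1_def)+
    qed
    show "\<exists>\<upsilon> \<in> globular D (hunit D (prod0 A B)) (prod1 (hunit D A) (hunit D B)). invertible (HCat D) \<upsilon>
        \<and> fst1 (hunit D A) (hunit D B) \<cdot>\<^sub>1\<^bsub>D\<^esub> \<upsilon> = cunit D (fst0 A B)
        \<and> snd1 (hunit D A) (hunit D B) \<cdot>\<^sub>1\<^bsub>D\<^esub> \<upsilon> = cunit D (snd0 A B)"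
      if A: "A \<in> Ob (VCat D)" and B: "B \<in> Ob (VCat D)" for A B
    proof (intro bexI conjI)
      let ?\<upsilon> = "DUni R (A, B)"
      have ab: "(A, B) \<in> Ob (VCat ?DD)"
        using that by simp
      show g: "?\<upsilon> \<in> globular D (hunit D (prod0 A B)) (prod1 (hunit D A) (hunit D B))"
        using P.R.uni_cell[OF ab] by (simp add: prod0_def prod1_def)
      show "invertible (HCat D) ?\<upsilon>"
        by (rule P.R.uni_invertible[OF ab])
      obtain p q where pq [simp]: "\<epsilon>\<^sub>0 (A, B) = (p, q)"
        by fastforce
      note [simp] = globularD(1-3)[OF g] that d0(1)[OF A B]
      note [simp] = homD[OF d0(2)[OF A B, unfolded fst0_def], simplified]
        homD[OF d0(3)[OF A B, unfolded snd0_def], simplified]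
      have "\<epsilon>\<^sub>1 (hunit D A, hunit D B) \<cdot>\<^sub>1\<^bsub>?DD\<^esub> (?\<upsilon>, ?\<upsilon>) = (cunit D (fst (\<epsilon>\<^sub>0 (A, B))), cunit D (snd (\<epsilon>\<^sub>0 (A, B))))"
        using P.counit.trans_uni[OF ab]
        by (simp add: comp_dfctr_def id_dfctr_def diagonal_def Let_def flip: prod0_def)
      then show "fst1 (hunit D A) (hunit D B) \<cdot>\<^sub>1\<^bsub>D\<^esub> ?\<upsilon> = cunit D (fst0 A B)"
        "snd1 (hunit D A) (hunit D B) \<cdot>\<^sub>1\<^bsub>D\<^esub> ?\<upsilon> = cunit D (snd0 A B)"
        by (cases "\<epsilon>\<^sub>1 (hunit D A, hunit D B)"; simp add: fst1_def snd1_def fst0_def snd0_def)+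
    qed
    show "\<exists>k \<in> hom (VCat D) C (prod0 A B). fst0 A B \<cdot>\<^sub>0\<^bsub>D\<^esub> k = f \<and> snd0 A B \<cdot>\<^sub>0\<^bsub>D\<^esub> k = g"
      if f: "f \<in> hom (VCat D) C A" and g: "g \<in> hom (VCat D) C B" for f g A B C
      using d0(4)[OF _ _ _ f g] homD[OF f] homD[OF g] by auto
    show "\<exists>\<gamma> \<in> hom (HCat D) Q (prod1 M N). fst1 M N \<cdot>\<^sub>1\<^bsub>D\<^esub> \<gamma> = \<alpha> \<and> snd1 M N \<cdot>\<^sub>1\<^bsub>D\<^esub> \<gamma> = \<beta>"
      if a: "\<alpha> \<in> hom (HCat D) Q M" and b: "\<beta> \<in> hom (HCat D) Q N" for \<alpha> \<beta> Q M N
      using d1(4)[OF _ _ _ a b] homD[OF a] homD[OF b] by auto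
    show "k = k'"
      if "A \<in> Ob (VCat D)" "B \<in> Ob (VCat D)" "k \<in> hom (VCat D) C (prod0 A B)"
        "k' \<in> hom (VCat D) C (prod0 A B)" "fst0 A B \<cdot>\<^sub>0\<^bsub>D\<^esub> k = fst0 A B \<cdot>\<^sub>0\<^bsub>D\<^esub> k'"
        "snd0 A B \<cdot>\<^sub>0\<^bsub>D\<^esub> k = snd0 A B \<cdot>\<^sub>0\<^bsub>D\<^esub> k'" for A B C k k'
      using d0(5)[OF that(1,2) S.B.category_axioms _ that(3-6)] homD[OF that(3)] by auto
    show "\<gamma> = \<gamma>'"
      if "M \<in> Ob (HCat D)" "N \<in> Ob (HCat D)" "\<gamma> \<in> hom (HCat D) Q (prod1 M N)"
        "\<gamma>' \<in> hom (HCat D) Q (prod1 M N)" "fst1 M N \<cdot>\<^sub>1\<^bsub>D\<^esub> \<gamma> = fst1 M N \<cdot>\<^sub>1\<^bsub>D\<^esub> \<gamma>'"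
        "snd1 M N \<cdot>\<^sub>1\<^bsub>D\<^esub> \<gamma> = snd1 M N \<cdot>\<^sub>1\<^bsub>D\<^esub> \<gamma>'" for M N Q \<gamma> \<gamma>'
      using d1(5)[OF that(1,2) S.A.category_axioms _ that(3-6)] homD[OF that(3)] by auto
    show "f = g" if "f \<in> hom (VCat D) A one0" "g \<in> hom (VCat D) A one0" for f g A
      using t0[of A] that homD[OF that(1)] by auto
    show "\<alpha> = \<beta>" if "\<alpha> \<in> hom (HCat D) M one1" "\<beta> \<in> hom (HCat D) M one1" for \<alpha> \<beta> M
      using t1[of M] that homD[OF that(1)] by auto
    show "\<exists>f. f \<in> hom (VCat D) A one0" if "A \<in> Ob (VCat D)" for A
      using t0[OF that] by blast
    show "\<exists>\<alpha>. \<alpha> \<in> hom (HCat D) M one1" if "M \<in> Ob (HCat D)" for M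
      using t1[OF that] by blast
  qed (use d0(1-3) d1(1-3) p1 s1 o1 o2 in \<open>auto simp: cells_def\<close>)
  then show ?thesis
    by (rule that)
qed

theorem corollary5p1p9:
  fixes D :: "('o, 'v, 'h, 'c) dblcat"
  assumes "double_category D"
    and "cartesian_double_category D"
    and "fibrant D"
    and "has_EM_objects D"
  shows "has_tabulators D \<and> (strong_EM_objects D \<longrightarrow> strong_tabulators D)"
proof -
  obtain prod0 fst0 snd0 prod1 fst1 snd1 one0 one1
    where "cart_dbl D prod0 fst0 snd0 prod1 fst1 snd1 one0 one1"
    using cart_dbl_of_cartesian[OF assms(1,2)] .
  then interpret cart_dbl D prod0 fst0 snd0 prod1 fst1 snd1 one0 one1 .
  show ?thesis
    using has_tabulators_of_EM strong_tabulators_of_strong_EM assms(3,4) by blast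
qed

end
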